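(* Let $S$ be any topologically recurrent random walk on $\mathbb R^d$ with state space $\mathcal Z$, and let $A\subset\mathcal Z$ be any $\lambda$-non-trivial Borel set (i.e. $\lambda(A)>0$ and $\lambda(\mathcal Z\setminus A)>0$) with $\lambda(\partial A)=0$. Let $A^c=\mathcal Z\setminus A$ and $$\lambda_A^{entr}(dx):=\mathbb P(X_1\in x-A^c)\,\lambda(dx)\ \text{ on }A,\qquad \lambda_{A^c}^{exit}(dx):=\mathbb P(X_1\in A-x)\,\lambda(dx)\ \text{ on }A^c.$$ Then $\lambda_A^{entr}$ is the unique (up to multiplication by a constant) locally finite Borel measure on $A$ that is invariant for the entrance chain $S^{\rangle A}$, and $\lambda_A^{entr}$ is recurrent and ergodic for $S^{\rangle A}$. Similarly, $\lambda_{A^c}^{exit}$ is the unique (up to multiplication by a constant) locally finite Borel measure on $A^c$ that is invariant for the exit chain $S^{A^c\rangle}$, and $\lambda_{A^c}^{exit}$ is recurrent and ergodic for $S^{A^c\rangle}$.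
   Context: Random walk. $S_n=S_0+X_1+\dots+X_n$, where $X_1,X_2,\dots$ are i.i.d. random vectors in $\mathbb R^d$ (non-degenerate), $d\ge1$, and $S_0$ is independent of them. The state space $\mathcal Z$ is the minimal topologically closed subgroup of $(\mathbb R^d,+)$ containing the topological support of the distribution of $X_1$; it is assumed that $\mathcal Z$ has full dimension and $S_0\in\mathcal Z$. $\mathbb P_x$ denotes the law of the walk with $S_0=x$. $\lambda$ is the Haar measure on $\mathcal Z$ normalized so that $\lambda(\{x\in\mathcal Z:0\le x<1\})=1$ (coordinate-wise inequalities). $S$ is topologically recurrent if $\mathbb P_0(S_n\in G\text{ infinitely often})=1$ for every open neighbourhood $G$ of $0$. $\partial A$ is the boundary in the topology of $\mathcal Z$; $A$ and $A^c$ carry the subspace topologies; a Borel measure is locally finite if every point has an open neighbourhood of finite measure. Entrance and exit chains. $T_0^{\rangle A}:=0$, $T_n^{\rangle A}:=\inf\{k>T_{n-1}^{\rangle A}:S_{k-1}\in A^c,S_k\in A\}$ for $n\ge1$ ($\inf\varnothing=\infty$); $S_n^{\rangle A}:=S_{T_n^{\rangle A}}$, $S_n^{A^c\rangle}:=S_{T_n^{\rangle A}-1}$, with $S_\infty:=\dagger$, a cemetery state. $S^{\rangle A}$ is a Markov chain on $A\cup\{\dagger\}$ with kernel $P_A^{entr}(x,dy)=\mathbb P_x(S_1^{\rangle A}\in dy)$, $x\in A$. $S^{A^c\rangle}$ is a Markov chain on $A^c\cup\{\dagger\}$ with kernel $P_{A^c}^{exit}(x,dy)=\int_A\mathbb P_z(S_1^{A^c\rangle}\in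 dy)\,\mathbb P_x(S_1\in dz\mid S_1\in A)$ for $x\in A^c$ with $\mathbb P_x(S_1\in A)>0$, and $P_{A^c}^{exit}(x,\{\dagger\})=1$ for other $x\in A^c$. For a chain on $E$ (possibly with cemetery, given zero mass) with kernel $K$: a measure $\nu$ on $E$ is invariant if $\int_E K(x,B)\,\nu(dx)=\nu(B)$ for all Borel $B\subset E$; it is recurrent if for every Borel $B\subset E$ with $\nu(B)<\infty$ the chain started at $x$ returns to $B$ at some positive time with probability one for $\nu$-a.e. $x\in B$; it is ergodic if the one-sided shift on sequence space, which preserves the law of the chain started under $\nu$, is ergodic (every set invariant modulo this law is null or co-null). *)

theory Defs
  imports "HOL-Probability.Probability"
begin

section \<open>Locally finite measures and Haar measure\<close>

definition locally_finite_borel_measure_on :: "'a::topological_space set \<Rightarrow> 'a measure \<Rightarrow> bool" where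
  "locally_finite_borel_measure_on E \<nu> \<longleftrightarrow>
     sets \<nu> = sets (restrict_space borel E) \<and>
     (\<forall>x\<in>E. \<exists>U. openin (top_of_set E) U \<and> x \<in> U \<and> emeasure \<nu> U < \<infinity>)"

definition closed_subgroup :: "'a::real_normed_vector set \<Rightarrow> bool" where
  "closed_subgroup H \<longleftrightarrow>
     closed H \<and> 0 \<in> H \<and> (\<forall>x\<in>H. \<forall>y\<in>H. x + y \<in> H) \<and> (\<forall>x\<in>H. - x \<in> H)"

definition topological_support :: "'a::topological_space measure \<Rightarrow> 'a set" where
  "topological_support \<mu> = {x. \<forall>U. open U \<longrightarrow> x \<in> U \<longrightarrow> emeasure \<mu> U > 0}"

definition haar_measure_on :: "'a::real_normed_vector set \<Rightarrow> 'a measure \<Rightarrow> bool" where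
  "haar_measure_on H haar \<longleftrightarrow>
     locally_finite_borel_measure_on H haar \<and> emeasure haar H > 0 \<and>
     (\<forall>z\<in>H. \<forall>B\<in>sets haar. emeasure haar ((+) z ` B) = emeasure haar B)"

text \<open>The normalization \<open>haar {x \<in> H. 0 \<le> x < 1} = 1\<close> is possible if and only if this set is not
  Haar-null. It is null for some oblique non-discrete groups such as
  \<open>{(s + 5 k, 5 k - s) | s real, k integer}\<close> in the plane; there every Haar measure is admitted.\<close>

definition normalized_haar_measure_on :: "(real^'d) set \<Rightarrow> (real^'d) measure \<Rightarrow> bool" where
  "normalized_haar_measure_on H haar \<longleftrightarrow>
     haar_measure_on H haar \<and>
     (let Q = {x\<in>H. \<forall>i. 0 \<le> x $ i \<and> x $ i < 1}
      in emeasure haar Q \<noteq> 0 \<longrightarrow> emeasure haar Q = 1)"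


section \<open>Random walks\<close>

definition state_space :: "'w measure \<Rightarrow> (nat \<Rightarrow> 'w \<Rightarrow> real^'d) \<Rightarrow> (real^'d) set" where
  "state_space M X =
     \<Inter>{H. closed_subgroup H \<and> topological_support (distr M borel (X 1)) \<subseteq> H}"

text \<open>The increments are \<open>X 1, X 2, \<dots>\<close>; the value \<open>X 0\<close> is never used.\<close>

locale random_walk = prob_space M
  for M :: "'w measure" and X :: "nat \<Rightarrow> 'w \<Rightarrow> real^'d" +
  assumes indep_increments: "indep_vars (\<lambda>_. borel) X {1..}"
    and identically_distributed: "\<And>n. n \<ge> 1 \<Longrightarrow> distr M borel (X n) = distr M borel (X 1)"
    and nondegenerate: "\<not> (\<exists>c. AE \<omega> in M. X 1 \<omega> = c)"
    and full_dimension: "dim (state_space M X) = DIM(real^'d)"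

text \<open>The law \<open>P\<^sub>x\<close> of the walk started at \<open>x\<close> is the law under \<open>M\<close> of
  \<open>\<lambda>\<omega>. walk X x \<omega>\<close>.\<close>

definition walk :: "(nat \<Rightarrow> 'w \<Rightarrow> real^'d) \<Rightarrow> real^'d \<Rightarrow> 'w \<Rightarrow> nat \<Rightarrow> real^'d" where
  "walk X x \<omega> n = x + (\<Sum>i=1..n. X i \<omega>)"

definition topologically_recurrent :: "'w measure \<Rightarrow> (nat \<Rightarrow> 'w \<Rightarrow> real^'d) \<Rightarrow> bool" where
  "topologically_recurrent M X \<longleftrightarrow>
     (\<forall>G. open G \<longrightarrow> 0 \<in> G \<longrightarrow>
        measure M {\<omega>\<in>space M. infinite {n. walk X 0 \<omega> n \<in> G}} = 1)"


section \<open>Markov chains with a cemetery state\<close>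

text \<open>The cemetery is \<open>None\<close>. A kernel on \<open>E\<close> assigns to each point of \<open>E\<close> a
  probability measure on \<open>with_cemetery E\<close>; the cemetery itself is absorbing.\<close>

definition with_cemetery :: "'a::topological_space set \<Rightarrow> 'a option measure" where
  "with_cemetery E = sigma (insert None (Some ` E)) ((`) Some ` sets (restrict_space borel E))"

abbreviation path_space :: "'a::topological_space set \<Rightarrow> (nat \<Rightarrow> 'a option) measure" where
  "path_space E \<equiv> PiM UNIV (\<lambda>_. with_cemetery E)"

definition chain_step ::
    "'a::topological_space set \<Rightarrow> ('a \<Rightarrow> 'a option measure) \<Rightarrow> 'a option \<Rightarrow> 'a option measure" where
  "chain_step E K s = (case s of None \<Rightarrow> return (with_cemetery E) None | Some x \<Rightarrow> K x)"

definition chain_transition ::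
    "'a::topological_space set \<Rightarrow> ('a \<Rightarrow> 'a option measure) \<Rightarrow> 'a \<Rightarrow>
      nat \<Rightarrow> (nat \<Rightarrow> 'a option) \<Rightarrow> 'a option measure" where
  "chain_transition E K x n s =
     (case n of 0 \<Rightarrow> return (with_cemetery E) (Some x) | Suc m \<Rightarrow> chain_step E K (s m))"

text \<open>The law on path space of the chain started at \<open>x\<close>, by the Ionescu-Tulcea theorem.\<close>

definition chain_law ::
    "'a::topological_space set \<Rightarrow> ('a \<Rightarrow> 'a option measure) \<Rightarrow> 'a \<Rightarrow> (nat \<Rightarrow> 'a option) measure" where
  "chain_law E K x =
     projective_family.lim UNIV
       (Ionescu_Tulcea.CI (chain_transition E K x) (\<lambda>_. with_cemetery E)) (\<lambda>_. with_cemetery E)"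

text \<open>The law \<open>\<integral> chain_law E K x (\<cdot>) \<nu>(dx)\<close> of the chain started under \<open>\<nu>\<close>; the
  initial measure \<open>\<nu>\<close> need not be finite.\<close>

definition chain_law_under ::
    "'a::topological_space set \<Rightarrow> ('a \<Rightarrow> 'a option measure) \<Rightarrow> 'a measure \<Rightarrow>
      (nat \<Rightarrow> 'a option) measure" where
  "chain_law_under E K \<nu> = \<nu> \<bind> chain_law E K"

definition invariant_for ::
    "('a \<Rightarrow> 'a option measure) \<Rightarrow> 'a measure \<Rightarrow> bool" where
  "invariant_for K \<nu> \<longleftrightarrow>
     (\<forall>B\<in>sets \<nu>. (\<integral>\<^sup>+x. emeasure (K x) (Some ` B) \<partial>\<nu>) = emeasure \<nu> B)"

definition recurrent_for ::
    "'a::topological_space set \<Rightarrow> ('a \<Rightarrow> 'a option measure) \<Rightarrow> 'a measure \<Rightarrow> bool" where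
  "recurrent_for E K \<nu> \<longleftrightarrow>
     (\<forall>B\<in>sets \<nu>. emeasure \<nu> B < \<infinity> \<longrightarrow>
        (AE x in \<nu>. x \<in> B \<longrightarrow>
           measure (chain_law E K x)
             {s\<in>space (path_space E). \<exists>n\<ge>1. s n \<in> Some ` B} = 1))"

definition shift :: "(nat \<Rightarrow> 's) \<Rightarrow> nat \<Rightarrow> 's" where
  "shift s n = s (Suc n)"

definition ergodic_for ::
    "'a::topological_space set \<Rightarrow> ('a \<Rightarrow> 'a option measure) \<Rightarrow> 'a measure \<Rightarrow> bool" where
  "ergodic_for E K \<nu> \<longleftrightarrow>
     (let L = chain_law_under E K \<nu> in
        distr L (path_space E) shift = L \<and>
        (\<forall>W\<in>sets (path_space E).
           sym_diff (shift -` W \<inter> space (path_space E)) W \<in> null_sets L \<longrightarrow>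
           W \<in> null_sets L \<or> space (path_space E) - W \<in> null_sets L))"


section \<open>Entrance and exit chains\<close>

text \<open>In this section \<open>Ac\<close> stands for the complement of \<open>A\<close> in the state space.\<close>

primrec entrance_time ::
    "'a set \<Rightarrow> 'a set \<Rightarrow> (nat \<Rightarrow> 'a) \<Rightarrow> nat \<Rightarrow> enat" where
  "entrance_time A Ac s 0 = 0"
| "entrance_time A Ac s (Suc n) =
     Inf {enat k |k. enat k > entrance_time A Ac s n \<and> s (k - 1) \<in> Ac \<and> s k \<in> A}"

definition entrance_position :: "'a set \<Rightarrow> 'a set \<Rightarrow> (nat \<Rightarrow> 'a) \<Rightarrow> nat \<Rightarrow> 'a option" where
  "entrance_position A Ac s n =
     (case entrance_time A Ac s n of enat k \<Rightarrow> Some (s k) | \<infinity> \<Rightarrow> None)"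

text \<open>Only meaningful for \<open>n \<ge> 1\<close>.\<close>

definition exit_position :: "'a set \<Rightarrow> 'a set \<Rightarrow> (nat \<Rightarrow> 'a) \<Rightarrow> nat \<Rightarrow> 'a option" where
  "exit_position A Ac s n =
     (case entrance_time A Ac s n of enat k \<Rightarrow> Some (s (k - 1)) | \<infinity> \<Rightarrow> None)"

definition entrance_kernel ::
    "'w measure \<Rightarrow> (nat \<Rightarrow> 'w \<Rightarrow> real^'d) \<Rightarrow> (real^'d) set \<Rightarrow> (real^'d) set \<Rightarrow>
      real^'d \<Rightarrow> (real^'d) option measure" where
  "entrance_kernel M X A Ac x =
     distr M (with_cemetery A) (\<lambda>\<omega>. entrance_position A Ac (walk X x \<omega>) 1)"

text \<open>\<open>uniform_measure \<mu> A\<close> is the conditional law \<open>\<mu>(\<cdot> | A)\<close>.\<close>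

definition exit_kernel ::
    "'w measure \<Rightarrow> (nat \<Rightarrow> 'w \<Rightarrow> real^'d) \<Rightarrow> (real^'d) set \<Rightarrow> (real^'d) set \<Rightarrow>
      real^'d \<Rightarrow> (real^'d) option measure" where
  "exit_kernel M X A Ac x =
     (let step = distr M borel (\<lambda>\<omega>. walk X x \<omega> 1) in
      if emeasure step A > 0
      then uniform_measure step A \<bind>
             (\<lambda>z. distr M (with_cemetery Ac) (\<lambda>\<omega>. exit_position A Ac (walk X z \<omega>) 1))
      else return (with_cemetery Ac) None)"

definition entrance_measure ::
    "'w measure \<Rightarrow> (nat \<Rightarrow> 'w \<Rightarrow> real^'d) \<Rightarrow> (real^'d) measure \<Rightarrow> (real^'d) set \<Rightarrow> (real^'d) set \<Rightarrow>
      (real^'d) measure" where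
  "entrance_measure M X haar A Ac =
     density (restrict_space haar A)
       (\<lambda>x. emeasure M {\<omega>\<in>space M. X 1 \<omega> \<in> (\<lambda>y. x - y) ` Ac})"

definition exit_measure ::
    "'w measure \<Rightarrow> (nat \<Rightarrow> 'w \<Rightarrow> real^'d) \<Rightarrow> (real^'d) measure \<Rightarrow> (real^'d) set \<Rightarrow> (real^'d) set \<Rightarrow>
      (real^'d) measure" where
  "exit_measure M X haar A Ac =
     density (restrict_space haar Ac)
       (\<lambda>x. emeasure M {\<omega>\<in>space M. X 1 \<omega> \<in> (\<lambda>y. y - x) ` A})"

definition unique_locally_finite_invariant ::
    "'a::topological_space set \<Rightarrow> ('a \<Rightarrow> 'a option measure) \<Rightarrow> 'a measure \<Rightarrow> bool" where
  "unique_locally_finite_invariant E K \<nu> \<longleftrightarrow>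
     locally_finite_borel_measure_on E \<nu> \<and> invariant_for K \<nu> \<and>
     (\<forall>\<nu>'. locally_finite_borel_measure_on E \<nu>' \<and> invariant_for K \<nu>' \<longrightarrow>
        (\<exists>c\<ge>0. \<nu>' = scale_measure (ennreal c) \<nu>))"

end

theory Submission
  imports Defs
begin

text \<open>Split the transition operator of the walk as \<open>P = Q + R\<close>, where \<open>R\<close> is the part of a step that crosses
  from \<open>A\<^sup>c\<close> to \<open>A\<close>, and put \<open>H = \<Sum>\<^sub>n Q\<^sup>n\<close> and \<open>p = R 1\<close>. The entrance kernel is \<open>H R\<close> and the exit
  kernel is \<open>p\<^sup>-\<^sup>1 R H p\<close>. Recurrence enters through one fact: by topological recurrence, a nonnegative lower
  semicontinuous superharmonic function is constant on \<open>Z\<close>. Applied to \<open>z \<mapsto> m (U - z)\<close> for open \<open>U\<close>, it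
  shows that a locally finite excessive measure \<open>m\<close> of the walk is translation invariant, hence a multiple of
  Haar measure; applied to \<open>z \<mapsto> \<integral> 1\<^sub>U(x - z) F(x) \<lambda>(dx)\<close>, it shows that a bounded superharmonic function
  \<open>F\<close> is constant almost everywhere.

  Uniqueness: a locally finite invariant measure \<open>\<nu>\<close> of the entrance chain gives the invariant measure \<open>\<nu> H\<close> of
  the walk, which therefore is \<open>c \<lambda>\<close>, and \<open>\<nu> = \<nu> H R = c \<lambda> R\<close>. That \<open>\<nu> H\<close> is finite on some open set uses
  \<open>\<lambda>(\<partial>A) = 0\<close>: almost every path enters \<open>A\<close> through its interior, so from a suitable small ball the next
  entrance point lies, with probability bounded away from \<open>0\<close>, in an open set of finite \<open>\<nu>\<close>-measure.
  Recurrence and ergodicity: if \<open>f\<close> is bounded and superharmonic for the entrance chain, then \<open>H R f\<close> is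
  superharmonic for the walk, so \<open>f\<close> is constant almost everywhere. This is applied to hitting probabilities and to
  the conditional probabilities of an invariant event. The exit chain is treated in the same way.\<close>

section \<open>Functionals and lower semicontinuous functions\<close>

text \<open>Measures act from the right below. Invariance of both measures rests on one identity,
  \<open>haar R H = haar\<close>: it gives \<open>(haar R) (H R) = haar R\<close> for the entrance
  chain and \<open>(haar p) p^-1 R H p = haar p\<close> for the exit chain. The usual route to it is
  the reversed walk; here it comes out of the proportionality of excessive measures. Exit uniqueness
  reduces to entrance invariance: if \<nu>' is invariant for the exit chain, then
  \<open>s = \<nu>' p^-1 R\<close> is fixed by \<open>H R\<close>, and \<nu>' is recovered as
  \<open>s H p\<close>. The obstacle is regularity. Recurrence speaks of open sets, but A is only
  Borel, so \<open>Q\<close> and \<open>R\<close> destroy lower semicontinuity. For bounded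
  superharmonic functions, averaging against \<open>haar\<close> restores it. For uniqueness, steps
  are restricted to the interiors of A and its complement, and the null boundary ensures that
  nothing is lost almost everywhere. A measure such as \<open>\<nu> H\<close> might be infinite on
  every open set, so it is treated as a functional with values up to infinity until one open set of
  finite measure has been found.\<close>

definition ennreal_functional :: "(('a::topological_space \<Rightarrow> ennreal) \<Rightarrow> ennreal) \<Rightarrow> bool" where
  "ennreal_functional \<Phi> \<longleftrightarrow>
     (\<forall>f\<in>borel_measurable borel. \<forall>g\<in>borel_measurable borel. \<Phi> (\<lambda>x. f x + g x) = \<Phi> f + \<Phi> g) \<and>
     (\<forall>f\<in>borel_measurable borel. \<forall>c. \<Phi> (\<lambda>x. c * f x) = c * \<Phi> f) \<and>
     (\<forall>f. range f \<subseteq> borel_measurable borel \<longrightarrow> incseq f \<longrightarrow>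
        \<Phi> (\<lambda>x. SUP i. f i x) = (SUP i::nat. \<Phi> (f i)))"

lemma ennreal_functionalI:
  assumes "\<And>f g. f \<in> borel_measurable borel \<Longrightarrow> g \<in> borel_measurable borel \<Longrightarrow>
        \<Phi> (\<lambda>x. f x + g x) = \<Phi> f + \<Phi> g"
    and "\<And>f c. f \<in> borel_measurable borel \<Longrightarrow> \<Phi> (\<lambda>x. c * f x) = c * \<Phi> f"
    and "\<And>f. (\<And>i. f i \<in> borel_measurable borel) \<Longrightarrow> incseq f \<Longrightarrow>
        \<Phi> (\<lambda>x. SUP i. f i x) = (SUP i::nat. \<Phi> (f i))"
  shows "ennreal_functional \<Phi>"
  unfolding ennreal_functional_def image_subset_iff using assms by blast

text \<open>Continuity along increasing sequences is what countable additivity of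
  \<open>B \<mapsto> \<Phi> (indicator B)\<close> and the extension from indicators to functions
  require. Infinite values are allowed, so \<open>f \<mapsto> \<integral> H f d\<nu>\<close> becomes
  a measure before anything is known about its size.\<close>

lemma ennreal_functional_eq_nn_integral:
  fixes \<Phi> :: "('a::topological_space \<Rightarrow> ennreal) \<Rightarrow> ennreal"
  assumes "ennreal_functional \<Phi>"
  obtains m where "sets m = sets borel"
    and "\<And>f. f \<in> borel_measurable borel \<Longrightarrow> (\<integral>\<^sup>+x. f x \<partial>m) = \<Phi> f"
proof
  let ?e = "\<lambda>B. \<Phi> (indicator B)"
  have sum: "\<Phi> (\<lambda>x. f x + g x) = \<Phi> f + \<Phi> g"
    if "f \<in> borel_measurable borel" "g \<in> borel_measurable borel" for f g
    using assms that by (simp add: ennreal_functional_def)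
  have cmult: "\<Phi> (\<lambda>x. c * f x) = c * \<Phi> f" if "f \<in> borel_measurable borel" for f c
    using assms that by (simp add: ennreal_functional_def)
  have sup: "\<Phi> (\<lambda>x. SUP i. f i x) = (SUP i. \<Phi> (f i))"
    if "\<And>i. f i \<in> borel_measurable borel" "incseq f" for f :: "nat \<Rightarrow> _"
    using assms that by (auto simp: ennreal_functional_def image_subset_iff)
  have zero: "\<Phi> (\<lambda>x. 0) = 0"
    using cmult[of "\<lambda>x. 0" 0] by simp
  have mono: "\<Phi> f \<le> \<Phi> g" if "f \<in> borel_measurable borel" "g \<in> borel_measurable borel" "f \<le> g" for f g
  proof -
    \<comment> \<open>Monotonicity is not an axiom; it follows from continuity along the sequence f,
      g, g, and so on.\<close>
    let ?s = "\<lambda>i::nat. if i = 0 then f else g"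
    have i: "incseq ?s"
      using that by (auto simp: incseq_def le_fun_def)
    have "\<And>i. ?s i \<in> borel_measurable borel" using that by simp
    from sup[of ?s, OF this i]
    have "\<Phi> (\<lambda>x. SUP i::nat. ?s i x) = (SUP i::nat. \<Phi> (?s i))" .
    moreover have "(SUP i::nat. (if i = 0 then f else g) x) = g x" for x
      using that(3) by (intro antisym SUP_least SUP_upper2[of 1]) (auto simp: le_fun_def)
    ultimately have "\<Phi> g = (SUP i::nat. \<Phi> (if i = 0 then f else g))" by simp
    moreover have "\<Phi> (?s 0) \<le> (SUP i. \<Phi> (?s i))" by (rule SUP_upper) simp
    ultimately show ?thesis by simp
  qed
  have fin: "\<Phi> (\<lambda>x. \<Sum>i<n. f i x) = (\<Sum>i<n. \<Phi> (f i))" if [measurable]: "\<And>i. f i \<in> borel_measurable borel" for f and n :: nat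
    by (induction n) (auto simp: zero sum)
  have sums: "\<Phi> (\<lambda>x. \<Sum>i. f i x) = (\<Sum>i. \<Phi> (f i))" if [measurable]: "\<And>i. f i \<in> borel_measurable borel" for f :: "nat \<Rightarrow> _"
  proof -
    have "(\<lambda>x. \<Sum>i. f i x) = (\<lambda>x. SUP n. \<Sum>i<n. f i x)"
      by (simp add: suminf_eq_SUP)
    moreover have "\<Phi> \<dots> = (SUP n. \<Phi> (\<lambda>x. \<Sum>i<n. f i x))"
      by (rule sup) (auto simp: incseq_def le_fun_def intro!: sum_mono2)
    ultimately show ?thesis by (simp add: fin suminf_eq_SUP)
  qed
  define m where "m = measure_of UNIV (sets borel) ?e"
  show sets_m: "sets m = sets borel" unfolding m_def
    using sets.sigma_sets_eq[of "borel :: 'a measure"] by simp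
  have em: "emeasure m B = \<Phi> (indicator B)" if "B \<in> sets borel" for B
  proof (rule emeasure_measure_of[OF m_def])
    have "indicator {} = (\<lambda>x::'a. 0 :: ennreal)" by (simp add: fun_eq_iff)
    then show "positive (sets m) ?e" by (simp add: positive_def zero)
    show "countably_additive (sets m) ?e"
    proof (rule countably_additiveI)
      fix F :: "nat \<Rightarrow> 'a set" assume F: "range F \<subseteq> sets m" "disjoint_family F"
      have [measurable]: "F i \<in> sets borel" for i using F(1) by (auto simp: sets_m)
      show "(\<Sum>i. \<Phi> (indicator (F i))) = \<Phi> (indicator (\<Union> (range F)))"
        by (subst sums[symmetric]) (auto simp: suminf_indicator[OF F(2)])
    qed
  qed (use that sets_m in auto)
  note [measurable_cong] = sets_m
  show "(\<integral>\<^sup>+x. f x \<partial>m) = \<Phi> f" if "f \<in> borel_measurable borel" for f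
    using that
  proof (induction rule: borel_measurable_induct)
    case (cong f g) then show ?case by (metis UNIV_I ext space_borel)
  next
    case (set B) then show ?case using em[of B] sets_m by (simp add: nn_integral_indicator)
  next
    case (mult u c)
    then show ?case by (simp add: cmult nn_integral_cmult)
  next
    case (add u v)
    then show ?case using sum by (simp add: nn_integral_add)
  next
    case (seq U)
    then have [measurable]: "\<And>i. U i \<in> borel_measurable m" by simp
    have "(\<integral>\<^sup>+x. (SUP i. U i x) \<partial>m) = (SUP i. \<integral>\<^sup>+x. U i x \<partial>m)"
      by (rule nn_integral_monotone_convergence_SUP) (use seq in auto)
    with seq sup[of U] show ?case by (simp add: SUP_apply image_comp)
  qed
qed

text \<open>The two representing measures agree on every Borel set, not merely on a generator, so
  there is no ambiguity when they are not sigma-finite.\<close>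

lemma ennreal_functional_eqI:
  assumes "ennreal_functional \<Phi>" "ennreal_functional \<Psi>"
    and eq: "\<And>B. B \<in> sets borel \<Longrightarrow> \<Phi> (indicator B) = \<Psi> (indicator B)"
    and f: "f \<in> borel_measurable borel"
  shows "\<Phi> f = \<Psi> f"
proof -
  obtain m where m: "sets m = sets borel" "\<And>f. f \<in> borel_measurable borel \<Longrightarrow> (\<integral>\<^sup>+x. f x \<partial>m) = \<Phi> f"
    by (rule ennreal_functional_eq_nn_integral[OF assms(1)]) (rule that)
  obtain m' where m': "sets m' = sets borel" "\<And>f. f \<in> borel_measurable borel \<Longrightarrow> (\<integral>\<^sup>+x. f x \<partial>m') = \<Psi> f"
    by (rule ennreal_functional_eq_nn_integral[OF assms(2)]) (rule that)
  have "m = m'"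
  proof (rule measure_eqI)
    fix B assume "B \<in> sets m"
    then have B: "B \<in> sets borel" by (simp add: m)
    then show "emeasure m B = emeasure m' B"
      using m(2)[of "indicator B"] m'(2)[of "indicator B"] eq[OF B] m(1) m'(1) by simp
  qed (simp add: m m')
  then show ?thesis using m(2)[OF f] m'(2)[OF f] by simp
qed

lemma ennreal_functional_nn_integral:
  fixes \<Phi> :: "'b \<Rightarrow> ('a::topological_space \<Rightarrow> ennreal) \<Rightarrow> ennreal"
  assumes \<Phi>: "\<And>x. x \<in> space M \<Longrightarrow> ennreal_functional (\<Phi> x)"
    and meas: "\<And>f. f \<in> borel_measurable borel \<Longrightarrow> (\<lambda>x. \<Phi> x f) \<in> borel_measurable M"
  shows "ennreal_functional (\<lambda>f. \<integral>\<^sup>+x. \<Phi> x f \<partial>M)"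
proof (rule ennreal_functionalI)
  fix f g :: "'a \<Rightarrow> ennreal"
  assume fg: "f \<in> borel_measurable borel" "g \<in> borel_measurable borel"
  have "(\<integral>\<^sup>+x. \<Phi> x (\<lambda>x. f x + g x) \<partial>M) = (\<integral>\<^sup>+x. \<Phi> x f + \<Phi> x g \<partial>M)"
    using \<Phi> fg by (intro nn_integral_cong) (simp add: ennreal_functional_def)
  then show "(\<integral>\<^sup>+x. \<Phi> x (\<lambda>x. f x + g x) \<partial>M) = (\<integral>\<^sup>+x. \<Phi> x f \<partial>M) + (\<integral>\<^sup>+x. \<Phi> x g \<partial>M)"
    using meas fg by (simp add: nn_integral_add)
next
  fix f :: "'a \<Rightarrow> ennreal" and c
  assume f: "f \<in> borel_measurable borel"
  have "(\<integral>\<^sup>+x. \<Phi> x (\<lambda>x. c * f x) \<partial>M) = (\<integral>\<^sup>+x. c * \<Phi> x f \<partial>M)"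
    using \<Phi> f by (intro nn_integral_cong) (simp add: ennreal_functional_def)
  then show "(\<integral>\<^sup>+x. \<Phi> x (\<lambda>x. c * f x) \<partial>M) = c * (\<integral>\<^sup>+x. \<Phi> x f \<partial>M)"
    using meas f by (simp add: nn_integral_cmult)
next
  fix f :: "nat \<Rightarrow> 'a \<Rightarrow> ennreal"
  assume f: "\<And>i. f i \<in> borel_measurable borel" and inc: "incseq f"
  \<comment> \<open>Monotone convergence under the outer integral needs each functional to be
    monotone, which is read off its representing measure.\<close>
  have mono: "\<Phi> x (f i) \<le> \<Phi> x (f j)" if x: "x \<in> space M" and ij: "i \<le> j" for x i j
  proof -
    obtain m where "sets m = sets borel"
      and m: "\<And>f. f \<in> borel_measurable borel \<Longrightarrow> (\<integral>\<^sup>+x. f x \<partial>m) = \<Phi> x f"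
      by (rule ennreal_functional_eq_nn_integral[OF \<Phi>[OF x]]) (rule that)
    have "\<Phi> x (f i) = (\<integral>\<^sup>+x. f i x \<partial>m)" "\<Phi> x (f j) = (\<integral>\<^sup>+x. f j x \<partial>m)"
      using m[OF f] by simp_all
    then show ?thesis using inc ij by (auto intro!: nn_integral_mono simp: incseq_def le_fun_def)
  qed
  have "(\<integral>\<^sup>+x. \<Phi> x (\<lambda>x. SUP i. f i x) \<partial>M) = (\<integral>\<^sup>+x. (SUP i. \<Phi> x (f i)) \<partial>M)"
    using \<Phi> f inc by (intro nn_integral_cong) (auto simp: ennreal_functional_def image_subset_iff)
  also have "\<dots> = (SUP i. \<integral>\<^sup>+x. \<Phi> x (f i) \<partial>M)"
    using mono meas f
    by (intro nn_integral_monotone_convergence_SUP_AE) auto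
  finally show "(\<integral>\<^sup>+x. \<Phi> x (\<lambda>x. SUP i. f i x) \<partial>M) = (SUP i. \<integral>\<^sup>+x. \<Phi> x (f i) \<partial>M)" .
qed

section \<open>Lower semicontinuous functions with values up to infinity\<close>

definition lsc :: "('a::topological_space \<Rightarrow> ennreal) \<Rightarrow> bool" where
  "lsc f \<longleftrightarrow> (\<forall>a. open {x. a < f x})"

lemma lsc_measurable: "lsc f \<Longrightarrow> f \<in> borel_measurable borel"
  by (rule borel_measurableI_greater) (auto simp: lsc_def)

lemma lsc_compose: "lsc f \<Longrightarrow> continuous_on UNIV g \<Longrightarrow> lsc (\<lambda>x. f (g x))"
  unfolding lsc_def
proof
  fix a assume "\<forall>a. open {x. a < f x}" "continuous_on UNIV g"
  then have "open (g -` {x. a < f x})" by (intro open_vimage) auto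
  then show "open {x. a < f (g x)}" by (simp add: vimage_def)
qed

lemma lsc_indicator: "open U \<Longrightarrow> lsc (indicator U)"
  unfolding lsc_def
proof
  fix a assume "open U"
  have "{x. a < (indicator U x :: ennreal)} = (if a < 1 then U else {})"
    by (auto simp: indicator_def split: if_splits)
  then show "open {x. a < (indicator U x :: ennreal)}" using \<open>open U\<close> by simp
qed

lemma lsc_indicator_mult: "open U \<Longrightarrow> lsc f \<Longrightarrow> lsc (\<lambda>x. indicator U x * f x)"
  unfolding lsc_def
proof
  fix a assume "open U" "\<forall>a. open {x. a < f x}"
  moreover have "{x. a < indicator U x * f x} = U \<inter> {x. a < f x}"
    by (auto simp: indicator_def split: if_splits)
  ultimately show "open {x. a < indicator U x * f x}" by auto
qed

text \<open>Fatou's lemma; first countability lets the closed sublevel sets be recognised by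
  sequences.\<close>

lemma lsc_nn_integral:
  fixes f :: "'a::first_countable_topology \<Rightarrow> 'b \<Rightarrow> ennreal"
  assumes [measurable]: "\<And>x. f x \<in> borel_measurable M" and lsc: "\<And>y. lsc (\<lambda>x. f x y)"
  shows "lsc (\<lambda>x. \<integral>\<^sup>+y. f x y \<partial>M)"
  unfolding lsc_def
proof
  fix a
  have "closed {x. (\<integral>\<^sup>+y. f x y \<partial>M) \<le> a}"
    unfolding closed_sequential_limits
  proof (intro allI impI, elim conjE)
    fix s x assume s: "\<forall>n. s n \<in> {x. (\<integral>\<^sup>+y. f x y \<partial>M) \<le> a}" "s \<longlonglongrightarrow> x"
    have "f x y \<le> liminf (\<lambda>n. f (s n) y)" for y
    proof (rule ccontr)
      assume "\<not> f x y \<le> liminf (\<lambda>n. f (s n) y)"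
      then have "liminf (\<lambda>n. f (s n) y) < f x y" by simp
      then obtain b where b: "liminf (\<lambda>n. f (s n) y) < b" "b < f x y"
        using dense by blast
      have "\<forall>\<^sub>F n in sequentially. s n \<in> {x. b < f x y}"
        using lsc[of y] b(2) by (intro topological_tendstoD[OF s(2)]) (auto simp: lsc_def)
      then have "b \<le> liminf (\<lambda>n. f (s n) y)"
        by (intro Liminf_bounded) (auto elim: eventually_mono)
      with b(1) show False by simp
    qed
    then have "(\<integral>\<^sup>+y. f x y \<partial>M) \<le> (\<integral>\<^sup>+y. liminf (\<lambda>n. f (s n) y) \<partial>M)"
      by (intro nn_integral_mono)
    also have "\<dots> \<le> liminf (\<lambda>n. \<integral>\<^sup>+y. f (s n) y \<partial>M)"
      by (rule nn_integral_liminf) simp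
    also have "\<dots> \<le> a"
      using s(1) by (intro Liminf_le) (auto intro!: always_eventually)
    finally show "x \<in> {x. (\<integral>\<^sup>+y. f x y \<partial>M) \<le> a}" by simp
  qed
  then show "open {x. a < (\<integral>\<^sup>+y. f x y \<partial>M)}"
    by (simp add: closed_def Compl_eq not_le)
qed

section \<open>Locally finite measures on second countable spaces\<close>

lemma locally_finite_countable_cover:
  fixes m :: "'a::second_countable_topology measure"
  assumes "\<And>x. \<exists>U. open U \<and> x \<in> U \<and> emeasure m U < \<infinity>"
  obtains C where "countable C" "\<And>U. U \<in> C \<Longrightarrow> open U \<and> emeasure m U < \<infinity>" "\<Union>C = UNIV"
proof -
  let ?F = "{U. open U \<and> emeasure m U < \<infinity>}"
  have "\<Union>?F = UNIV" using assms by auto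
  moreover obtain F' where "F' \<subseteq> ?F" "countable F'" "\<Union>F' = \<Union>?F"
    using Lindelof[of ?F] by auto
  ultimately show ?thesis by (intro that[of F']) auto
qed

lemma sigma_finite_locally_finite:
  fixes m :: "'a::second_countable_topology measure"
  assumes "sets m = sets borel" "\<And>x. \<exists>U. open U \<and> x \<in> U \<and> emeasure m U < \<infinity>"
  shows "sigma_finite_measure m"
proof
  obtain C where "countable C" "\<And>U. U \<in> C \<Longrightarrow> open U \<and> emeasure m U < \<infinity>" "\<Union>C = UNIV"
    using locally_finite_countable_cover[OF assms(2)] by metis
  then show "\<exists>A. countable A \<and> A \<subseteq> sets m \<and> \<Union> A = space m \<and> (\<forall>a\<in>A. emeasure m a \<noteq> \<infinity>)"
    using assms(1) sets_eq_imp_space_eq[OF assms(1)]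
    by (intro exI[of _ C]) (auto simp: less_top)
qed

lemma measure_eqI_open:
  fixes m m' :: "'a::second_countable_topology measure"
  assumes "sets m = sets borel" "sets m' = sets borel"
    and "\<And>x. \<exists>U. open U \<and> x \<in> U \<and> emeasure m U < \<infinity>"
    and eq: "\<And>U. open U \<Longrightarrow> emeasure m U = emeasure m' U"
  shows "m = m'"
proof -
  obtain C where C: "countable C" "\<And>U. U \<in> C \<Longrightarrow> open U \<and> emeasure m U < \<infinity>" "\<Union>C = UNIV"
    using locally_finite_countable_cover[OF assms(3)] by metis
  show ?thesis
  proof (rule measure_eqI_generator_eq_countable[where E="Collect open" and \<Omega>=UNIV and A=C])
    show "sets m = sigma_sets UNIV (Collect open)" "sets m' = sigma_sets UNIV (Collect open)"
      by (auto simp: assms(1,2) borel_def)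
    show "emeasure m U \<noteq> \<infinity>" if "U \<in> C" for U using C(2)[OF that] by (auto simp: less_top)
  qed (use C eq in \<open>auto simp: Int_stable_def\<close>)
qed

section \<open>The step operator of a random walk\<close>

text \<open>Restricting the pair of start and end rather than single points lets one operator
  express the full step (\<open>W = UNIV\<close>), the crossing and the non-crossing steps and, for
  open W, steps that preserve lower semicontinuity.\<close>

definition step :: "'a::euclidean_space measure \<Rightarrow> ('a \<times> 'a) set \<Rightarrow> ('a \<Rightarrow> ennreal) \<Rightarrow> 'a \<Rightarrow> ennreal" where
  "step \<mu> W f x = (\<integral>\<^sup>+y. indicator W (x, x + y) * f (x + y) \<partial>\<mu>)"

locale subgroup_walk = prob_space \<mu> for \<mu> :: "'a::euclidean_space measure" +
  fixes Z :: "'a set"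
  assumes sets_law[measurable_cong, simp]: "sets \<mu> = sets borel"
    and subgroup: "closed_subgroup Z"
    and AE_in_subgroup: "AE y in \<mu>. y \<in> Z"
begin

lemma Z_closed: "closed Z" and Z_zero: "0 \<in> Z"
  and Z_add: "x \<in> Z \<Longrightarrow> y \<in> Z \<Longrightarrow> x + y \<in> Z"
  and Z_minus: "x \<in> Z \<Longrightarrow> - x \<in> Z"
  using subgroup by (auto simp: closed_subgroup_def)

lemma Z_diff: "x \<in> Z \<Longrightarrow> y \<in> Z \<Longrightarrow> x - y \<in> Z"
  using Z_add[of x "- y"] Z_minus[of y] by simp

lemma Z_borel[measurable]: "Z \<in> sets borel"
  using Z_closed by (rule borel_closed)

lemma step_measurable[measurable]:
  assumes [measurable]: "W \<in> sets borel" "f \<in> borel_measurable borel"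
  shows "step \<mu> W f \<in> borel_measurable borel"
proof -
  have [measurable]: "W \<in> sets (borel \<Otimes>\<^sub>M borel)" using assms(1) unfolding borel_prod .
  show ?thesis unfolding step_def by measurable
qed

lemma step_integrand_measurable[measurable]:
  fixes x :: 'a
  assumes [measurable]: "W \<in> sets borel" "f \<in> borel_measurable borel"
  shows "(\<lambda>y. indicator W (x, x + y) * f (x + y) :: ennreal) \<in> borel_measurable borel"
proof -
  have [measurable]: "W \<in> sets (borel \<Otimes>\<^sub>M borel)" using assms(1) unfolding borel_prod .
  show ?thesis by measurable
qed

lemma step_add:
  assumes [measurable]: "W \<in> sets borel" "f \<in> borel_measurable borel" "g \<in> borel_measurable borel"
  shows "step \<mu> W (\<lambda>x. f x + g x) x = step \<mu> W f x + step \<mu> W g x"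
  unfolding step_def by (simp add: distrib_left nn_integral_add)

lemma step_cmult:
  assumes [measurable]: "W \<in> sets borel" "f \<in> borel_measurable borel"
  shows "step \<mu> W (\<lambda>x. c * f x) x = c * step \<mu> W f x"
  unfolding step_def by (simp add: mult.left_commute[of _ c] nn_integral_cmult)

lemma step_SUP:
  assumes [measurable]: "W \<in> sets borel" "\<And>i. f i \<in> borel_measurable borel" and "incseq f"
  shows "step \<mu> W (\<lambda>x. SUP i::nat. f i x) x = (SUP i. step \<mu> W (f i) x)"
  unfolding step_def
  by (subst nn_integral_monotone_convergence_SUP[symmetric])
     (use assms in \<open>auto simp: incseq_def le_fun_def SUP_mult_left_ennreal intro!: mult_left_mono\<close>)

text \<open>The walk almost surely stays in Z, so comparing integrands at points of Z is
  enough.\<close>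

lemma step_mono_Z:
  assumes "x \<in> Z" "\<And>y. y \<in> Z \<Longrightarrow> indicator W (x, y) * f y \<le> indicator W' (x, y) * g y"
  shows "step \<mu> W f x \<le> step \<mu> W' g x"
  unfolding step_def using AE_in_subgroup
  by (intro nn_integral_mono_AE) (auto elim!: eventually_mono intro: assms(2) Z_add[OF assms(1)])

lemma step_mono: "W \<subseteq> W' \<Longrightarrow> f \<le> g \<Longrightarrow> step \<mu> W f x \<le> step \<mu> W' g x"
  unfolding step_def
  by (intro nn_integral_mono mult_mono) (auto simp: indicator_def le_fun_def)

lemma step_Un:
  assumes [measurable]: "W \<in> sets borel" "W' \<in> sets borel" "f \<in> borel_measurable borel" and "W \<inter> W' = {}"
  shows "step \<mu> (W \<union> W') f x = step \<mu> W f x + step \<mu> W' f x"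
  unfolding step_def
  by (subst nn_integral_add[symmetric])
     (use assms(4) in \<open>auto intro!: nn_integral_cong simp: indicator_def distrib_right[symmetric]\<close>)

lemma lsc_step:
  assumes "open W" "lsc f"
  shows "lsc (step \<mu> W f)"
  unfolding step_def
proof (rule lsc_nn_integral)
  have [measurable]: "W \<in> sets borel" "f \<in> borel_measurable borel"
    using assms by (auto intro: lsc_measurable)
  show "(\<lambda>y. indicator W (x, x + y) * f (x + y)) \<in> borel_measurable \<mu>" for x by measurable
  show "lsc (\<lambda>x. indicator W (x, x + y) * f (x + y))" for y
  proof -
    have "open ((\<lambda>x. (x, x + y)) -` W)"
      by (intro open_vimage assms continuous_intros)
    moreover have "lsc (\<lambda>x. f (x + y))"
      by (rule lsc_compose[OF assms(2)]) (intro continuous_intros)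
    ultimately have "lsc (\<lambda>x. indicator ((\<lambda>x. (x, x + y)) -` W) x * f (x + y))"
      by (rule lsc_indicator_mult)
    then show ?thesis by (simp add: indicator_def)
  qed
qed

lemma step_pow_measurable[measurable]:
  assumes [measurable]: "W \<in> sets borel" "f \<in> borel_measurable borel"
  shows "(step \<mu> W ^^ n) f \<in> borel_measurable borel"
  by (induction n) auto

lemma step_pow_add:
  assumes [measurable]: "W \<in> sets borel" "f \<in> borel_measurable borel" "g \<in> borel_measurable borel"
  shows "(step \<mu> W ^^ n) (\<lambda>x. f x + g x) = (\<lambda>x. (step \<mu> W ^^ n) f x + (step \<mu> W ^^ n) g x)"
  by (induction n) (auto simp: step_add)

lemma step_pow_cmult:
  assumes [measurable]: "W \<in> sets borel" "f \<in> borel_measurable borel"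
  shows "(step \<mu> W ^^ n) (\<lambda>x. c * f x) = (\<lambda>x. c * (step \<mu> W ^^ n) f x)"
  by (induction n) (auto simp: step_cmult)

lemma step_pow_mono: "f \<le> g \<Longrightarrow> (step \<mu> W ^^ n) f \<le> (step \<mu> W ^^ n) g"
  by (induction n) (auto intro!: le_funI step_mono)

lemma step_pow_SUP:
  assumes [measurable]: "W \<in> sets borel" "\<And>i. f i \<in> borel_measurable borel" and "incseq f"
  shows "(step \<mu> W ^^ n) (\<lambda>x. SUP i::nat. f i x) = (\<lambda>x. SUP i. (step \<mu> W ^^ n) (f i) x)"
proof (induction n)
  case (Suc n)
  have "incseq (\<lambda>i. (step \<mu> W ^^ n) (f i))"
    using assms(3) by (auto simp: incseq_def intro!: step_pow_mono)
  then show ?case by (simp add: Suc step_SUP)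
qed simp

section \<open>The potential of a restricted step\<close>

definition potential :: "('a \<times> 'a) set \<Rightarrow> ('a \<Rightarrow> ennreal) \<Rightarrow> 'a \<Rightarrow> ennreal" where
  "potential W f x = (\<Sum>n. (step \<mu> W ^^ n) f x)"

lemma potential_measurable[measurable]:
  assumes [measurable]: "W \<in> sets borel" "f \<in> borel_measurable borel"
  shows "potential W f \<in> borel_measurable borel"
  unfolding potential_def by measurable

lemma potential_add:
  assumes [measurable]: "W \<in> sets borel" "f \<in> borel_measurable borel" "g \<in> borel_measurable borel"
  shows "potential W (\<lambda>x. f x + g x) = (\<lambda>x. potential W f x + potential W g x)"
  by (simp add: potential_def[abs_def] step_pow_add suminf_add[symmetric])

lemma potential_cmult:
  assumes [measurable]: "W \<in> sets borel" "f \<in> borel_measurable borel"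
  shows "potential W (\<lambda>x. c * f x) = (\<lambda>x. c * potential W f x)"
  by (simp add: potential_def[abs_def] step_pow_cmult ennreal_suminf_cmult)

lemma potential_mono: "f \<le> g \<Longrightarrow> potential W f \<le> potential W g"
  by (auto simp: potential_def le_fun_def intro!: suminf_le step_pow_mono[THEN le_funD])

lemma potential_SUP:
  assumes [measurable]: "W \<in> sets borel" "\<And>i. f i \<in> borel_measurable borel" and "incseq f"
  shows "potential W (\<lambda>x. SUP i::nat. f i x) = (\<lambda>x. SUP i. potential W (f i) x)"
proof
  fix x
  have "incseq (\<lambda>i. (step \<mu> W ^^ n) (f i) x)" for n
    using assms(3) unfolding incseq_def by (blast intro: step_pow_mono[THEN le_funD])
  then show "potential W (\<lambda>x. SUP i::nat. f i x) x = (SUP i. potential W (f i) x)"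
    by (simp add: potential_def step_pow_SUP[OF assms] ennreal_suminf_SUP_eq)
qed

lemma step_suminf:
  assumes [measurable]: "W \<in> sets borel" "\<And>i. f i \<in> borel_measurable borel"
  shows "step \<mu> W (\<lambda>x. \<Sum>i. f i x) x = (\<Sum>i. step \<mu> W (f i) x)"
  unfolding step_def by (subst nn_integral_suminf[symmetric]) (auto simp: ennreal_suminf_cmult)

lemma potential_unfold:
  assumes [measurable]: "W \<in> sets borel" "f \<in> borel_measurable borel"
  shows "potential W f x = f x + step \<mu> W (potential W f) x"
proof -
  have "step \<mu> W (potential W f) x = (\<Sum>n. (step \<mu> W ^^ Suc n) f x)"
    unfolding potential_def[abs_def] by (subst step_suminf) simp_all
  then show ?thesis
    using suminf_offset[of "\<lambda>n. (step \<mu> W ^^ n) f x" 1] by (simp add: potential_def)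
qed

text \<open>Here the extra step comes last, in \<open>potential_unfold\<close> it comes first.
  Integrated against a measure s, this form reads \<open>m = s + m W\<close> for the measure m that
  is s followed by the potential.\<close>

lemma potential_unfold_right:
  assumes [measurable]: "W \<in> sets borel" "f \<in> borel_measurable borel"
  shows "potential W f x = f x + potential W (step \<mu> W f) x"
  using suminf_offset[of "\<lambda>n. (step \<mu> W ^^ n) f x" 1]
  by (simp add: potential_def funpow_swap1)

lemma potential_step_pow_le:
  "potential W ((step \<mu> W ^^ n) f) x \<le> potential W f x"
proof -
  have "(\<Sum>k. (step \<mu> W ^^ (k + n)) f x) \<le> (\<Sum>k. (step \<mu> W ^^ k) f x)"
    using suminf_offset[of "\<lambda>k. (step \<mu> W ^^ k) f x" n] by simp
  then show ?thesis by (simp add: potential_def funpow_add)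
qed

section \<open>The law of the increment sequence\<close>

abbreviation path_law :: "(nat \<Rightarrow> 'a) measure" where
  "path_law \<equiv> PiM UNIV (\<lambda>_. \<mu>)"

definition pos :: "'a \<Rightarrow> (nat \<Rightarrow> 'a) \<Rightarrow> nat \<Rightarrow> 'a" where
  "pos x \<omega> n = x + (\<Sum>i<n. \<omega> i)"

lemma pos_0[simp]: "pos x \<omega> 0 = x"
  by (simp add: pos_def)

lemma pos_case_nat: "pos x (case_nat y \<omega>) (Suc n) = pos (x + y) \<omega> n"
  by (simp add: pos_def sum.lessThan_Suc_shift add.assoc del: sum.lessThan_Suc)

lemma pos_measurable[measurable]: "(\<lambda>\<omega>. pos x \<omega> n) \<in> borel_measurable (PiM UNIV (\<lambda>_. borel))"
  unfolding pos_def by measurable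

lemma pos_measurable2[measurable]:
  "(\<lambda>p. pos (fst p) (snd p) n) \<in> borel_measurable (borel \<Otimes>\<^sub>M PiM UNIV (\<lambda>_. borel))"
  unfolding pos_def by measurable

lemma sets_path_law[measurable_cong, simp]: "sets path_law = sets (PiM UNIV (\<lambda>_. borel))"
  by (intro sets_PiM_cong) auto

lemma prob_space_path_law: "prob_space path_law"
  by (rule prob_space_PiM) unfold_locales

text \<open>Markov property at time one: an i.i.d. sequence is one increment followed by an
  independent copy of the sequence.\<close>

lemma nn_integral_path_law:
  assumes [measurable]: "f \<in> borel_measurable (PiM UNIV (\<lambda>_. borel))"
  shows "(\<integral>\<^sup>+\<omega>. f \<omega> \<partial>path_law) = (\<integral>\<^sup>+y. \<integral>\<^sup>+\<omega>. f (case_nat y \<omega>) \<partial>path_law \<partial>\<mu>)"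
proof -
  interpret sequence_space \<mu>
    by unfold_locales
  have "(\<integral>\<^sup>+\<omega>. f \<omega> \<partial>path_law) = (\<integral>\<^sup>+\<omega>. f \<omega> \<partial>distr (\<mu> \<Otimes>\<^sub>M path_law) path_law (\<lambda>(s, \<omega>). case_nat s \<omega>))"
    by (simp add: PiM_iter)
  also have "\<dots> = (\<integral>\<^sup>+p. f (case_nat (fst p) (snd p)) \<partial>(\<mu> \<Otimes>\<^sub>M path_law))"
    by (subst nn_integral_distr) (auto simp: case_prod_beta)
  also have "\<dots> = (\<integral>\<^sup>+y. \<integral>\<^sup>+\<omega>. f (case_nat y \<omega>) \<partial>path_law \<partial>\<mu>)"
    by (subst sigma_finite_measure.nn_integral_fst[OF prob_space_imp_sigma_finite[OF prob_space_path_law], symmetric]) auto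
  finally show ?thesis .
qed

lemma emeasure_path_law:
  assumes [measurable]: "Measurable.pred (PiM UNIV (\<lambda>_. borel)) P"
  shows "emeasure path_law {\<omega>\<in>space path_law. P \<omega>} =
    (\<integral>\<^sup>+y. emeasure path_law {\<omega>\<in>space path_law. P (case_nat y \<omega>)} \<partial>\<mu>)"
proof -
  have "emeasure path_law {\<omega>\<in>space path_law. P \<omega>} = (\<integral>\<^sup>+\<omega>. indicator {\<omega>. P \<omega>} \<omega> \<partial>path_law)"
  proof -
    have "{\<omega>\<in>space path_law. P \<omega>} \<in> sets path_law" by measurable
    from nn_integral_indicator[OF this] show ?thesis
      by (subst eq_commute, elim subst) (auto simp: indicator_def intro!: nn_integral_cong)
  qed
  also have "\<dots> = (\<integral>\<^sup>+y. \<integral>\<^sup>+\<omega>. indicator {\<omega>. P \<omega>} (case_nat y \<omega>) \<partial>path_law \<partial>\<mu>)"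
    by (rule nn_integral_path_law) measurable
  also have "\<dots> = (\<integral>\<^sup>+y. emeasure path_law {\<omega>\<in>space path_law. P (case_nat y \<omega>)} \<partial>\<mu>)"
  proof (rule nn_integral_cong)
    fix y :: 'a
    have [measurable]: "(\<lambda>\<omega>. case_nat y \<omega>) \<in> PiM UNIV (\<lambda>_. borel) \<rightarrow>\<^sub>M PiM UNIV (\<lambda>_. borel)"
      by measurable
    have "Measurable.pred (PiM UNIV (\<lambda>_. borel)) (\<lambda>\<omega>. P (case_nat y \<omega>))" by measurable
    then have "{\<omega>\<in>space path_law. P (case_nat y \<omega>)} \<in> sets path_law" by measurable
    from nn_integral_indicator[OF this]
    show "(\<integral>\<^sup>+\<omega>. indicator {\<omega>. P \<omega>} (case_nat y \<omega>) \<partial>path_law) = emeasure path_law {\<omega>\<in>space path_law. P (case_nat y \<omega>)}"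
      by (elim subst) (auto simp: indicator_def intro!: nn_integral_cong)
  qed
  finally show ?thesis .
qed

lemma AE_path_in_Z: "AE \<omega> in path_law. \<forall>i. \<omega> i \<in> Z"
proof -
  show ?thesis
    unfolding AE_all_countable
    using AE_PiM_component[of UNIV "\<lambda>_. \<mu>" _ "\<lambda>y. y \<in> Z"] AE_in_subgroup prob_space_axioms by auto
qed

end

section \<open>Superharmonic functions of a recurrent walk\<close>

lemma ex_le_Suc: "(\<exists>k\<le>Suc n. P k) \<longleftrightarrow> P 0 \<or> (\<exists>k\<le>n. P (Suc k))"
proof
  assume "\<exists>k\<le>Suc n. P k"
  then obtain k where "k \<le> Suc n" "P k" by blast
  then show "P 0 \<or> (\<exists>k\<le>n. P (Suc k))" by (cases k) auto
qed auto

context subgroup_walk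
begin

lemma step_UNIV_pow_visit:
  assumes [measurable]: "G \<in> sets borel"
  shows "emeasure path_law {\<omega>\<in>space path_law. pos x \<omega> n \<in> G} = (step \<mu> UNIV ^^ n) (indicator G) x"
proof (induction n arbitrary: x)
  case 0
  interpret P: prob_space path_law by (rule prob_space_path_law)
  show ?case using P.emeasure_space_1 by (auto simp: indicator_def)
next
  case (Suc n)
  have "emeasure path_law {\<omega>\<in>space path_law. pos x \<omega> (Suc n) \<in> G} =
    (\<integral>\<^sup>+y. emeasure path_law {\<omega>\<in>space path_law. pos x (case_nat y \<omega>) (Suc n) \<in> G} \<partial>\<mu>)"
    by (rule emeasure_path_law) measurable
  also have "\<dots> = step \<mu> UNIV ((step \<mu> UNIV ^^ n) (indicator G)) x"
    by (simp add: pos_case_nat Suc step_def[of \<mu> UNIV _ x])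
  finally show ?case by simp
qed

text \<open>Bounding the time by n makes the comparison with superharmonic functions an induction on
  n, in place of optional stopping.\<close>

definition hit :: "'a set \<Rightarrow> nat \<Rightarrow> 'a \<Rightarrow> ennreal" where
  "hit G n x = emeasure path_law {\<omega>\<in>space path_law. \<exists>k\<le>n. pos x \<omega> k \<in> G}"

lemma hit_measurable[measurable]:
  assumes [measurable]: "G \<in> sets borel"
  shows "hit G n \<in> borel_measurable borel"
proof -
  interpret P: prob_space path_law by (rule prob_space_path_law)
  let ?Q = "{p \<in> space (borel \<Otimes>\<^sub>M path_law). \<exists>k\<le>n. pos (fst p) (snd p) k \<in> G}"
  have "?Q \<in> sets (borel \<Otimes>\<^sub>M path_law)" by measurable
  then have "(\<lambda>x. emeasure path_law (Pair x -` ?Q)) \<in> borel_measurable borel"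
    by (rule P.measurable_emeasure_Pair)
  also have "(\<lambda>x. emeasure path_law (Pair x -` ?Q)) = hit G n"
    by (auto simp: hit_def fun_eq_iff space_pair_measure intro!: arg_cong[of _ _ "emeasure _"])
  finally show ?thesis .
qed

lemma hit_inside:
  assumes "x \<in> G"
  shows "hit G n x = 1"
proof -
  interpret P: prob_space path_law by (rule prob_space_path_law)
  have "{\<omega>\<in>space path_law. \<exists>k\<le>n. pos x \<omega> k \<in> G} = space path_law"
    using assms by (auto intro!: exI[of _ 0])
  then show ?thesis using P.emeasure_space_1 by (simp add: hit_def)
qed

lemma hit_outside:
  assumes [measurable]: "G \<in> sets borel" and "x \<notin> G"
  shows "hit G 0 x = 0" "hit G (Suc n) x = (\<integral>\<^sup>+y. hit G n (x + y) \<partial>\<mu>)"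
proof -
  show "hit G 0 x = 0" using assms by (simp add: hit_def)
  have *: "(\<exists>k\<le>Suc n. pos x (case_nat y \<omega>) k \<in> G) \<longleftrightarrow> (\<exists>k\<le>n. pos (x + y) \<omega> k \<in> G)" for y \<omega>
    using assms(2) by (simp add: ex_le_Suc pos_case_nat)
  have "hit G (Suc n) x = (\<integral>\<^sup>+y. emeasure path_law {\<omega>\<in>space path_law. \<exists>k\<le>Suc n. pos x (case_nat y \<omega>) k \<in> G} \<partial>\<mu>)"
    unfolding hit_def by (rule emeasure_path_law) measurable
  then show "hit G (Suc n) x = (\<integral>\<^sup>+y. hit G n (x + y) \<partial>\<mu>)"
    by (simp only: hit_def *)
qed

text \<open>Outside G, a visit by time \<open>Suc n\<close> is after one step a visit by time n, and
  the mean of h after one step is at most h.\<close>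

lemma superharmonic_ge_hit:
  assumes [measurable]: "G \<in> sets borel" "h \<in> borel_measurable borel"
    and super: "\<And>z. z \<in> Z \<Longrightarrow> (\<integral>\<^sup>+y. h (z + y) \<partial>\<mu>) \<le> h z"
    and G: "\<And>z. z \<in> G \<Longrightarrow> z \<in> Z \<Longrightarrow> a \<le> h z" and "z \<in> Z"
  shows "a * hit G n z \<le> h z"
  using \<open>z \<in> Z\<close>
proof (induction n arbitrary: z)
  case 0 then show ?case using G by (cases "z \<in> G") (auto simp: hit_inside hit_outside)
next
  case (Suc n)
  show ?case
  proof (cases "z \<in> G")
    case True then show ?thesis using G Suc by (simp add: hit_inside)
  next
    case False
    have [measurable]: "(\<lambda>y. hit G n (z + y)) \<in> borel_measurable borel" by measurable
    have "a * hit G (Suc n) z = (\<integral>\<^sup>+y. a * hit G n (z + y) \<partial>\<mu>)"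
      by (simp add: hit_outside False nn_integral_cmult)
    also have "\<dots> \<le> (\<integral>\<^sup>+y. h (z + y) \<partial>\<mu>)"
      using AE_in_subgroup
    proof (intro nn_integral_mono_AE, eventually_elim)
      case (elim y)
      show ?case by (rule Suc.IH) (rule Z_add[OF Suc.prems], fact)
    qed
    also have "\<dots> \<le> h z" by (rule super[OF Suc(2)])
    finally show ?thesis .
  qed
qed

end

text \<open>Recurrence in the form in which it is used, for all starting points and all targets in
  Z. Topological recurrence only concerns returns from 0 to 0;
  \<open>recurrent_subgroup_walkI\<close> derives this form from it.\<close>

locale recurrent_subgroup_walk = subgroup_walk +
  assumes recurrent: "x \<in> Z \<Longrightarrow> w \<in> Z \<Longrightarrow> open G \<Longrightarrow> w \<in> G \<Longrightarrow>
    AE \<omega> in path_law. infinite {n. pos x \<omega> n \<in> G}"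
begin

lemma SUP_hit:
  assumes "x \<in> Z" "w \<in> Z" "open G" "w \<in> G"
  shows "(SUP n. hit G n x) = 1"
proof -
  interpret P: prob_space path_law by (rule prob_space_path_law)
  have [measurable]: "G \<in> sets borel" using assms by simp
  let ?H = "\<lambda>n. {\<omega>\<in>space path_law. \<exists>k\<le>n. pos x \<omega> k \<in> G}"
  have H[measurable]: "?H n \<in> sets path_law" for n by measurable
  have "incseq ?H"
    unfolding incseq_def by (blast intro: order_trans)
  then have "(SUP n. hit G n x) = emeasure path_law (\<Union>n. ?H n)"
    unfolding hit_def using H by (intro SUP_emeasure_incseq) blast+
  also have "\<dots> = emeasure path_law (space path_law)"
  proof (rule emeasure_eq_AE)
    show "AE \<omega> in path_law. (\<omega> \<in> (\<Union>n. ?H n)) = (\<omega> \<in> space path_law)"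
      using recurrent[OF assms] AE_space
    proof eventually_elim
      case (elim \<omega>)
      then obtain n where "pos x \<omega> n \<in> G" using not_finite_existsD by auto
      with elim show ?case by blast
    qed
    show "(\<Union>n. ?H n) \<in> sets path_law" using H by (intro sets.countable_UN) blast
  qed (rule sets.top)
  finally show ?thesis using P.emeasure_space_1 by simp
qed

text \<open>For \<open>a < h w\<close> the set \<open>{x. a < h x}\<close> is open by semicontinuity
  and contains w, so it is hit almost surely from z, whence \<open>a \<le> h z\<close>.\<close>

lemma superharmonic_lsc_const:
  assumes "lsc h" and super: "\<And>z. z \<in> Z \<Longrightarrow> (\<integral>\<^sup>+y. h (z + y) \<partial>\<mu>) \<le> h z"
    and "z \<in> Z" "w \<in> Z"
  shows "h z = h w"
proof -
  have "h w \<le> h z" if zw: "z \<in> Z" "w \<in> Z" for z w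
  proof (rule dense_le)
    fix a assume "a < h w"
    let ?G = "{x. a < h x}"
    have G: "open ?G" using \<open>lsc h\<close> by (simp add: lsc_def)
    have "a = (SUP n. a * hit ?G n z)"
      using SUP_hit[OF zw G] \<open>a < h w\<close> by (simp add: SUP_mult_left_ennreal[symmetric])
    also have "\<dots> \<le> h z"
    proof (rule SUP_least)
      fix n show "a * hit ?G n z \<le> h z"
        by (rule superharmonic_ge_hit) (use G lsc_measurable[OF \<open>lsc h\<close>] super zw in auto)
    qed
    finally show "a \<le> h z" .
  qed
  then show ?thesis using assms(3,4) by (intro antisym) auto
qed

end

section \<open>Excessive measures\<close>

lemma nn_integral_translate:
  fixes m :: "'a::euclidean_space measure"
  assumes "distr m borel ((+) z) = m" and [measurable]: "f \<in> borel_measurable borel"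
    and "sets m = sets borel"
  shows "(\<integral>\<^sup>+x. f (z + x) \<partial>m) = (\<integral>\<^sup>+x. f x \<partial>m)"
proof -
  note [measurable_cong] = assms(3)
  have "(\<integral>\<^sup>+x. f x \<partial>distr m borel ((+) z)) = (\<integral>\<^sup>+x. f (z + x) \<partial>m)"
    by (rule nn_integral_distr) measurable
  with assms(1) show ?thesis by simp
qed

text \<open>Uniqueness of Haar measure, where m may be zero. Integrating
  \<open>indicator W y * indicator B (y + x)\<close> over both variables, and using the translation
  invariance of each measure in turn, relates m and l through W and its reflection. One W with
  \<open>l W\<close> positive and finite and finite m-measure of the reflection then fixes the
  ratio.\<close>

lemma invariant_measures_proportional:
  fixes m l :: "'a::euclidean_space measure"
  assumes [measurable_cong]: "sets m = sets borel" and m_fin: "\<And>x. \<exists>U. open U \<and> x \<in> U \<and> emeasure m U < \<infinity>"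
    and m_AE: "AE x in m. x \<in> Z" and m_inv: "\<And>z. z \<in> Z \<Longrightarrow> distr m borel ((+) z) = m"
    and [measurable_cong]: "sets l = sets borel" and l_fin: "\<And>x. \<exists>U. open U \<and> x \<in> U \<and> emeasure l U < \<infinity>"
    and l_AE: "AE x in l. x \<in> Z" and l_inv: "\<And>z. z \<in> Z \<Longrightarrow> distr l borel ((+) z) = l"
    and l_pos: "emeasure l UNIV \<noteq> 0"
  obtains c where "c < \<infinity>" "m = scale_measure c l"
proof -
  interpret m: sigma_finite_measure m using assms(1) m_fin by (rule sigma_finite_locally_finite)
  interpret l: sigma_finite_measure l using assms(5) l_fin by (rule sigma_finite_locally_finite)
  interpret P: pair_sigma_finite l m ..
  have key: "emeasure m B * emeasure l W = emeasure l B * emeasure m (uminus -` W)"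
    if B[measurable]: "B \<in> sets borel" and W[measurable]: "W \<in> sets borel" for B W
  proof -
    have W'[measurable]: "uminus -` W \<in> sets borel"
      using measurable_sets_borel[OF _ W, of uminus] by simp
    have "emeasure m B * emeasure l W = (\<integral>\<^sup>+y. indicator W y * emeasure m B \<partial>l)"
      by (simp add: nn_integral_multc mult.commute)
    also have "\<dots> = (\<integral>\<^sup>+y. \<integral>\<^sup>+x. indicator W y * indicator B (y + x) \<partial>m \<partial>l)"
      using l_AE
    proof (intro nn_integral_cong_AE, eventually_elim)
      case (elim y)
      show ?case
        using nn_integral_translate[OF m_inv[OF elim(2)], of "indicator B"] assms(1)
        by (simp add: nn_integral_cmult)
    qed
    also have "\<dots> = (\<integral>\<^sup>+x. \<integral>\<^sup>+y. indicator W y * indicator B (y + x) \<partial>l \<partial>m)"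
      by (rule P.Fubini'[symmetric]) measurable
    also have "\<dots> = (\<integral>\<^sup>+x. \<integral>\<^sup>+y. indicator W (y - x) * indicator B y \<partial>l \<partial>m)"
      using m_AE
    proof (intro nn_integral_cong_AE, eventually_elim)
      case (elim x)
      show ?case
        using nn_integral_translate[OF l_inv[OF elim(2)], of "\<lambda>y. indicator W (y - x) * indicator B y"] assms(5)
        by (simp add: add.commute)
    qed
    also have "\<dots> = (\<integral>\<^sup>+y. \<integral>\<^sup>+x. indicator W (y - x) * indicator B y \<partial>m \<partial>l)"
      by (rule P.Fubini') measurable
    also have "\<dots> = (\<integral>\<^sup>+y. indicator B y * emeasure m (uminus -` W) \<partial>l)"
      using l_AE
    proof (intro nn_integral_cong_AE, eventually_elim)
      case (elim y)
      have "(\<integral>\<^sup>+x. indicator W (y - x) * indicator B y \<partial>m) = indicator B y * (\<integral>\<^sup>+x. indicator W (y - x) \<partial>m)"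
        by (simp add: nn_integral_cmult mult.commute)
      also have "(\<integral>\<^sup>+x. indicator W (y - x) \<partial>m) = (\<integral>\<^sup>+x. indicator (uminus -` W) x \<partial>m)"
        using nn_integral_translate[OF m_inv[OF elim(2)], of "\<lambda>x. indicator W (y - x)"] assms(1)
        by (simp add: indicator_def)
      finally show ?case by (simp add: assms(1))
    qed
    also have "\<dots> = emeasure l B * emeasure m (uminus -` W)"
      by (simp add: nn_integral_multc)
    finally show ?thesis .
  qed
  \<comment> \<open>A point of the support of l; if there were none, the Lindelof property would
    make l zero.\<close>
  obtain x where x: "\<And>U. open U \<Longrightarrow> x \<in> U \<Longrightarrow> emeasure l U \<noteq> 0"
  proof (rule ccontr)
    assume "\<not> thesis"
    then have "\<forall>x. \<exists>U. open U \<and> x \<in> U \<and> emeasure l U = 0" using that by blast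
    then have "\<Union>{U. open U \<and> emeasure l U = 0} = UNIV" by auto
    moreover obtain F where "F \<subseteq> {U. open U \<and> emeasure l U = 0}" "countable F" "\<Union>F = \<Union>{U. open U \<and> emeasure l U = 0}"
      using Lindelof[of "{U. open U \<and> emeasure l U = 0}"] by auto
    moreover from this have "U \<in> null_sets l" if "U \<in> F" for U
      using that assms(5) by (auto simp: null_sets_def)
    ultimately have "UNIV \<in> null_sets l"
      using null_sets_UN'[of F id l] by simp
    with l_pos show False by (simp add: null_sets_def)
  qed
  obtain U1 U2 where U: "open U1" "x \<in> U1" "emeasure l U1 < \<infinity>" "open U2" "- x \<in> U2" "emeasure m U2 < \<infinity>"
    using l_fin[of x] m_fin[of "- x"] by metis
  let ?W = "U1 \<inter> uminus -` U2"
  have "open (uminus -` U2)" by (intro open_vimage U continuous_intros)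
  then have W: "open ?W" "x \<in> ?W" using U by auto
  have W0: "emeasure l ?W \<noteq> 0" using x W by blast
  have W1: "emeasure l ?W < \<infinity>"
    using U assms(5) by (intro le_less_trans[OF emeasure_mono U(3)]) auto
  have W2: "emeasure m (uminus -` ?W) < \<infinity>"
    using U assms(1) by (intro le_less_trans[OF emeasure_mono U(6)]) auto
  define c where "c = emeasure m (uminus -` ?W) / emeasure l ?W"
  show thesis
  proof
    show "c < \<infinity>" using W0 W2 by (auto simp: c_def ennreal_divide_eq_top_iff less_top[symmetric])
    show "m = scale_measure c l"
    proof (rule measure_eqI)
      fix B assume "B \<in> sets m"
      then have "emeasure m B * emeasure l ?W = emeasure l B * emeasure m (uminus -` ?W)"
        using W by (intro key) (auto simp: assms(1))
      then have "emeasure m B * emeasure l ?W / emeasure l ?W = emeasure l B * c"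
        by (simp add: c_def ennreal_times_divide)
      then show "emeasure m B = emeasure (scale_measure c l) B"
        using W0 W1 by (simp add: ennreal_mult_divide_eq mult.commute)
    qed (simp add: assms(1,5))
  qed
qed

text \<open>Haar measure is regarded as a Borel measure of the ambient space concentrated on Z.
  Translations and Fubini then live on a vector space, and Z enters through almost-everywhere
  statements.\<close>

locale haar_walk = recurrent_subgroup_walk +
  fixes haar :: "'a measure"
  assumes sets_haar[measurable_cong, simp]: "sets haar = sets borel"
    and haar_locally_finite: "\<exists>U. open U \<and> x \<in> U \<and> emeasure haar U < \<infinity>"
    and AE_haar_Z: "AE x in haar. x \<in> Z"
    and haar_translate: "z \<in> Z \<Longrightarrow> distr haar borel ((+) z) = haar"
    and haar_nonzero: "emeasure haar UNIV \<noteq> 0"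
begin

sublocale haar: sigma_finite_measure haar
  using sets_haar haar_locally_finite by (rule sigma_finite_locally_finite)

lemma haar_invariant:
  assumes [measurable]: "f \<in> borel_measurable borel"
  shows "(\<integral>\<^sup>+x. step \<mu> UNIV f x \<partial>haar) = (\<integral>\<^sup>+x. f x \<partial>haar)"
proof -
  interpret P: pair_sigma_finite \<mu> haar ..
  have "(\<integral>\<^sup>+x. step \<mu> UNIV f x \<partial>haar) = (\<integral>\<^sup>+y. \<integral>\<^sup>+x. f (y + x) \<partial>haar \<partial>\<mu>)"
    unfolding step_def by (subst P.Fubini') (auto simp: add.commute)
  also have "\<dots> = (\<integral>\<^sup>+y. \<integral>\<^sup>+x. f x \<partial>haar \<partial>\<mu>)"
    using AE_in_subgroup
  proof (intro nn_integral_cong_AE, eventually_elim)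
    case (elim y) show ?case by (rule nn_integral_translate[OF haar_translate[OF elim(2)]]) simp_all
  qed
  finally show ?thesis by (simp add: emeasure_space_1)
qed

text \<open>\<open>haar\<close> is invariant under the step, so from almost every start the next
  position avoids a given null set.\<close>

lemma AE_haar_step:
  assumes "AE x in haar. P x"
  shows "AE x in haar. AE y in \<mu>. P (x + y)"
proof -
  obtain N where N: "{x\<in>space haar. \<not> P x} \<subseteq> N" "emeasure haar N = 0" and [measurable]: "N \<in> sets borel"
    using assms by (auto elim!: AE_E simp del: space_borel)
  have "(\<integral>\<^sup>+x. step \<mu> UNIV (indicator N) x \<partial>haar) = 0"
    by (subst haar_invariant) (simp_all add: N)
  then have "AE x in haar. step \<mu> UNIV (indicator N) x = 0"
    by (subst (asm) nn_integral_0_iff_AE) simp_all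
  then show ?thesis
  proof eventually_elim
    case (elim x)
    then have "AE y in \<mu>. indicator N (x + y) = (0::ennreal)"
      unfolding step_def by (subst (asm) nn_integral_0_iff_AE) simp_all
    then show ?case
    proof eventually_elim
      case (elim y)
      then show ?case
        using N(1) by (auto simp: indicator_def sets_eq_imp_space_eq[OF sets_haar] split: if_splits)
    qed
  qed
qed

lemma AE_haar_step_cong:
  assumes "AE x in haar. f x = g x"
  shows "AE x in haar. step \<mu> W f x = step \<mu> W g x"
  using AE_haar_step[OF assms]
proof eventually_elim
  case (elim x)
  then have "AE y in \<mu>. indicator W (x, x + y) * f (x + y) = indicator W (x, x + y) * g (x + y)"
    by eventually_elim simp
  then show ?case unfolding step_def by (rule nn_integral_cong_AE)
qed

text \<open>Finiteness on U spreads to all of Z. From x the set U is visited with positive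
  probability at some time n, so by semicontinuity \<open>P^n 1_U > e\<close> on a neighbourhood V
  of x, and \<open>e * m V\<close> is at most the integral of \<open>P^n 1_U\<close>, hence at most
  \<open>m U\<close>.\<close>

lemma excessive_locally_finite:
  assumes [measurable_cong, simp]: "sets m = sets borel" and AE_Z: "AE x in m. x \<in> Z"
    and U: "open U" "w \<in> U" "w \<in> Z" "emeasure m U < \<infinity>"
    and exc: "\<And>f. f \<in> borel_measurable borel \<Longrightarrow> (\<integral>\<^sup>+x. step \<mu> UNIV f x \<partial>m) \<le> (\<integral>\<^sup>+x. f x \<partial>m)"
  shows "\<exists>V. open V \<and> x \<in> V \<and> emeasure m V < \<infinity>"
proof (cases "x \<in> Z")
  case False
  have "- Z \<in> null_sets m" using AE_Z by (auto simp: AE_iff_null_sets Compl_eq)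
  then show ?thesis using False Z_closed by (intro exI[of _ "- Z"]) (auto simp: null_sets_def)
next
  case True
  interpret P: prob_space path_law by (rule prob_space_path_law)
  have [measurable]: "U \<in> sets borel" using U by simp
  let ?g = "\<lambda>n. (step \<mu> UNIV ^^ n) (indicator U)"
  have "\<exists>n. ?g n x \<noteq> 0"
  proof (rule ccontr)
    assume *: "\<not> (\<exists>n. ?g n x \<noteq> 0)"
    have "AE \<omega> in path_law. pos x \<omega> n \<notin> U" for n
    proof -
      have "emeasure path_law {\<omega>\<in>space path_law. pos x \<omega> n \<in> U} = 0"
        using * by (simp add: step_UNIV_pow_visit)
      moreover have "{\<omega>\<in>space path_law. pos x \<omega> n \<in> U} \<in> sets path_law" by measurable
      ultimately show ?thesis by (intro AE_I[of _ _ "{\<omega>\<in>space path_law. pos x \<omega> n \<in> U}"]) auto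
    qed
    then have "AE \<omega> in path_law. \<forall>n. pos x \<omega> n \<notin> U" by (simp add: AE_all_countable)
    moreover note recurrent[OF True U(3,1,2)]
    ultimately have "AE \<omega> in path_law. False" by eventually_elim simp
    then show False by simp
  qed
  then obtain n where n: "?g n x \<noteq> 0" by blast
  have le: "(\<integral>\<^sup>+x. ?g n x \<partial>m) \<le> emeasure m U" for n
  proof (induction n)
    case (Suc n)
    have "(\<integral>\<^sup>+x. ?g (Suc n) x \<partial>m) \<le> (\<integral>\<^sup>+x. ?g n x \<partial>m)" by (simp add: exc)
    with Suc show ?case by simp
  qed simp
  obtain e where e: "0 < e" "e < ?g n x" using n dense[of 0 "?g n x"] by (auto simp: zero_less_iff_neq_zero)
  let ?V = "{x. e < ?g n x}"
  have "lsc (?g n)"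
    by (induction n) (auto intro: lsc_indicator U lsc_step)
  then have V: "open ?V" by (simp add: lsc_def)
  have "e * emeasure m ?V = (\<integral>\<^sup>+x. e * indicator ?V x \<partial>m)"
    using V by (simp add: nn_integral_cmult)
  also have "\<dots> \<le> (\<integral>\<^sup>+x. ?g n x \<partial>m)"
    by (intro nn_integral_mono) (auto simp: indicator_def)
  also have "\<dots> < \<infinity>" using le U(4) by (rule le_less_trans)
  finally have "emeasure m ?V < \<infinity>"
    using e(1) by (auto simp: ennreal_mult_less_top zero_less_iff_neq_zero)
  with V e show ?thesis by blast
qed

lemma excessive_measure_proportional:
  assumes [measurable_cong, simp]: "sets m = sets borel" and AE_Z: "AE x in m. x \<in> Z"
    and U: "open U" "w \<in> U" "w \<in> Z" "emeasure m U < \<infinity>"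
    and exc: "\<And>f. f \<in> borel_measurable borel \<Longrightarrow> (\<integral>\<^sup>+x. step \<mu> UNIV f x \<partial>m) \<le> (\<integral>\<^sup>+x. f x \<partial>m)"
  obtains c where "c < \<infinity>" "m = scale_measure c haar"
proof (rule invariant_measures_proportional)
  show fin: "\<exists>U. open U \<and> x \<in> U \<and> emeasure m U < \<infinity>" for x
    using excessive_locally_finite[OF assms] .
  interpret m: sigma_finite_measure m using assms(1) fin by (rule sigma_finite_locally_finite)
  interpret P: pair_sigma_finite \<mu> m ..
  show "distr m borel ((+) z) = m" if z: "z \<in> Z" for z
  proof (rule sym, rule measure_eqI_open)
    fix V :: "'a set" assume V: "open V"
    then have [measurable]: "V \<in> sets borel" by simp
    define h :: "'a \<Rightarrow> ennreal" where "h v = (\<integral>\<^sup>+x. indicator V (v + x) \<partial>m)" for v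
    have "h z = h 0"
    proof (rule superharmonic_lsc_const)
      show "lsc h" unfolding h_def
        by (intro lsc_nn_integral lsc_compose[OF lsc_indicator[OF V]] continuous_intros) measurable
      \<comment> \<open>Averaging h over the increments amounts to letting x take a step, because
        addition is commutative; so excessiveness of m is superharmonicity of h.\<close>
      fix v
      have "(\<integral>\<^sup>+y. h (v + y) \<partial>\<mu>) = (\<integral>\<^sup>+x. step \<mu> UNIV (\<lambda>x. indicator V (v + x)) x \<partial>m)"
        unfolding h_def step_def by (subst P.Fubini') (auto simp: ac_simps)
      also have "\<dots> \<le> h v" unfolding h_def by (rule exc) measurable
      finally show "(\<integral>\<^sup>+y. h (v + y) \<partial>\<mu>) \<le> h v" .
    qed (use z Z_zero in auto)
    have "emeasure (distr m borel ((+) z)) V = (\<integral>\<^sup>+x. indicator V x \<partial>distr m borel ((+) z))"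
      by simp
    also have "\<dots> = h z" unfolding h_def by (rule nn_integral_distr) measurable
    also have "\<dots> = emeasure m V" using \<open>h z = h 0\<close> by (simp add: h_def)
    finally show "emeasure m V = emeasure (distr m borel ((+) z)) V" ..
  qed (use fin in simp_all)
qed (use assms haar_locally_finite AE_haar_Z haar_translate haar_nonzero in auto)

text \<open>F satisfies the inequality only almost everywhere and need not be semicontinuous, so
  hitting arguments do not apply to it. Its averages over translates of an open set are
  semicontinuous and superharmonic, hence constant on Z. This makes the measure with density F
  translation invariant, and densities with respect to \<open>haar\<close> are unique.\<close>

lemma superharmonic_const:
  assumes [measurable]: "F \<in> borel_measurable borel" and F1: "\<And>x. F x \<le> 1"
    and super: "AE x in haar. step \<mu> UNIV F x \<le> F x"
  obtains c where "AE x in haar. F x = c"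
proof -
  interpret P: pair_sigma_finite \<mu> haar ..
  define m where "m = density haar F"
  have sets_m[measurable_cong, simp]: "sets m = sets borel" by (simp add: m_def)
  have m_le: "emeasure m B \<le> emeasure haar B" if [measurable]: "B \<in> sets borel" for B
  proof -
    have "emeasure m B = (\<integral>\<^sup>+x. F x * indicator B x \<partial>haar)" by (simp add: m_def emeasure_density)
    also have "\<dots> \<le> (\<integral>\<^sup>+x. indicator B x \<partial>haar)"
      using F1 by (intro nn_integral_mono) (auto simp: indicator_def)
    finally show ?thesis by simp
  qed
  have fin: "\<exists>U. open U \<and> x \<in> U \<and> emeasure m U < \<infinity>" for x
    using haar_locally_finite[of x] m_le by (meson borel_open le_less_trans)
  obtain c where c: "c < \<infinity>" "m = scale_measure c haar"
  proof (rule invariant_measures_proportional)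
    show "AE x in m. x \<in> Z" using AE_haar_Z unfolding m_def
      by (subst AE_density) (auto elim: eventually_mono)
    show "distr m borel ((+) z) = m" if z: "z \<in> Z" for z
    proof (rule sym, rule measure_eqI_open)
      fix V :: "'a set" assume V: "open V"
      then have [measurable]: "V \<in> sets borel" by simp
      define h :: "'a \<Rightarrow> ennreal" where "h v = (\<integral>\<^sup>+x. indicator V (x - v) * F x \<partial>haar)" for v
      have "h (- z) = h 0"
      proof (rule superharmonic_lsc_const)
        show "lsc h" unfolding h_def
        proof (rule lsc_nn_integral)
          show "lsc (\<lambda>v. indicator V (x - v) * F x)" for x
          proof -
            have "open ((\<lambda>v. x - v) -` V)" by (intro open_vimage V continuous_intros)
            then have "lsc (\<lambda>v. indicator ((\<lambda>v. x - v) -` V) v * F x)"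
              by (rule lsc_indicator_mult) (auto simp: lsc_def)
            then show ?thesis by (simp add: indicator_def)
          qed
        qed measurable
        \<comment> \<open>Translating by y moves the increment from the indicator to F, where the
          inequality for F applies.\<close>
        fix v
        have "(\<integral>\<^sup>+y. h (v + y) \<partial>\<mu>) = (\<integral>\<^sup>+y. \<integral>\<^sup>+x. indicator V (x - v) * F (x + y) \<partial>haar \<partial>\<mu>)"
          using AE_in_subgroup
        proof (intro nn_integral_cong_AE, eventually_elim)
          case (elim y)
          show ?case unfolding h_def
            using nn_integral_translate[OF haar_translate[OF elim(2)], of "\<lambda>x. indicator V (x - (v + y)) * F x"]
            by (simp add: algebra_simps)
        qed
        also have "\<dots> = (\<integral>\<^sup>+x. \<integral>\<^sup>+y. indicator V (x - v) * F (x + y) \<partial>\<mu> \<partial>haar)"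
          by (rule P.Fubini'[symmetric]) measurable
        also have "\<dots> = (\<integral>\<^sup>+x. indicator V (x - v) * step \<mu> UNIV F x \<partial>haar)"
          by (simp add: step_def nn_integral_cmult)
        also have "\<dots> \<le> h v" unfolding h_def
          using super by (intro nn_integral_mono_AE) (auto elim!: eventually_mono intro: mult_left_mono)
        finally show "(\<integral>\<^sup>+y. h (v + y) \<partial>\<mu>) \<le> h v" .
      qed (use z Z_zero Z_minus in auto)
      have "emeasure (distr m borel ((+) z)) V = (\<integral>\<^sup>+x. indicator V x \<partial>distr m borel ((+) z))"
        by simp
      also have "\<dots> = (\<integral>\<^sup>+x. indicator V (z + x) \<partial>m)" by (rule nn_integral_distr) measurable
      also have "\<dots> = h (- z)"
        unfolding h_def m_def by (subst nn_integral_density) (auto simp: ac_simps)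
      also have "\<dots> = emeasure m V"
        unfolding \<open>h (- z) = h 0\<close> by (simp add: h_def m_def emeasure_density mult.commute)
      finally show "emeasure m V = emeasure (distr m borel ((+) z)) V" ..
    qed (use fin in simp_all)
  qed (use fin haar_locally_finite AE_haar_Z haar_translate haar_nonzero in auto)
  have "density haar F = density haar (\<lambda>_. c)"
    using c(2) by (auto simp: m_def intro!: measure_eqI simp: emeasure_density nn_integral_cmult)
  then have "AE x in haar. F x = c"
    by (subst (asm) haar.density_unique_iff) simp_all
  then show ?thesis by (rule that)
qed

end

section \<open>Path laws of Markov chains\<close>

text \<open>Here the cemetery is an ordinary state, so the Markov property is proved for a
  probability kernel without case distinctions; \<open>chain_law_eq\<close> later identifies
  \<open>law\<close> with \<open>chain_law\<close>.\<close>

locale markov_kernel =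
  fixes N :: "'s measure" and \<kappa> :: "'s \<Rightarrow> 's measure"
  assumes kernel[measurable]: "\<kappa> \<in> N \<rightarrow>\<^sub>M prob_algebra N"
begin

definition transition :: "'s \<Rightarrow> nat \<Rightarrow> (nat \<Rightarrow> 's) \<Rightarrow> 's measure" where
  "transition s n \<omega> = (case n of 0 \<Rightarrow> return N s | Suc m \<Rightarrow> \<kappa> (\<omega> m))"

definition law :: "'s \<Rightarrow> (nat \<Rightarrow> 's) measure" where
  "law s = projective_family.lim UNIV (Ionescu_Tulcea.CI (transition s) (\<lambda>_. N)) (\<lambda>_. N)"

abbreviation paths :: "(nat \<Rightarrow> 's) measure" where
  "paths \<equiv> PiM UNIV (\<lambda>_. N)"

abbreviation cyl :: "nat \<Rightarrow> (nat \<Rightarrow> 's set) \<Rightarrow> (nat \<Rightarrow> 's) set" where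
  "cyl n A \<equiv> {\<omega>\<in>space paths. \<forall>i<n. \<omega> i \<in> A i}"

lemma kernel_subprob[measurable]: "\<kappa> \<in> N \<rightarrow>\<^sub>M subprob_algebra N"
  by (rule measurable_prob_algebraD) measurable

lemma prob_space_kernel: "s \<in> space N \<Longrightarrow> prob_space (\<kappa> s)"
  and sets_kernel: "s \<in> space N \<Longrightarrow> sets (\<kappa> s) = sets N"
  using measurable_space[OF kernel] by (auto simp: space_prob_algebra)

lemma Ionescu_Tulcea_transition:
  assumes "s \<in> space N"
  shows "Ionescu_Tulcea (transition s) (\<lambda>_. N)"
proof (rule Ionescu_Tulcea.intro)
  fix i
  show "transition s i \<in> PiM {0..<i} (\<lambda>_. N) \<rightarrow>\<^sub>M subprob_algebra N"
  proof (cases i)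
    case 0 then show ?thesis using assms by (simp add: transition_def[abs_def])
  next
    case (Suc m)
    have "(\<lambda>\<omega>. \<omega> m) \<in> PiM {0..<i} (\<lambda>_. N) \<rightarrow>\<^sub>M N"
      by (rule measurable_component_singleton) (simp add: Suc)
    then have "(\<lambda>\<omega>. \<kappa> (\<omega> m)) \<in> PiM {0..<i} (\<lambda>_. N) \<rightarrow>\<^sub>M subprob_algebra N" by measurable
    then show ?thesis by (simp add: transition_def[abs_def] Suc)
  qed
  fix x assume "x \<in> space (PiM {0..<i} (\<lambda>_. N))"
  then show "prob_space (transition s i x)"
    by (auto simp: transition_def space_PiM assms prob_space_return PiE_iff
             intro!: prob_space_kernel split: nat.split)
qed

text \<open>The expectation, from s, of g at time n on the event that the states at times below n
  lie in the sets \<open>A i\<close>. The recursion splits off the first step, as the Markov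
  property does, whereas Ionescu-Tulcea composes at the last step; \<open>cylinder_Suc_right\<close>
  passes between the two.\<close>

primrec cylinder :: "nat \<Rightarrow> (nat \<Rightarrow> 's set) \<Rightarrow> ('s \<Rightarrow> ennreal) \<Rightarrow> 's \<Rightarrow> ennreal" where
  "cylinder 0 A g s = g s"
| "cylinder (Suc n) A g s = indicator (A 0) s * (\<integral>\<^sup>+t. cylinder n (\<lambda>i. A (Suc i)) g t \<partial>\<kappa> s)"

lemma cylinder_measurable[measurable]:
  assumes "\<And>i. A i \<in> sets N" and [measurable]: "g \<in> borel_measurable N"
  shows "cylinder n A g \<in> borel_measurable N"
  using assms(1)
proof (induction n arbitrary: A)
  case (Suc n)
  note [measurable] = Suc.prems Suc.IH[OF Suc.prems]
  show ?case unfolding cylinder.simps[abs_def] by measurable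
qed (simp add: cylinder.simps(1)[abs_def])

lemma cylinder_Suc_right:
  "cylinder (Suc n) A g = cylinder n A (\<lambda>s. indicator (A n) s * (\<integral>\<^sup>+t. g t \<partial>\<kappa> s))"
proof (induction n arbitrary: A)
  case (Suc n)
  show ?case
    by (rule ext, subst cylinder.simps(2), subst Suc) simp
qed (auto simp: fun_eq_iff)

text \<open>\<open>C 0 (Suc n)\<close> is the law of the coordinates 0 to n. Integrating out the
  last coordinate absorbs one application of the kernel into g, which is why g varies in the
  induction.\<close>

lemma nn_integral_C:
  assumes s: "s \<in> space N" and A: "\<And>i. A i \<in> sets N" and "g \<in> borel_measurable N"
  shows "(\<integral>\<^sup>+\<omega>. (\<Prod>i<n. indicator (A i) (\<omega> i)) * g (\<omega> n)
      \<partial>Ionescu_Tulcea.C (transition s) (\<lambda>_. N) 0 (Suc n) (\<lambda>_. undefined)) = cylinder n A g s"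
  using assms(3)
proof (induction n arbitrary: g)
  case 0
  interpret IT: Ionescu_Tulcea "transition s" "\<lambda>_. N" by (rule Ionescu_Tulcea_transition[OF s])
  note [measurable] = 0
  have "(\<lambda>\<omega>. \<omega> 0) \<in> PiM {0..<Suc 0} (\<lambda>_. N) \<rightarrow>\<^sub>M N" by measurable
  then have [measurable]: "(\<lambda>\<omega>. g (\<omega> 0)) \<in> borel_measurable (PiM {0..<Suc 0} (\<lambda>_. N))" by measurable
  have sp: "(\<lambda>_. undefined) \<in> space (PiM {0..<0::nat} (\<lambda>_. N))" by (auto simp: space_PiM)
  have "IT.C 0 (Suc 0) (\<lambda>_. undefined) = IT.eP 0 (\<lambda>_. undefined)"
    using bind_return[OF IT.measurable_eP[of 0] sp] by simp
  then have "(\<integral>\<^sup>+\<omega>. g (\<omega> 0) \<partial>IT.C 0 (Suc 0) (\<lambda>_. undefined)) = (\<integral>\<^sup>+t. g t \<partial>transition s 0 (\<lambda>_. undefined))"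
    using IT.nn_integral_eP[OF sp, of "\<lambda>\<omega>. g (\<omega> 0)"] by simp
  also have "\<dots> = g s" using s by (simp add: transition_def nn_integral_return)
  finally show ?case by simp
next
  case (Suc n)
  interpret IT: Ionescu_Tulcea "transition s" "\<lambda>_. N" by (rule Ionescu_Tulcea_transition[OF s])
  note [measurable] = Suc.prems A
  have comp[measurable]: "(\<lambda>\<omega>. \<omega> i) \<in> PiM {0..<Suc m} (\<lambda>_. N) \<rightarrow>\<^sub>M N" if "i \<le> m" for i m
    using that by (intro measurable_component_singleton) simp
  have [measurable]: "(\<lambda>\<omega>. g (\<omega> (Suc n))) \<in> borel_measurable (PiM {0..<Suc (Suc n)} (\<lambda>_. N))"
    using comp[of "Suc n" "Suc n"] by measurable
  have [measurable]: "(\<lambda>\<omega>. indicator (A i) (\<omega> i) :: ennreal) \<in> borel_measurable (PiM {0..<Suc m} (\<lambda>_. N))" if "i \<le> m" for i m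
    using comp[OF that] by measurable
  let ?f = "\<lambda>\<omega>. (\<Prod>i<Suc n. indicator (A i) (\<omega> i)) * g (\<omega> (Suc n)) :: ennreal"
  have f[measurable]: "?f \<in> borel_measurable (PiM {0..<Suc (Suc n)} (\<lambda>_. N))"
    by (intro borel_measurable_times_ennreal borel_measurable_prod_ennreal) auto
  have "(\<integral>\<^sup>+\<omega>. ?f \<omega> \<partial>IT.C 0 (Suc (Suc n)) (\<lambda>_. undefined)) =
      (\<integral>\<^sup>+\<omega>. \<integral>\<^sup>+\<omega>'. ?f \<omega>' \<partial>IT.eP (Suc n) \<omega> \<partial>IT.C 0 (Suc n) (\<lambda>_. undefined))"
    apply (simp only: IT.C.simps(2)[of 0 "Suc n"] add_0)
    apply (rule nn_integral_bind[OF f])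
    using IT.measurable_eP[of "Suc n"]
    apply (simp add: measurable_cong_sets[OF IT.sets_C refl] space_PiM del: IT.C.simps)
    done
  also have "\<dots> = (\<integral>\<^sup>+\<omega>. (\<Prod>i<n. indicator (A i) (\<omega> i)) * (indicator (A n) (\<omega> n) * (\<integral>\<^sup>+t. g t \<partial>\<kappa> (\<omega> n))) \<partial>IT.C 0 (Suc n) (\<lambda>_. undefined))"
  proof (rule nn_integral_cong)
    fix \<omega> assume "\<omega> \<in> space (IT.C 0 (Suc n) (\<lambda>_. undefined))"
    then have \<omega>: "\<omega> \<in> space (PiM {0..<Suc n} (\<lambda>_. N))" by (subst (asm) IT.space_C) (auto simp: space_PiM)
    then have "\<omega> n \<in> space N" by (auto simp: space_PiM PiE_iff)
    have "(\<integral>\<^sup>+\<omega>'. ?f \<omega>' \<partial>IT.eP (Suc n) \<omega>) = (\<integral>\<^sup>+t. (\<Prod>i<Suc n. indicator (A i) (\<omega> i)) * g t \<partial>\<kappa> (\<omega> n))"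
      by (subst IT.nn_integral_eP[OF \<omega> f]) (auto simp: transition_def intro!: nn_integral_cong prod.cong)
    also have "\<dots> = (\<Prod>i<Suc n. indicator (A i) (\<omega> i)) * (\<integral>\<^sup>+t. g t \<partial>\<kappa> (\<omega> n))"
      using Suc.prems
      by (intro nn_integral_cmult)
         (simp add: measurable_cong_sets[OF sets_kernel[OF \<open>\<omega> n \<in> space N\<close>] refl])
    finally show "(\<integral>\<^sup>+\<omega>'. ?f \<omega>' \<partial>IT.eP (Suc n) \<omega>) = (\<Prod>i<n. indicator (A i) (\<omega> i)) * (indicator (A n) (\<omega> n) * (\<integral>\<^sup>+t. g t \<partial>\<kappa> (\<omega> n)))"
      by (simp add: mult.assoc)
  qed
  also have "\<dots> = cylinder (Suc n) A g s"
    unfolding cylinder_Suc_right by (rule Suc.IH) measurable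
  finally show ?case .
qed

lemma cylinder_sets:
  assumes "\<And>i. A i \<in> sets N"
  shows "cyl n A \<in> sets paths"
proof -
  note [measurable] = assms
  show ?thesis by measurable
qed

lemma prob_space_law:
  assumes "s \<in> space N"
  shows "prob_space (law s)"
proof -
  interpret IT: Ionescu_Tulcea "transition s" "\<lambda>_. N" by (rule Ionescu_Tulcea_transition[OF assms])
  \<comment> \<open>The total mass is the mass of the cylinder over the empty index set.\<close>
  have "emeasure IT.PF.lim (space IT.PF.lim) = emeasure IT.PF.lim (prod_emb UNIV (\<lambda>_. N) {} (space (PiM {} (\<lambda>_. N))))"
    by (intro arg_cong2[where f=emeasure]) (auto simp: space_PiM prod_emb_def restrict_def)
  also have "\<dots> = emeasure (IT.CI {}) (space (PiM {} (\<lambda>_. N)))"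
    by (rule IT.lim) auto
  also have "\<dots> = 1"
    using prob_space.emeasure_space_1[OF IT.PF.prob_space_P[of "{}"]] IT.PF.space_P[of "{}"] by simp
  finally show ?thesis unfolding law_def by (rule prob_spaceI)
qed

lemma sets_law[simp]: "s \<in> space N \<Longrightarrow> sets (law s) = sets paths"
proof -
  assume "s \<in> space N"
  then interpret IT: Ionescu_Tulcea "transition s" "\<lambda>_. N" by (rule Ionescu_Tulcea_transition)
  show ?thesis unfolding law_def by (rule IT.PF.sets_lim)
qed

lemma space_law[simp]: "s \<in> space N \<Longrightarrow> space (law s) = space paths"
  by (rule sets_eq_imp_space_eq) simp

lemma emeasure_law_cylinder:
  assumes s: "s \<in> space N" and A: "\<And>i. A i \<in> sets N"
  shows "emeasure (law s) (cyl n A) = cylinder n A (\<lambda>_. 1) s"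
proof -
  interpret IT: Ionescu_Tulcea "transition s" "\<lambda>_. N" by (rule Ionescu_Tulcea_transition[OF s])
  have A_sp: "A i \<subseteq> space N" for i using A[of i] by (rule sets.sets_into_space)
  let ?X = "PiE {0..<n} A"
  have X: "?X \<in> sets (PiM {0..<n} (\<lambda>_. N))" using A by (intro sets_PiM_I_finite) auto
  have "cyl n A = prod_emb UNIV (\<lambda>_. N) {0..<n} ?X"
    using A_sp by (auto simp: prod_emb_def space_PiM PiE_iff)
  then have "emeasure (law s) (cyl n A) = emeasure (IT.CI {0..<n}) ?X"
    unfolding law_def by (simp add: IT.lim[OF _ X])
  \<comment> \<open>One coordinate more than the cylinder constrains, because
    \<open>nn_integral_C\<close> evaluates g at time n; here g is 1.\<close>
  also have "\<dots> = emeasure (IT.C 0 (Suc n) (\<lambda>_. undefined)) (prod_emb {0..<Suc n} (\<lambda>_. N) {0..<n} ?X)"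
    by (rule IT.emeasure_CI[OF _ X]) auto
  also have "\<dots> = (\<integral>\<^sup>+\<omega>. indicator (prod_emb {0..<Suc n} (\<lambda>_. N) {0..<n} ?X) \<omega> \<partial>IT.C 0 (Suc n) (\<lambda>_. undefined))"
  proof (rule nn_integral_indicator[symmetric])
    have "prod_emb {0..<Suc n} (\<lambda>_. N) {0..<n} ?X \<in> sets (PiM {0..<Suc n} (\<lambda>_. N))"
      by (rule measurable_prod_emb[OF _ X]) auto
    then show "prod_emb {0..<Suc n} (\<lambda>_. N) {0..<n} ?X \<in> sets (IT.C 0 (Suc n) (\<lambda>_. undefined))"
      by (subst IT.sets_C) (auto simp: space_PiM)
  qed
  also have "\<dots> = (\<integral>\<^sup>+\<omega>. (\<Prod>i<n. indicator (A i) (\<omega> i)) * 1 \<partial>IT.C 0 (Suc n) (\<lambda>_. undefined))"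
  proof (rule nn_integral_cong)
    fix \<omega> assume "\<omega> \<in> space (IT.C 0 (Suc n) (\<lambda>_. undefined))"
    then have "\<omega> \<in> space (PiM {0..<Suc n} (\<lambda>_. N))" by (subst (asm) IT.space_C) (auto simp: space_PiM)
    then have "\<omega> \<in> prod_emb {0..<Suc n} (\<lambda>_. N) {0..<n} ?X \<longleftrightarrow> (\<forall>i<n. \<omega> i \<in> A i)"
      by (auto simp: prod_emb_def space_PiM PiE_iff)
    moreover have "(\<Prod>i<n. indicator (A i) (\<omega> i)) = (if \<forall>i<n. \<omega> i \<in> A i then 1 else 0 :: ennreal)"
      by (auto intro!: prod.neutral prod_zero simp: indicator_def split: if_splits)
    ultimately show "indicator (prod_emb {0..<Suc n} (\<lambda>_. N) {0..<n} ?X) \<omega> = (\<Prod>i<n. indicator (A i) (\<omega> i)) * (1::ennreal)"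
      by (simp add: indicator_def)
  qed
  also have "\<dots> = cylinder n A (\<lambda>_. 1) s"
    by (rule nn_integral_C[OF s A]) simp
  finally show ?thesis .
qed

text \<open>Free coordinates are filled with the whole space, so initial cylinders suffice to
  determine a finite measure on paths.\<close>

lemma prod_emb_eq_cylinder:
  assumes "finite J" "\<forall>j\<in>J. A j \<in> sets N"
  shows "\<exists>n B. (\<forall>i. B i \<in> sets N) \<and>
    prod_emb UNIV (\<lambda>_. N) J (PiE J A) = cyl n B"
proof -
  obtain n where n: "J \<subseteq> {..<n}" using finite_nat_iff_bounded assms(1) by blast
  let ?B = "\<lambda>i. if i \<in> J then A i else space N"
  have "?B i \<in> sets N" for i using assms(2) by auto
  moreover have "prod_emb UNIV (\<lambda>_. N) J (PiE J A) = cyl n ?B"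
    using n by (auto simp: prod_emb_def space_PiM PiE_iff subset_iff split: if_splits)
  ultimately show ?thesis by (intro exI conjI allI)
qed

lemma law_measurable[measurable]: "law \<in> N \<rightarrow>\<^sub>M prob_algebra paths"
proof (rule measurable_prob_algebra_generated[OF sets_PiM Int_stable_prod_algebra prod_algebra_sets_into_space])
  fix X assume "X \<in> prod_algebra (UNIV :: nat set) (\<lambda>_. N)"
  then obtain J A where J: "finite J" "\<And>j. j \<in> J \<Longrightarrow> A j \<in> sets N" and X: "X = prod_emb UNIV (\<lambda>_. N) J (PiE J A)"
    by (elim prod_algebraE) (use that in blast)
  have J': "\<forall>j\<in>J. A j \<in> sets N" using J(2) by blast
  from prod_emb_eq_cylinder[OF J(1) J'] obtain n B where B': "\<forall>i. B i \<in> sets N"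
    "prod_emb UNIV (\<lambda>_. N) J (PiE J A) = cyl n B"
    by (elim exE conjE)
  note B = B'(1)[rule_format] B'(2)
  note [measurable] = B(1)
  have "cylinder n B (\<lambda>_. 1) \<in> borel_measurable N" by measurable
  then show "(\<lambda>s. emeasure (law s) X) \<in> borel_measurable N"
    unfolding X B(2) by (rule measurable_cong[THEN iffD1, rotated]) (simp add: emeasure_law_cylinder B(1))
qed (auto intro: prob_space_law)

lemma law_subprob[measurable]: "law \<in> N \<rightarrow>\<^sub>M subprob_algebra paths"
  by (rule measurable_prob_algebraD) measurable

lemma emeasure_distr_law:
  assumes s: "s \<in> space N" and t: "t \<in> space N" and W: "W \<in> sets paths"
  shows "emeasure (distr (law t) paths (case_nat s)) W = emeasure (law t) (case_nat s -` W \<inter> space paths)"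
proof -
  have "case_nat s \<in> paths \<rightarrow>\<^sub>M paths"
    by (rule measurable_case_nat') (use s in auto)
  then have "case_nat s \<in> law t \<rightarrow>\<^sub>M paths"
    by (simp add: measurable_cong_sets[OF sets_law[OF t] refl])
  from emeasure_distr[OF this W] t show ?thesis by simp
qed

text \<open>Markov property at time one: s is prepended to a path started at a point drawn from
  \<open>\<kappa> s\<close>. On cylinders this is the recursion defining
  \<open>cylinder\<close>.\<close>

lemma law_eq_bind:
  assumes s: "s \<in> space N"
  shows "law s = \<kappa> s \<bind> (\<lambda>t. distr (law t) paths (case_nat s))"
proof (rule measure_eqI_PiM_infinite)
  note [measurable_cong] = sets_kernel[OF s]
  have cn[measurable]: "case_nat s \<in> paths \<rightarrow>\<^sub>M paths"
    by (rule measurable_case_nat') (use s in auto)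
  have "law \<in> \<kappa> s \<rightarrow>\<^sub>M subprob_algebra paths"
    using law_subprob by (simp add: measurable_cong_sets[OF sets_kernel[OF s] refl])
  from measurable_compose[OF this measurable_distr[OF cn]]
  have d[measurable]: "(\<lambda>t. distr (law t) paths (case_nat s)) \<in> \<kappa> s \<rightarrow>\<^sub>M subprob_algebra paths" .
  have sp: "space (\<kappa> s) \<noteq> {}" using s sets_eq_imp_space_eq[OF sets_kernel[OF s]] by auto
  show "sets (law s) = sets paths" using s by simp
  show "sets (\<kappa> s \<bind> (\<lambda>t. distr (law t) paths (case_nat s))) = sets paths"
    by (rule sets_bind[OF _ sp]) simp
  show "finite_measure (law s)" using prob_space_law[OF s] by (simp add: prob_space_def)
  fix A J assume J: "finite (J::nat set)" "\<And>i. i \<in> J \<Longrightarrow> A i \<in> sets N"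
  have J': "\<forall>j\<in>J. A j \<in> sets N" using J(2) by blast
  from prod_emb_eq_cylinder[OF J(1) J'] obtain n B where B': "\<forall>i. B i \<in> sets N"
    "prod_emb UNIV (\<lambda>_. N) J (PiE J A) = cyl n B"
    by (elim exE conjE)
  note B = B'(1)[rule_format] B'(2)
  have C[measurable]: "cyl m B' \<in> sets paths" if "\<And>i. B' i \<in> sets N" for m B'
    using that by (rule cylinder_sets)
  have "emeasure (\<kappa> s \<bind> (\<lambda>t. distr (law t) paths (case_nat s))) (cyl n B) =
    (\<integral>\<^sup>+t. emeasure (distr (law t) paths (case_nat s)) (cyl n B) \<partial>\<kappa> s)"
    by (rule emeasure_bind[OF sp d]) (use B in measurable)
  also have "\<dots> = (\<integral>\<^sup>+t. emeasure (law t) (case_nat s -` cyl n B \<inter> space paths) \<partial>\<kappa> s)"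
    by (intro nn_integral_cong emeasure_distr_law[OF s _ C[OF B(1)]])
       (simp add: sets_eq_imp_space_eq[OF sets_kernel[OF s]])
  also have "\<dots> = cylinder n B (\<lambda>_. 1) s"
  \<comment> \<open>For n = 0 nothing is constrained, not even the prepended state, and both sides
    are the total mass.\<close>
  proof (cases n)
    case 0
    have "emeasure (law t) (case_nat s -` cyl n B \<inter> space paths) = 1" if "t \<in> space N" for t
    proof -
      have "case_nat s -` cyl n B \<inter> space paths = space paths"
        using measurable_space[OF cn] 0 by auto
      then show ?thesis using prob_space.emeasure_space_1[OF prob_space_law[OF that]] that by simp
    qed
    then have "(\<integral>\<^sup>+t. emeasure (law t) (case_nat s -` cyl n B \<inter> space paths) \<partial>\<kappa> s) = (\<integral>\<^sup>+t. 1 \<partial>\<kappa> s)"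
      by (intro nn_integral_cong) (simp add: sets_eq_imp_space_eq[OF sets_kernel[OF s]])
    then show ?thesis
      using prob_space.emeasure_space_1[OF prob_space_kernel[OF s]] 0 by simp
  next
    case (Suc m)
    have "case_nat s -` cyl n B \<inter> space paths = (if s \<in> B 0 then cyl m (\<lambda>i. B (Suc i)) else {})"
      using measurable_space[OF cn] by (auto simp: Suc All_less_Suc2)
    then have "(\<integral>\<^sup>+t. emeasure (law t) (case_nat s -` cyl n B \<inter> space paths) \<partial>\<kappa> s) =
        (\<integral>\<^sup>+t. indicator (B 0) s * cylinder m (\<lambda>i. B (Suc i)) (\<lambda>_. 1) t \<partial>\<kappa> s)"
      using B(1) by (intro nn_integral_cong) (auto simp: indicator_def emeasure_law_cylinder sets_eq_imp_space_eq[OF sets_kernel[OF s]])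
    also have "\<dots> = cylinder n B (\<lambda>_. 1) s"
      using B(1)
      by (subst nn_integral_cmult) (simp_all add: Suc measurable_cong_sets[OF sets_kernel[OF s] refl] cylinder_measurable)
    finally show ?thesis .
  qed
  also have "\<dots> = emeasure (law s) (cyl n B)"
    using emeasure_law_cylinder[OF s B(1)] by simp
  finally show "emeasure (law s) (prod_emb UNIV (\<lambda>_. N) J (PiE J A)) =
     emeasure (\<kappa> s \<bind> (\<lambda>t. distr (law t) paths (case_nat s))) (prod_emb UNIV (\<lambda>_. N) J (PiE J A))"
    unfolding B(2) by simp
qed

lemma emeasure_law_step:
  assumes s: "s \<in> space N" and W[measurable]: "W \<in> sets paths"
  shows "emeasure (law s) W = (\<integral>\<^sup>+t. emeasure (law t) (case_nat s -` W \<inter> space paths) \<partial>\<kappa> s)"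
proof -
  note [measurable_cong] = sets_kernel[OF s]
  have cn[measurable]: "case_nat s \<in> paths \<rightarrow>\<^sub>M paths"
    by (rule measurable_case_nat') (use s in auto)
  have "law \<in> \<kappa> s \<rightarrow>\<^sub>M subprob_algebra paths"
    using law_subprob by (simp add: measurable_cong_sets[OF sets_kernel[OF s] refl])
  from measurable_compose[OF this measurable_distr[OF cn]]
  have d[measurable]: "(\<lambda>t. distr (law t) paths (case_nat s)) \<in> \<kappa> s \<rightarrow>\<^sub>M subprob_algebra paths" .
  have sp: "space (\<kappa> s) \<noteq> {}" using s sets_eq_imp_space_eq[OF sets_kernel[OF s]] by auto
  have "emeasure (law s) W = (\<integral>\<^sup>+t. emeasure (distr (law t) paths (case_nat s)) W \<partial>\<kappa> s)"
    by (subst law_eq_bind[OF s]) (rule emeasure_bind[OF sp d W])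
  also have "\<dots> = (\<integral>\<^sup>+t. emeasure (law t) (case_nat s -` W \<inter> space paths) \<partial>\<kappa> s)"
  proof (rule nn_integral_cong)
    fix t assume "t \<in> space (\<kappa> s)"
    then have t: "t \<in> space N" by (simp add: sets_eq_imp_space_eq[OF sets_kernel[OF s]])
    show "emeasure (distr (law t) paths (case_nat s)) W = emeasure (law t) (case_nat s -` W \<inter> space paths)"
      by (rule emeasure_distr_law[OF s t W])
  qed
  finally show ?thesis .
qed

end

section \<open>Recurrence and ergodicity from the Liouville property\<close>

lemma sets_restrict_borel_subset: "B \<in> sets (restrict_space borel E) \<Longrightarrow> B \<subseteq> E"
  using sets.sets_into_space[of B "restrict_space borel E"] by (simp add: space_restrict_space)

lemma space_with_cemetery[simp]: "space (with_cemetery E) = insert None (Some ` E)"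
  unfolding with_cemetery_def
  by (rule space_measure_of) (auto dest: sets_restrict_borel_subset)

lemma sets_with_cemetery:
  "C \<in> sets (with_cemetery E) \<longleftrightarrow> C \<subseteq> insert None (Some ` E) \<and> Some -` C \<in> sets (restrict_space borel E)"
proof -
  let ?R = "restrict_space borel E" and ?\<Omega> = "insert None (Some ` E)"
  have sub: "(`) Some ` sets ?R \<subseteq> Pow ?\<Omega>" by (auto dest: sets_restrict_borel_subset)
  have sets: "sets (with_cemetery E) = sigma_sets ?\<Omega> ((`) Some ` sets ?R)"
    unfolding with_cemetery_def by (rule sets_measure_of[OF sub])
  show ?thesis
  proof
    assume "C \<in> sets (with_cemetery E)"
    then have "Some -` C \<in> sets ?R" unfolding sets
    proof (induction rule: sigma_sets.induct)
      case (Basic a) then show ?case by (auto simp: inj_vimage_image_eq)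
    next
      case (Compl a)
      have "Some -` (?\<Omega> - a) = space ?R - Some -` a" by (auto simp: space_restrict_space)
      with Compl show ?case by simp
    next
      case (Union a) then show ?case by (auto simp: vimage_UN)
    qed simp
    then show "C \<subseteq> ?\<Omega> \<and> Some -` C \<in> sets ?R"
      using sets.sets_into_space[OF \<open>C \<in> sets (with_cemetery E)\<close>] by simp
  next
    assume C: "C \<subseteq> ?\<Omega> \<and> Some -` C \<in> sets ?R"
    have S: "Some ` B \<in> sets (with_cemetery E)" if "B \<in> sets ?R" for B
      unfolding sets using that by auto
    \<comment> \<open>No set of the generator contains \<open>None\<close>; the cemetery is
      measurable as a complement.\<close>
    have "?\<Omega> - Some ` E \<in> sets (with_cemetery E)"
      using S[of E] sets.top[of ?R] sets.top[of "with_cemetery E"] by (auto simp: space_restrict_space)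
    also have "?\<Omega> - Some ` E = {None}" by auto
    finally have "{None} \<in> sets (with_cemetery E)" .
    moreover have "Some ` (Some -` C) \<in> sets (with_cemetery E)" using C by (intro S) auto
    moreover have "C = (if None \<in> C then {None} else {}) \<union> Some ` (Some -` C)"
      using C by (auto split: if_splits)
    ultimately show "C \<in> sets (with_cemetery E)"
      by (cases "None \<in> C") (auto dest: sets.Un elim: ssubst)
  qed
qed

lemma Some_measurable[measurable]: "Some \<in> restrict_space borel E \<rightarrow>\<^sub>M with_cemetery E"
  by (rule measurableI) (auto simp: space_restrict_space sets_with_cemetery dest: sets.sets_into_space
     intro: arg_cong[THEN iffD1, of _ _ "\<lambda>X. X \<in> sets (restrict_space borel E)"])

lemma Some_image_sets: "B \<in> sets (restrict_space borel E) \<Longrightarrow> Some ` B \<in> sets (with_cemetery E)"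
  by (auto simp: sets_with_cemetery inj_vimage_image_eq dest: sets_restrict_borel_subset)

lemma None_sets: "{None} \<in> sets (with_cemetery E)"
  by (simp add: sets_with_cemetery vimage_def)

lemma measurable_with_cemetery:
  assumes "f None \<in> space M" and f: "(\<lambda>x. f (Some x)) \<in> restrict_space borel E \<rightarrow>\<^sub>M M"
  shows "f \<in> with_cemetery E \<rightarrow>\<^sub>M M"
proof (rule measurableI)
  fix s assume "s \<in> space (with_cemetery E)"
  then show "f s \<in> space M" using assms(1) measurable_space[OF f] by (auto simp: space_restrict_space)
next
  fix A assume "A \<in> sets M"
  then have "(\<lambda>x. f (Some x)) -` A \<inter> space (restrict_space borel E) \<in> sets (restrict_space borel E)"
    using f by (rule measurable_sets[rotated])
  moreover have "Some -` (f -` A \<inter> insert None (Some ` E)) = (\<lambda>x. f (Some x)) -` A \<inter> space (restrict_space borel E)"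
    by (auto simp: space_restrict_space)
  ultimately show "f -` A \<inter> space (with_cemetery E) \<in> sets (with_cemetery E)"
    by (simp add: sets_with_cemetery)
qed

text \<open>The cemetery contributes 0, so the operator is sub-Markov where the chain can
  die.\<close>

definition kernel_op :: "('a \<Rightarrow> 'a option measure) \<Rightarrow> ('a \<Rightarrow> ennreal) \<Rightarrow> 'a \<Rightarrow> ennreal" where
  "kernel_op K f x = (\<integral>\<^sup>+s. (case s of None \<Rightarrow> 0 | Some y \<Rightarrow> f y) \<partial>K x)"

locale cemetery_chain =
  fixes E :: "'a::topological_space set" and K :: "'a \<Rightarrow> 'a option measure"
  assumes chain_kernel[measurable]: "K \<in> restrict_space borel E \<rightarrow>\<^sub>M prob_algebra (with_cemetery E)"
begin

sublocale markov_kernel "with_cemetery E" "chain_step E K"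
proof
  show "chain_step E K \<in> with_cemetery E \<rightarrow>\<^sub>M prob_algebra (with_cemetery E)"
  proof (rule measurable_with_cemetery)
    show "chain_step E K None \<in> space (prob_algebra (with_cemetery E))"
      by (auto simp: chain_step_def space_prob_algebra intro!: prob_space_return)
  qed (simp add: chain_step_def chain_kernel)
qed

lemma chain_law_eq: "chain_law E K x = law (Some x)"
  by (simp add: chain_law_def law_def chain_transition_def[abs_def] transition_def[abs_def])

lemma chain_step_Some[simp]: "chain_step E K (Some x) = K x"
  by (simp add: chain_step_def)

lemma K_sets: "x \<in> E \<Longrightarrow> sets (K x) = sets (with_cemetery E)"
  and K_prob: "x \<in> E \<Longrightarrow> prob_space (K x)"
  using measurable_space[OF chain_kernel] by (auto simp: space_restrict_space space_prob_algebra)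

lemma option_ext_measurable[measurable]:
  "f \<in> borel_measurable (restrict_space borel E) \<Longrightarrow>
    (\<lambda>s. case s of None \<Rightarrow> 0 :: ennreal | Some y \<Rightarrow> f y) \<in> borel_measurable (with_cemetery E)"
  by (rule measurable_with_cemetery) auto

lemma kernel_op_measurable[measurable]:
  assumes [measurable]: "f \<in> borel_measurable (restrict_space borel E)"
  shows "kernel_op K f \<in> borel_measurable (restrict_space borel E)"
proof -
  have [measurable]: "K \<in> restrict_space borel E \<rightarrow>\<^sub>M subprob_algebra (with_cemetery E)"
    by (rule measurable_prob_algebraD) measurable
  show ?thesis unfolding kernel_op_def[abs_def]
    by (rule measurable_compose[OF _ nn_integral_measurable_subprob_algebra]) measurable
qed

lemma option_ext_K_measurable:
  assumes "f \<in> borel_measurable (restrict_space borel E)" "x \<in> E"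
  shows "(\<lambda>s. case s of None \<Rightarrow> 0 :: ennreal | Some y \<Rightarrow> f y) \<in> borel_measurable (K x)"
  using option_ext_measurable assms by (simp add: measurable_cong_sets[OF K_sets refl])

lemma kernel_op_cong:
  assumes "x \<in> E" "\<And>y. y \<in> E \<Longrightarrow> f y = g y"
  shows "kernel_op K f x = kernel_op K g x"
  unfolding kernel_op_def
  using assms sets_eq_imp_space_eq[OF K_sets[OF assms(1)]]
  by (intro nn_integral_cong) (auto split: option.split)

lemma kernel_op_indicator:
  assumes "B \<in> sets (restrict_space borel E)" "x \<in> E"
  shows "kernel_op K (indicator B) x = emeasure (K x) (Some ` B)"
proof -
  have "(\<lambda>s. case s of None \<Rightarrow> 0 :: ennreal | Some y \<Rightarrow> indicator B y) = indicator (Some ` B)"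
    by (auto simp: fun_eq_iff indicator_def split: option.split)
  moreover have "Some ` B \<in> sets (K x)"
    using assms Some_image_sets by (simp add: K_sets)
  ultimately show ?thesis by (simp add: kernel_op_def)
qed

lemma kernel_op_add:
  assumes "f \<in> borel_measurable (restrict_space borel E)" "g \<in> borel_measurable (restrict_space borel E)" "x \<in> E"
  shows "kernel_op K (\<lambda>x. f x + g x) x = kernel_op K f x + kernel_op K g x"
proof -
  have "(\<lambda>s. case s of None \<Rightarrow> 0 | Some y \<Rightarrow> f y + g y) =
      (\<lambda>s. (case s of None \<Rightarrow> 0 | Some y \<Rightarrow> f y) + (case s of None \<Rightarrow> 0 | Some y \<Rightarrow> g y))"
    by (auto split: option.split)
  then show ?thesis unfolding kernel_op_def
    using option_ext_K_measurable[OF _ assms(3)] assms by (simp add: nn_integral_add)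
qed

lemma kernel_op_cmult:
  assumes "f \<in> borel_measurable (restrict_space borel E)" "x \<in> E"
  shows "kernel_op K (\<lambda>x. c * f x) x = c * kernel_op K f x"
proof -
  have "(\<lambda>s. case s of None \<Rightarrow> 0 | Some y \<Rightarrow> c * f y) = (\<lambda>s. c * (case s of None \<Rightarrow> 0 | Some y \<Rightarrow> f y))"
    by (auto split: option.split)
  then show ?thesis unfolding kernel_op_def
    using option_ext_K_measurable[OF assms] by (simp add: nn_integral_cmult)
qed

lemma kernel_op_SUP:
  assumes "\<And>i::nat. f i \<in> borel_measurable (restrict_space borel E)" "incseq f" "x \<in> E"
  shows "kernel_op K (\<lambda>x. SUP i. f i x) x = (SUP i. kernel_op K (f i) x)"
proof -
  have "(\<lambda>s. case s of None \<Rightarrow> 0 | Some y \<Rightarrow> (SUP i. f i y)) = (\<lambda>s. SUP i. case s of None \<Rightarrow> 0 | Some y \<Rightarrow> f i y)"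
    by (auto simp: fun_eq_iff split: option.split)
  moreover have "incseq (\<lambda>i s. case s of None \<Rightarrow> 0 | Some y \<Rightarrow> f i y)"
    using assms(2) by (auto simp: incseq_def le_fun_def split: option.split)
  ultimately show ?thesis unfolding kernel_op_def
    using option_ext_K_measurable[OF assms(1,3)]
    by (simp add: nn_integral_monotone_convergence_SUP)
qed

lemma kernel_op_functional:
  assumes "x \<in> E"
  shows "ennreal_functional (\<lambda>f. kernel_op K f x)"
  using assms
  by (intro ennreal_functionalI kernel_op_add kernel_op_cmult kernel_op_SUP measurable_restrict_space1)

end

lemma ennreal_idem:
  fixes x :: ennreal
  assumes "x * x = x" "x \<le> 1"
  shows "x = 0 \<or> x = 1"
  using assms by (cases x) (auto simp: ennreal_mult[symmetric] top_unique)

locale invariant_chain = cemetery_chain +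
  fixes \<nu> :: "'a measure"
  assumes sets_nu[measurable_cong]: "sets \<nu> = sets (restrict_space borel E)"
    and invariant: "invariant_for K \<nu>"
begin

lemma space_nu[simp]: "space \<nu> = E"
  using sets_eq_imp_space_eq[OF sets_nu] by (simp add: space_restrict_space)

lemma kernel_op_nu_measurable[measurable]:
  assumes "f \<in> borel_measurable \<nu>" shows "kernel_op K f \<in> borel_measurable \<nu>"
  using kernel_op_measurable assms by (simp add: measurable_cong_sets[OF sets_nu refl])

lemma nn_integral_kernel_op:
  assumes "f \<in> borel_measurable \<nu>"
  shows "(\<integral>\<^sup>+x. kernel_op K f x \<partial>\<nu>) = (\<integral>\<^sup>+x. f x \<partial>\<nu>)"
  using assms
proof (induction rule: borel_measurable_induct)
  case (cong f g)
  have "(\<integral>\<^sup>+x. kernel_op K f x \<partial>\<nu>) = (\<integral>\<^sup>+x. kernel_op K g x \<partial>\<nu>)"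
    using cong(3) by (intro nn_integral_cong kernel_op_cong) simp_all
  moreover have "(\<integral>\<^sup>+x. f x \<partial>\<nu>) = (\<integral>\<^sup>+x. g x \<partial>\<nu>)" using cong(3) by (intro nn_integral_cong)
  ultimately show ?case using cong by simp
next
  case (set A)
  have "(\<integral>\<^sup>+x. kernel_op K (indicator A) x \<partial>\<nu>) = (\<integral>\<^sup>+x. emeasure (K x) (Some ` A) \<partial>\<nu>)"
    using set by (intro nn_integral_cong kernel_op_indicator) (simp_all add: sets_nu)
  also have "\<dots> = emeasure \<nu> A" using invariant set by (simp add: invariant_for_def)
  finally show ?case using set by simp
next
  case (mult u c)
  have "(\<integral>\<^sup>+x. kernel_op K (\<lambda>x. c * u x) x \<partial>\<nu>) = (\<integral>\<^sup>+x. c * kernel_op K u x \<partial>\<nu>)"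
    using mult(2) by (intro nn_integral_cong kernel_op_cmult) (simp_all add: measurable_cong_sets[OF sets_nu refl])
  with mult show ?case by (simp add: nn_integral_cmult)
next
  case (add u v)
  have "(\<integral>\<^sup>+x. kernel_op K (\<lambda>x. v x + u x) x \<partial>\<nu>) = (\<integral>\<^sup>+x. kernel_op K v x + kernel_op K u x \<partial>\<nu>)"
    using add by (intro nn_integral_cong kernel_op_add) (simp_all add: measurable_cong_sets[OF sets_nu refl])
  with add show ?case by (simp add: nn_integral_add add.commute)
next
  case (seq U)
  have *: "Sup (range U) = (\<lambda>x. SUP i. U i x)" by (auto simp: fun_eq_iff SUP_apply image_comp)
  have "(\<integral>\<^sup>+x. kernel_op K (\<lambda>x. SUP i. U i x) x \<partial>\<nu>) = (\<integral>\<^sup>+x. (SUP i. kernel_op K (U i) x) \<partial>\<nu>)"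
    using seq(1,3) by (intro nn_integral_cong kernel_op_SUP) (simp_all add: measurable_cong_sets[OF sets_nu refl])
  also have "\<dots> = (SUP i. \<integral>\<^sup>+x. kernel_op K (U i) x \<partial>\<nu>)"
  proof (rule nn_integral_monotone_convergence_SUP)
    show "incseq (\<lambda>i. kernel_op K (U i))"
      using seq(3) by (auto simp: incseq_def le_fun_def kernel_op_def intro!: nn_integral_mono split: option.split)
  qed (use seq in measurable)
  also have "\<dots> = (\<integral>\<^sup>+x. (SUP i. U i x) \<partial>\<nu>)"
    using seq by (simp add: nn_integral_monotone_convergence_SUP)
  finally show ?case unfolding * .
qed

end

text \<open>The hypothesis only makes \<open>kernel_op K f\<close> constant, because that is what
  the walk controls: for both chains it is computed from a potential of the walk. Constancy of f
  itself is added by invariance in \<open>superharmonic_AE_const\<close>.\<close>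

locale liouville_chain = invariant_chain +
  assumes sigma_finite_nu: "sigma_finite_measure \<nu>"
    and nonempty: "E \<noteq> {}"
    and no_cemetery: "AE x in \<nu>. emeasure (K x) {None} = 0"
    and liouville: "\<And>f. f \<in> borel_measurable \<nu> \<Longrightarrow> (\<And>x. f x \<le> 1) \<Longrightarrow>
       AE x in \<nu>. kernel_op K f x \<le> f x \<Longrightarrow> \<exists>c. AE x in \<nu>. kernel_op K f x = c"
begin

text \<open>By invariance, from almost every point a \<nu>-null set is entered in one step with
  probability 0.\<close>

lemma AE_kernel:
  assumes "AE x in \<nu>. P x"
  shows "AE x in \<nu>. AE s in K x. \<exists>y\<in>E. s = Some y \<and> P y"
proof -
  obtain B where B: "{x\<in>space \<nu>. \<not> P x} \<subseteq> B" "emeasure \<nu> B = 0" "B \<in> sets \<nu>"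
    using assms by (rule AE_E)
  have "(\<integral>\<^sup>+x. emeasure (K x) (Some ` B) \<partial>\<nu>) = 0"
    using invariant B by (simp add: invariant_for_def)
  moreover have "(\<lambda>x. emeasure (K x) (Some ` B)) \<in> borel_measurable \<nu>"
    by (rule measurable_cong[THEN iffD1, OF _ kernel_op_nu_measurable[of "indicator B"]])
       (use B in \<open>auto simp: kernel_op_indicator sets_nu\<close>)
  ultimately have "AE x in \<nu>. emeasure (K x) (Some ` B) = 0"
    by (simp add: nn_integral_0_iff_AE)
  with no_cemetery AE_space show ?thesis
  proof eventually_elim
    case (elim x)
    then have x: "x \<in> E" by simp
    have sp: "space (K x) = insert None (Some ` E)" using sets_eq_imp_space_eq[OF K_sets[OF x]] by simp
    have "{None} \<in> null_sets (K x)" "Some ` B \<in> null_sets (K x)"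
      using elim None_sets Some_image_sets B(3) by (auto simp: null_sets_def K_sets[OF x] sets_nu)
    then have "{None} \<union> Some ` B \<in> null_sets (K x)" by (rule null_sets.Un)
    then show ?case by (rule AE_I') (use sp B(1) in auto)
  qed
qed

text \<open>If \<open>K f = c\<close> then \<open>f \<ge> c\<close>, and \<open>f - c\<close> is
  nonnegative with \<open>K (f - c) = 0\<close>, so by invariance its integral is 0. Subtracting c
  first avoids comparing the integrals of f and \<open>K f\<close>, which may both be
  infinite.\<close>

lemma superharmonic_AE_const:
  assumes [measurable]: "f \<in> borel_measurable \<nu>" and f1: "\<And>x. f x \<le> 1"
    and super: "AE x in \<nu>. kernel_op K f x \<le> f x"
  shows "\<exists>c\<le>1. AE x in \<nu>. f x = c \<and> kernel_op K f x = c"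
proof -
  obtain c where c: "AE x in \<nu>. kernel_op K f x = c" using liouville[OF assms] by blast
  have Kf: "kernel_op K f x \<le> 1" if "x \<in> E" for x
  proof -
    have "kernel_op K f x \<le> (\<integral>\<^sup>+s. 1 \<partial>K x)"
      unfolding kernel_op_def using f1 by (intro nn_integral_mono) (auto split: option.split)
    also have "\<dots> = 1" using prob_space.emeasure_space_1[OF K_prob[OF that]] by simp
    finally show ?thesis .
  qed
  show ?thesis
  proof (cases "c \<le> 1")
    case False
    \<comment> \<open>On E the function \<open>K f\<close> is at most 1, so c above 1 can only occur
      when \<nu> is zero; any constant then serves.\<close>
    have "AE x in \<nu>. False" using c AE_space
      by eventually_elim (use False Kf in auto)
    then show ?thesis by (intro exI[of _ 0]) (auto elim: eventually_mono)
  next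
    case True
    let ?g = "\<lambda>x. f x - c"
    have f_ge: "AE x in \<nu>. c \<le> f x" using c super by eventually_elim simp
    have g[measurable]: "?g \<in> borel_measurable \<nu>" by measurable
    have "AE x in \<nu>. kernel_op K ?g x = 0"
      using AE_kernel[OF f_ge] c AE_space
    proof eventually_elim
      case (elim x)
      then have x: "x \<in> E" by simp
      note m = option_ext_K_measurable[OF g[unfolded measurable_cong_sets[OF sets_nu refl]] x]
      have "c = (\<integral>\<^sup>+s. (case s of None \<Rightarrow> 0 | Some y \<Rightarrow> f y) \<partial>K x)"
        using elim(2) by (simp add: kernel_op_def)
      also have "\<dots> = (\<integral>\<^sup>+s. (case s of None \<Rightarrow> 0 | Some y \<Rightarrow> ?g y) + c \<partial>K x)"
        using elim(1) by (intro nn_integral_cong_AE) (auto elim!: eventually_mono simp: diff_add_cancel_ennreal)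
      also have "\<dots> = kernel_op K ?g x + c"
        using m prob_space.emeasure_space_1[OF K_prob[OF x]] by (simp add: nn_integral_add kernel_op_def)
      finally have "kernel_op K ?g x + c = 0 + c" by simp
      moreover have "c \<noteq> \<top>" using True by (auto simp: top_unique)
      ultimately show ?case by (metis add_0 ennreal_add_diff_cancel_right)
    qed
    then have "(\<integral>\<^sup>+x. ?g x \<partial>\<nu>) = 0"
      by (subst nn_integral_kernel_op[OF g, symmetric]) (simp add: nn_integral_0_iff_AE)
    then have "AE x in \<nu>. ?g x = 0" by (simp add: nn_integral_0_iff_AE)
    with f_ge c have "AE x in \<nu>. f x = c \<and> kernel_op K f x = c"
      by eventually_elim (auto simp: diff_eq_0_iff_ennreal)
    with True show ?thesis by blast
  qed
qed


section \<open>Recurrence, shift invariance and ergodicity\<close>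

abbreviation "start_law x \<equiv> law (Some x)"

lemma start_law_emeasure_measurable[measurable]:
  assumes "W \<in> sets paths"
  shows "(\<lambda>x. emeasure (start_law x) W) \<in> borel_measurable \<nu>"
proof -
  have "(\<lambda>s. emeasure (law s) W) \<in> borel_measurable (with_cemetery E)"
    by (rule measurable_emeasure_subprob_algebra[THEN measurable_compose[OF law_subprob]]) fact
  then have "(\<lambda>x. emeasure (start_law x) W) \<in> borel_measurable (restrict_space borel E)"
    by (rule measurable_compose[OF Some_measurable])
  then show ?thesis by (simp add: measurable_cong_sets[OF sets_nu refl])
qed

lemma start_law_le_1: "x \<in> E \<Longrightarrow> emeasure (start_law x) W \<le> 1"
  using prob_space.measure_le_1[OF prob_space_law[of "Some x"]] by auto

lemma AE_no_cemetery: "AE x in \<nu>. AE s in K x. s \<noteq> None"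
  using AE_kernel[of "\<lambda>_. True"] by (auto elim!: eventually_mono)

text \<open>The law started at the cemetery may charge V, whereas \<open>kernel_op\<close> counts 0
  there; hence the premise that \<open>K x\<close> does not charge \<open>None\<close>.\<close>

lemma law_tail:
  assumes "AE s in K x. s \<noteq> None" "x \<in> E" "W \<in> sets paths"
    and W: "case_nat (Some x) -` W \<inter> space paths = V"
  shows "emeasure (start_law x) W = kernel_op K (\<lambda>y. emeasure (start_law y) V) x"
proof -
  have "emeasure (start_law x) W = (\<integral>\<^sup>+t. emeasure (law t) V \<partial>K x)"
    using emeasure_law_step[of "Some x" W] assms by simp
  also have "\<dots> = kernel_op K (\<lambda>y. emeasure (start_law y) V) x"
    unfolding kernel_op_def
  proof (rule nn_integral_cong_AE)
    show "AE t in K x. emeasure (law t) V = (case t of None \<Rightarrow> 0 | Some y \<Rightarrow> emeasure (start_law y) V)"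
      using assms(1) by eventually_elim (auto split: option.split)
  qed
  finally show ?thesis .
qed

lemma shift_measurable[measurable]: "shift \<in> paths \<rightarrow>\<^sub>M paths"
  unfolding shift_def[abs_def] by (intro measurable_PiM_single') (auto simp: space_PiM PiE_iff)

lemma case_nat_vimage_shift:
  assumes "x \<in> E"
  shows "case_nat (Some x) -` (shift -` W \<inter> space paths) \<inter> space paths = W \<inter> space paths"
  using assms by (auto simp: shift_def[abs_def] space_PiM PiE_iff split: nat.split)

text \<open>Let f be the probability of ever visiting B, time 0 included. Then \<open>K f\<close> is
  the probability of a visit at a positive time, so f is superharmonic. Both equal the same constant
  almost everywhere, and \<open>f = 1\<close> on B makes this constant 1.\<close>

lemma recurrent: "recurrent_for E K \<nu>"
  unfolding recurrent_for_def chain_law_eq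
proof (intro ballI impI)
  fix B assume B: "B \<in> sets \<nu>"
  let ?V = "{s\<in>space paths. \<exists>n. s n \<in> Some ` B}"
  let ?W = "{s\<in>space paths. \<exists>n\<ge>1. s n \<in> Some ` B}"
  have [measurable]: "Some ` B \<in> sets (with_cemetery E)"
    using B Some_image_sets by (simp add: sets_nu)
  have V[measurable]: "?V \<in> sets paths" and W[measurable]: "?W \<in> sets paths" by measurable
  let ?f = "\<lambda>x. if x \<in> E then emeasure (start_law x) ?V else 0"
  \<comment> \<open>Time 0 of the tail is time 1 of the path, so visits at positive times become
    visits at any time.\<close>
  have WV: "case_nat (Some x) -` ?W \<inter> space paths = ?V" if "x \<in> E" for x
    using that by (auto simp: space_PiM PiE_iff Suc_le_eq gr0_conv_Suc split: nat.split)
  have f[measurable]: "?f \<in> borel_measurable \<nu>"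
    by (rule measurable_cong[THEN iffD1, OF _ start_law_emeasure_measurable[OF V]]) simp
  have f1: "?f x \<le> 1" for x by (simp add: start_law_le_1)
  have Kf: "AE x in \<nu>. emeasure (start_law x) ?W = kernel_op K ?f x"
    using AE_no_cemetery AE_space
  proof eventually_elim
    case (elim x)
    then have x: "x \<in> E" by simp
    have "kernel_op K (\<lambda>y. emeasure (start_law y) ?V) x = kernel_op K ?f x"
      unfolding kernel_op_def using sets_eq_imp_space_eq[OF K_sets[OF x]]
      by (intro nn_integral_cong) (auto split: option.split)
    then show ?case using law_tail[OF elim(1) x W WV[OF x]] by simp
  qed
  have "AE x in \<nu>. kernel_op K ?f x \<le> ?f x"
    using Kf AE_space
  proof eventually_elim
    case (elim x)
    have "emeasure (start_law x) ?W \<le> emeasure (start_law x) ?V"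
      by (rule emeasure_mono) (use elim V in auto)
    with elim show ?case by simp
  qed
  from superharmonic_AE_const[OF f f1 this]
  obtain c where "AE x in \<nu>. ?f x = c \<and> kernel_op K ?f x = c" by blast
  with Kf AE_space show "AE x in \<nu>. x \<in> B \<longrightarrow> measure (start_law x) ?W = 1"
  proof eventually_elim
    case (elim x)
    then have x: "Some x \<in> space (with_cemetery E)" by simp
    interpret P: prob_space "start_law x" by (rule prob_space_law[OF x])
    show ?case
    proof
      assume "x \<in> B"
      have "emeasure (start_law x) (cyl (Suc 0) (\<lambda>_. Some ` B)) = 1"
        using \<open>x \<in> B\<close> x prob_space.emeasure_space_1[OF K_prob[of x]]
        by (subst emeasure_law_cylinder[OF x]) auto
      then have "1 \<le> emeasure (start_law x) ?V"
        using V x by (auto intro!: emeasure_mono elim!: ord_eq_le_trans[OF sym])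
      then have "c = 1" using elim x start_law_le_1[of x ?V] by auto
      then have "emeasure (start_law x) ?W = 1" using elim by simp
      then show "measure (start_law x) ?W = 1" by (simp add: measure_def)
    qed
  qed
qed

lemma emeasure_chain_law_under:
  assumes "W \<in> sets paths"
  shows "emeasure (chain_law_under E K \<nu>) W = (\<integral>\<^sup>+x. emeasure (start_law x) W \<partial>\<nu>)"
  unfolding chain_law_under_def
proof (subst emeasure_bind)
  have "(\<lambda>x. law (Some x)) \<in> restrict_space borel E \<rightarrow>\<^sub>M subprob_algebra paths" by measurable
  then show "chain_law E K \<in> \<nu> \<rightarrow>\<^sub>M subprob_algebra paths"
    by (simp add: chain_law_eq[abs_def] measurable_cong_sets[OF sets_nu refl])
qed (use assms nonempty in \<open>simp_all add: chain_law_eq\<close>)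

lemma sets_chain_law_under: "sets (chain_law_under E K \<nu>) = sets paths"
  unfolding chain_law_under_def by (rule sets_bind) (auto simp: chain_law_eq nonempty)

lemma shift_invariant: "distr (chain_law_under E K \<nu>) paths shift = chain_law_under E K \<nu>"
proof (rule measure_eqI)
  let ?L = "chain_law_under E K \<nu>"
  have sp: "space ?L = space paths" by (rule sets_eq_imp_space_eq[OF sets_chain_law_under])
  fix W assume "W \<in> sets (distr ?L paths shift)"
  then have W: "W \<in> sets paths" by simp
  then have sW: "shift -` W \<inter> space paths \<in> sets paths" by measurable
  have "emeasure (distr ?L paths shift) W = emeasure ?L (shift -` W \<inter> space paths)"
    using W by (subst emeasure_distr) (simp_all add: sp measurable_cong_sets[OF sets_chain_law_under refl])
  also have "\<dots> = (\<integral>\<^sup>+x. emeasure (start_law x) (shift -` W \<inter> space paths) \<partial>\<nu>)"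
    by (rule emeasure_chain_law_under[OF sW])
  also have "\<dots> = (\<integral>\<^sup>+x. kernel_op K (\<lambda>y. emeasure (start_law y) W) x \<partial>\<nu>)"
  proof (rule nn_integral_cong_AE)
    show "AE x in \<nu>. emeasure (start_law x) (shift -` W \<inter> space paths) = kernel_op K (\<lambda>y. emeasure (start_law y) W) x"
      using AE_no_cemetery AE_space
    proof eventually_elim
      case (elim x)
      then show ?case
        using law_tail[OF elim(1) _ sW case_nat_vimage_shift] sets.sets_into_space[OF W] by (simp add: Int_absorb2)
    qed
  qed
  also have "\<dots> = (\<integral>\<^sup>+x. emeasure (start_law x) W \<partial>\<nu>)"
    by (rule nn_integral_kernel_op[OF start_law_emeasure_measurable[OF W]])
  finally show "emeasure (distr ?L paths shift) W = emeasure ?L W"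
    by (simp add: emeasure_chain_law_under[OF W])
qed (simp add: sets_chain_law_under)

text \<open>An almost invariant event \<open>W\<close> has a harmonic, hence constant, conditional probability \<open>c\<close>;
  so \<open>W\<close> is independent of all cylinders and therefore of itself.\<close>

lemma ergodic_event:
  assumes W: "W \<in> sets paths"
    and inv: "sym_diff (shift -` W \<inter> space paths) W \<in> null_sets (chain_law_under E K \<nu>)"
  shows "W \<in> null_sets (chain_law_under E K \<nu>) \<or> space paths - W \<in> null_sets (chain_law_under E K \<nu>)"
proof -
  let ?L = "chain_law_under E K \<nu>"
  interpret nu: sigma_finite_measure \<nu> by (rule sigma_finite_nu)
  let ?D = "sym_diff (shift -` W \<inter> space paths) W"
  have sW: "shift -` W \<inter> space paths \<in> sets paths" using W by measurable
  have WS: "W \<inter> space paths = W" using sets.sets_into_space[OF W] by blast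
  have D: "?D \<in> sets paths" using inv sets_chain_law_under by (auto simp: null_sets_def)
  have "(\<integral>\<^sup>+x. emeasure (start_law x) ?D \<partial>\<nu>) = 0"
    using inv emeasure_chain_law_under[OF D] by (simp add: null_sets_def)
  then have AE_D: "AE x in \<nu>. emeasure (start_law x) ?D = 0"
    by (simp add: nn_integral_0_iff_AE start_law_emeasure_measurable[OF D])
  \<comment> \<open>From almost every x the event \<open>?D\<close> has probability 0, so W may be
    exchanged for its shift preimage inside any event V.\<close>
  have AE_W: "AE x in \<nu>. \<forall>V\<in>sets paths. emeasure (start_law x) (V \<inter> (shift -` W \<inter> space paths)) = emeasure (start_law x) (V \<inter> W)"
    using AE_D AE_space
  proof eventually_elim
    case (elim x)
    then have x: "Some x \<in> space (with_cemetery E)" by simp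
    show ?case
    proof
      fix V assume V: "V \<in> sets paths"
      have D0: "?D \<in> null_sets (start_law x)" using elim(1) D x by (simp add: null_sets_def)
      show "emeasure (start_law x) (V \<inter> (shift -` W \<inter> space paths)) = emeasure (start_law x) (V \<inter> W)"
      proof (rule emeasure_eq_AE)
        show "AE \<omega> in start_law x. (\<omega> \<in> V \<inter> (shift -` W \<inter> space paths)) = (\<omega> \<in> V \<inter> W)"
          using AE_not_in[OF D0] by eventually_elim blast
      qed (use V W sW x in auto)
    qed
  qed
  let ?f = "\<lambda>x. if x \<in> E then emeasure (start_law x) W else 0"
  have f[measurable]: "?f \<in> borel_measurable \<nu>"
    by (rule measurable_cong[THEN iffD1, OF _ start_law_emeasure_measurable[OF W]]) simp
  have f1: "?f x \<le> 1" for x by (simp add: start_law_le_1)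
  have "AE x in \<nu>. kernel_op K ?f x \<le> ?f x"
    using AE_W AE_no_cemetery AE_space
  proof eventually_elim
    case (elim x)
    then have x: "x \<in> E" by simp
    have "kernel_op K ?f x = kernel_op K (\<lambda>y. emeasure (start_law y) W) x"
      unfolding kernel_op_def using sets_eq_imp_space_eq[OF K_sets[OF x]]
      by (intro nn_integral_cong) (auto split: option.split)
    also have "\<dots> = emeasure (start_law x) (space paths \<inter> (shift -` W \<inter> space paths))"
      using law_tail[OF elim(2) x sW case_nat_vimage_shift[OF x]] WS by (simp add: Int_absorb1)
    also have "\<dots> = emeasure (start_law x) (space paths \<inter> W)" using elim(1) by blast
    finally show ?case using x WS by (simp add: Int_commute)
  qed
  from superharmonic_AE_const[OF f f1 this]
  obtain c where c1: "c \<le> 1" and c': "AE x in \<nu>. ?f x = c \<and> kernel_op K ?f x = c"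
    by (elim exE conjE)
  from c' have c: "AE x in \<nu>. ?f x = c" by eventually_elim simp
  \<comment> \<open>In the induction W is replaced by its shift preimage. Then the first state only
    decides membership in \<open>A 0\<close>, and what remains is a shorter cylinder intersected
    with W, seen from the next state.\<close>
  have cyl: "AE x in \<nu>. emeasure (start_law x) (cyl n A \<inter> W) = c * emeasure (start_law x) (cyl n A)"
    if "\<And>i. A i \<in> sets (with_cemetery E)" for n A
    using that
  proof (induction n arbitrary: A)
    case 0
    from c AE_space show ?case
    proof eventually_elim
      case (elim x)
      then show ?case
        using prob_space.emeasure_space_1[OF prob_space_law[of "Some x"]] WS by (simp add: Int_commute)
    qed
  next
    case (Suc n)
    let ?A = "\<lambda>i. A (Suc i)"
    have C: "cyl n ?A \<in> sets paths" "cyl (Suc n) A \<in> sets paths"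
      using Suc.prems by (auto intro!: cylinder_sets)
    from AE_kernel[OF Suc.IH[of ?A, OF Suc.prems]] AE_W AE_no_cemetery AE_space show ?case
    proof eventually_elim
      case (elim x)
      then have x: "x \<in> E" and xs: "Some x \<in> space (with_cemetery E)" by auto
      have "emeasure (start_law x) (cyl (Suc n) A \<inter> W) = emeasure (start_law x) (cyl (Suc n) A \<inter> (shift -` W \<inter> space paths))"
        using bspec[OF elim(2) C(2)] by (rule sym)
      also have "\<dots> = kernel_op K (\<lambda>y. emeasure (start_law y) (if Some x \<in> A 0 then cyl n ?A \<inter> W else {})) x"
      proof (rule law_tail[OF elim(3) x])
        show "cyl (Suc n) A \<inter> (shift -` W \<inter> space paths) \<in> sets paths" using C sW by blast
        show "case_nat (Some x) -` (cyl (Suc n) A \<inter> (shift -` W \<inter> space paths)) \<inter> space paths =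
           (if Some x \<in> A 0 then cyl n ?A \<inter> W else {})"
        proof -
          have h: "case_nat (Some x) -` cyl (Suc n) A \<inter> space paths = (if Some x \<in> A 0 then cyl n ?A else {})"
            using x by (auto simp: space_PiM PiE_iff All_less_Suc2 split: nat.split)
          have "case_nat (Some x) -` (cyl (Suc n) A \<inter> (shift -` W \<inter> space paths)) \<inter> space paths =
            (case_nat (Some x) -` cyl (Suc n) A \<inter> space paths) \<inter> (case_nat (Some x) -` (shift -` W \<inter> space paths) \<inter> space paths)"
            by blast
          also have "\<dots> = (if Some x \<in> A 0 then cyl n ?A else {}) \<inter> W"
            unfolding h case_nat_vimage_shift[OF x] WS ..
          finally show ?thesis by simp
        qed
      qed
      also have "\<dots> = (\<integral>\<^sup>+s. c * (case s of None \<Rightarrow> 0 | Some y \<Rightarrow> emeasure (start_law y) (if Some x \<in> A 0 then cyl n ?A else {})) \<partial>K x)"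
        unfolding kernel_op_def
      proof (rule nn_integral_cong_AE)
        show "AE s in K x. (case s of None \<Rightarrow> 0 | Some y \<Rightarrow> emeasure (start_law y) (if Some x \<in> A 0 then cyl n ?A \<inter> W else {})) =
          c * (case s of None \<Rightarrow> 0 | Some y \<Rightarrow> emeasure (start_law y) (if Some x \<in> A 0 then cyl n ?A else {}))"
          using elim(1) by eventually_elim auto
      qed
      also have "\<dots> = c * kernel_op K (\<lambda>y. emeasure (start_law y) (if Some x \<in> A 0 then cyl n ?A else {})) x"
        unfolding kernel_op_def
      proof (rule nn_integral_cmult, rule option_ext_K_measurable[OF _ x],
          rule start_law_emeasure_measurable[unfolded measurable_cong_sets[OF sets_nu refl]])
        show "(if Some x \<in> A 0 then cyl n ?A else {}) \<in> sets paths"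
          by (cases "Some x \<in> A 0") (simp_all only: if_True if_False C(1) sets.empty_sets simp_thms)
      qed
      also have "kernel_op K (\<lambda>y. emeasure (start_law y) (if Some x \<in> A 0 then cyl n ?A else {})) x = emeasure (start_law x) (cyl (Suc n) A)"
      proof (rule law_tail[OF elim(3) x C(2), symmetric])
        show "case_nat (Some x) -` cyl (Suc n) A \<inter> space paths = (if Some x \<in> A 0 then cyl n ?A else {})"
          using x by (auto simp: space_PiM PiE_iff All_less_Suc2 split: nat.split)
      qed
      finally show ?case .
    qed
  qed
  \<comment> \<open>Started from \<nu> restricted to F, the law is finite, so cylinders determine
    it, and W takes the share c of every event. Choosing W as the event gives \<open>c * c\<close>
    in place of c.\<close>
  have cc: "c * emeasure \<nu> F = c * (c * emeasure \<nu> F)" if F: "F \<in> sets \<nu>" "emeasure \<nu> F < \<infinity>" for F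
  proof -
    have [measurable]: "F \<in> sets \<nu>" by fact
    have m: "chain_law E K \<in> density \<nu> (indicator F) \<rightarrow>\<^sub>M subprob_algebra paths"
    proof -
      have "(\<lambda>x. law (Some x)) \<in> restrict_space borel E \<rightarrow>\<^sub>M subprob_algebra paths" by measurable
      then show ?thesis by (simp add: chain_law_eq[abs_def] measurable_cong_sets[OF sets_nu refl])
    qed
    define LF where "LF = density \<nu> (indicator F) \<bind> chain_law E K"
    have sets_LF: "sets LF = sets paths"
      unfolding LF_def by (rule sets_bind) (auto simp: chain_law_eq nonempty)
    have LF: "emeasure LF V = (\<integral>\<^sup>+x. indicator F x * emeasure (start_law x) V \<partial>\<nu>)" if V: "V \<in> sets paths" for V
      unfolding LF_def using V start_law_emeasure_measurable[OF V] nonempty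
      by (subst emeasure_bind[OF _ m V]) (simp_all add: chain_law_eq nn_integral_density)
    have W': "W \<in> sets LF" using W by (simp only: sets_LF)
    have dens: "emeasure (density LF (indicator W)) V = emeasure LF (V \<inter> W)" if "V \<in> sets paths" for V
      using emeasure_restricted[OF W', of V] that by (simp only: sets_LF Int_commute)
    have "density LF (indicator W) = scale_measure c LF"
    proof (rule measure_eqI_PiM_infinite)
      show "sets (density LF (indicator W)) = sets paths" "sets (scale_measure c LF) = sets paths"
        by (simp_all add: sets_LF)
      show "finite_measure (density LF (indicator W))"
      proof
        have "emeasure (density LF (indicator W)) (space paths) = emeasure LF (W \<inter> space paths)"
          using dens[OF sets.top] by (simp only: Int_commute)
        also have "\<dots> \<le> (\<integral>\<^sup>+x. indicator F x \<partial>\<nu>)"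
          unfolding WS LF[OF W] by (intro nn_integral_mono) (auto simp: indicator_def start_law_le_1)
        also have "\<dots> < \<infinity>" using F by simp
        finally show "emeasure (density LF (indicator W)) (space (density LF (indicator W))) \<noteq> \<infinity>"
          by (simp add: sets_eq_imp_space_eq[OF sets_LF])
      qed
      fix A J assume J: "finite (J::nat set)" "\<And>i. i \<in> J \<Longrightarrow> A i \<in> sets (with_cemetery E)"
      have J': "\<forall>j\<in>J. A j \<in> sets (with_cemetery E)" using J(2) by blast
      from prod_emb_eq_cylinder[OF J(1) J'] obtain n B where B': "\<forall>i. B i \<in> sets (with_cemetery E)"
        "prod_emb UNIV (\<lambda>_. with_cemetery E) J (PiE J A) = cyl n B"
        by (elim exE conjE)
      note B = B'(1)[rule_format]
      have C: "cyl n B \<in> sets paths" using B by (rule cylinder_sets)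
      have "emeasure (density LF (indicator W)) (cyl n B) = emeasure LF (cyl n B \<inter> W)"
        by (rule dens[OF C])
      also have "\<dots> = (\<integral>\<^sup>+x. indicator F x * emeasure (start_law x) (cyl n B \<inter> W) \<partial>\<nu>)"
        by (rule LF[OF sets.Int[OF C W]])
      also have "\<dots> = (\<integral>\<^sup>+x. c * (indicator F x * emeasure (start_law x) (cyl n B)) \<partial>\<nu>)"
      proof (rule nn_integral_cong_AE)
        show "AE x in \<nu>. indicator F x * emeasure (start_law x) (cyl n B \<inter> W) = c * (indicator F x * emeasure (start_law x) (cyl n B))"
          using cyl[of B n, OF B] by eventually_elim (simp add: mult.left_commute)
      qed
      also have "\<dots> = c * emeasure LF (cyl n B)"
        unfolding LF[OF C] by (intro nn_integral_cmult borel_measurable_times_ennreal start_law_emeasure_measurable[OF C]) simp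
      finally show "emeasure (density LF (indicator W)) (prod_emb UNIV (\<lambda>_. with_cemetery E) J (PiE J A)) =
          emeasure (scale_measure c LF) (prod_emb UNIV (\<lambda>_. with_cemetery E) J (PiE J A))"
        unfolding B'(2) by simp
    qed
    then have "emeasure (density LF (indicator W)) W = emeasure (scale_measure c LF) W" by simp
    then have "emeasure LF W = c * emeasure LF W"
      using dens[OF W] by simp
    moreover have "emeasure LF W = (\<integral>\<^sup>+x. c * indicator F x \<partial>\<nu>)"
      unfolding LF[OF W]
    proof (rule nn_integral_cong_AE)
      show "AE x in \<nu>. indicator F x * emeasure (start_law x) W = c * indicator F x"
        using c AE_space by eventually_elim (auto simp: mult.commute)
    qed
    ultimately show ?thesis by (simp add: nn_integral_cmult)
  qed
  have L_W: "emeasure ?L W = (\<integral>\<^sup>+x. c \<partial>\<nu>)"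
    unfolding emeasure_chain_law_under[OF W]
  proof (rule nn_integral_cong_AE)
    show "AE x in \<nu>. emeasure (start_law x) W = c" using c AE_space by eventually_elim simp
  qed
  have L_W': "emeasure ?L (space paths - W) = (\<integral>\<^sup>+x. 1 - c \<partial>\<nu>)"
    unfolding emeasure_chain_law_under[OF sets.compl_sets[OF W]]
  proof (rule nn_integral_cong_AE)
    show "AE x in \<nu>. emeasure (start_law x) (space paths - W) = 1 - c" using c AE_space
    proof eventually_elim
      case (elim x)
      then have x: "Some x \<in> space (with_cemetery E)" by simp
      interpret P: prob_space "start_law x" by (rule prob_space_law[OF x])
      show ?case
        using emeasure_compl[of W "start_law x"] P.emeasure_space_1 W x elim P.emeasure_finite[of W] by simp
    qed
  qed
  show ?thesis
  proof (cases "emeasure \<nu> E = 0")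
    case True
    then have "emeasure ?L W = 0" using L_W by (simp)
    then show ?thesis using W by (simp add: null_sets_def sets_chain_law_under)
  next
    case False
    obtain F where F: "F \<in> sets \<nu>" "emeasure \<nu> F < \<infinity>" "emeasure \<nu> F \<noteq> 0"
    proof -
      obtain S :: "nat \<Rightarrow> 'a set" where S: "range S \<subseteq> sets \<nu>" "(\<Union>i. S i) = space \<nu>" "\<And>i. emeasure \<nu> (S i) \<noteq> \<infinity>"
        using nu.sigma_finite by metis
      have "\<exists>i. emeasure \<nu> (S i) \<noteq> 0"
      proof (rule ccontr)
        assume "\<not> ?thesis"
        then have "(\<Union>i. S i) \<in> null_sets \<nu>" using S(1) by (intro null_sets_UN) (auto simp: null_sets_def)
        with S(2) False show False by (simp add: null_sets_def)
      qed
      then show ?thesis using S that by (auto simp: less_top)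
    qed
    have "emeasure \<nu> F * c = emeasure \<nu> F * (c * c)"
      using cc[OF F(1,2)] by (simp add: ac_simps)
    then have "c * c = c"
      using F(2,3) by (subst (asm) ennreal_mult_cancel_left) auto
    then have "c = 0 \<or> c = 1" using c1 by (rule ennreal_idem)
    then show ?thesis
      using L_W L_W' W by (auto simp: null_sets_def sets_chain_law_under)
  qed
qed

lemma ergodic: "ergodic_for E K \<nu>"
  unfolding ergodic_for_def Let_def using shift_invariant ergodic_event by blast

end

section \<open>Crossings\<close>

context subgroup_walk
begin

lemma step_pow_mono_Z:
  assumes W: "\<And>x y. x \<in> Z \<Longrightarrow> y \<in> Z \<Longrightarrow> (x, y) \<in> W \<Longrightarrow> (x, y) \<in> W'"
    and fg: "\<And>x. x \<in> Z \<Longrightarrow> f x \<le> g x" and "x \<in> Z"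
  shows "(step \<mu> W ^^ n) f x \<le> (step \<mu> W' ^^ n) g x"
  using \<open>x \<in> Z\<close>
proof (induction n arbitrary: x)
  case 0 then show ?case using fg by simp
next
  case (Suc n)
  have "step \<mu> W ((step \<mu> W ^^ n) f) x \<le> step \<mu> W' ((step \<mu> W' ^^ n) g) x"
  proof (rule step_mono_Z[OF Suc.prems])
    fix y assume "y \<in> Z"
    then show "indicator W (x, y) * (step \<mu> W ^^ n) f y \<le> indicator W' (x, y) * (step \<mu> W' ^^ n) g y"
      using Suc.IH[of y] W[OF Suc.prems, of y] by (auto simp: indicator_def)
  qed
  then show ?case by simp
qed

lemma potential_mono_Z:
  assumes "\<And>x. x \<in> Z \<Longrightarrow> f x \<le> g x" "x \<in> Z"
  shows "potential W f x \<le> potential W g x"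
  unfolding potential_def using assms by (intro suminf_le step_pow_mono_Z) auto

lemma potential_cong_Z:
  assumes "\<And>x. x \<in> Z \<Longrightarrow> f x = g x" "x \<in> Z"
  shows "potential W f x = potential W g x"
  using potential_mono_Z[of f g x W] potential_mono_Z[of g f x W] assms by (intro antisym) auto

end

text \<open>\<open>Ai\<close> and \<open>Bi\<close> are open sets of the ambient space standing for the interiors of \<open>A\<close> and
  \<open>Ac\<close> relative to \<open>Z\<close>; that they carry \<open>haar\<close> is the form in which a null boundary is used.\<close>

locale crossing = haar_walk +
  fixes A Ac Ai Bi :: "'a set"
  assumes A_subset: "A \<subseteq> Z" and A_borel[measurable]: "A \<in> sets borel" and Ac_eq: "Ac = Z - A"
    and open_Ai: "open Ai" and open_Bi: "open Bi"
    and Ai_subset: "Ai \<inter> Z \<subseteq> A" and Bi_subset: "Bi \<inter> Z \<subseteq> Ac"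
    and AE_interior: "AE x in haar. x \<in> Ai \<union> Bi"
    and Ai_nonempty: "Ai \<inter> Z \<noteq> {}" and Bi_nonempty: "Bi \<inter> Z \<noteq> {}"
begin

lemma Ac_borel[measurable]: "Ac \<in> sets borel"
  unfolding Ac_eq by simp

abbreviation "cross \<equiv> Ac \<times> A"

lemma cross_borel[measurable]: "cross \<in> sets borel"
  unfolding borel_prod[symmetric] by (rule pair_measureI) measurable

text \<open>\<open>Q\<close> is a step that does not cross from \<open>Ac\<close> to \<open>A\<close>, \<open>R\<close> a step that does, and \<open>H = \<Sum>\<^sub>n Q\<^sup>n\<close>.
  So the entrance kernel is \<open>H R\<close>, and the exit kernel is \<open>f \<mapsto> R (H (f p)) / p\<close> with \<open>p = R 1\<close>.\<close>

abbreviation "Q \<equiv> step \<mu> (- cross)"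
abbreviation "R \<equiv> step \<mu> cross"
abbreviation "H \<equiv> potential (- cross)"

section \<open>Decomposition of paths at the first crossing\<close>

lemma step_split:
  assumes "f \<in> borel_measurable borel"
  shows "step \<mu> UNIV f x = Q f x + R f x"
  using step_Un[of "- cross" cross f x] assms by simp

lemma R_outside: "x \<notin> Ac \<Longrightarrow> R f x = 0"
  by (simp add: step_def)

text \<open>The index k is the time of the exit point; the entrance time is \<open>Suc k\<close>.
  The exit chain reads position k, the entrance chain position \<open>Suc k\<close>.\<close>

definition first_cross :: "'a \<Rightarrow> (nat \<Rightarrow> 'a) \<Rightarrow> nat \<Rightarrow> bool" where
  "first_cross x \<omega> k \<longleftrightarrow> (pos x \<omega> k, pos x \<omega> (Suc k)) \<in> cross \<and> (\<forall>j<k. (pos x \<omega> j, pos x \<omega> (Suc j)) \<notin> cross)"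

lemma first_cross_Suc:
  "first_cross x (case_nat y \<omega>) (Suc k) \<longleftrightarrow> (x, x + y) \<notin> cross \<and> first_cross (x + y) \<omega> k"
  using pos_case_nat[of x y \<omega> 0]
  by (auto simp: first_cross_def pos_case_nat All_less_Suc2)

lemma first_cross_unique: "first_cross x \<omega> k \<Longrightarrow> first_cross x \<omega> l \<Longrightarrow> k = l"
  unfolding first_cross_def by (metis linorder_neqE_nat)

lemma first_cross_exists:
  assumes k: "(pos x \<omega> k, pos x \<omega> (Suc k)) \<in> cross"
  shows "\<exists>l. first_cross x \<omega> l"
proof
  let ?l = "LEAST k. (pos x \<omega> k, pos x \<omega> (Suc k)) \<in> cross"
  show "first_cross x \<omega> ?l"
    unfolding first_cross_def
  proof (intro conjI allI impI)
    show "(pos x \<omega> ?l, pos x \<omega> (Suc ?l)) \<in> cross" using k by (rule LeastI)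
    show "(pos x \<omega> j, pos x \<omega> (Suc j)) \<notin> cross" if "j < ?l" for j
      using not_less_Least[OF that] .
  qed
qed

lemma first_cross_measurable[measurable]: "Measurable.pred (PiM UNIV (\<lambda>_. borel)) (\<lambda>\<omega>. first_cross x \<omega> k)"
  unfolding first_cross_def mem_Times_iff fst_conv snd_conv by measurable

abbreviation cross_event :: "'a \<Rightarrow> nat \<Rightarrow> 'a set \<Rightarrow> 'a set \<Rightarrow> (nat \<Rightarrow> 'a) set" where
  "cross_event x k B' B \<equiv>
     {\<omega>\<in>space path_law. first_cross x \<omega> k \<and> pos x \<omega> k \<in> B' \<and> pos x \<omega> (Suc k) \<in> B}"

text \<open>A first crossing at k consists of k steps under \<open>Q\<close> and one under
  \<open>R\<close>. Constraining both the exit point (\<open>B'\<close>) and the entrance point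
  (\<open>B\<close>) makes the formula serve both chains.\<close>

lemma emeasure_first_cross:
  assumes [measurable]: "B \<in> sets borel" "B' \<in> sets borel"
  shows "emeasure path_law (cross_event x k B' B) =
    (Q ^^ k) (\<lambda>x. indicator B' x * R (indicator B) x) x"
proof (induction k arbitrary: x)
  case 0
  interpret P: prob_space path_law by (rule prob_space_path_law)
  have p1: "pos x (case_nat y \<omega>) (Suc 0) = x + y" for y \<omega>
    using pos_case_nat[of x y \<omega> 0] by simp
  have "emeasure path_law (cross_event x 0 B' B) =
    (\<integral>\<^sup>+y. emeasure path_law {\<omega>\<in>space path_law. first_cross x (case_nat y \<omega>) 0 \<and> pos x (case_nat y \<omega>) 0 \<in> B' \<and> pos x (case_nat y \<omega>) (Suc 0) \<in> B} \<partial>\<mu>)"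
    by (rule emeasure_path_law) measurable
  also have "\<dots> = (\<integral>\<^sup>+y. indicator B' x * (indicator cross (x, x + y) * indicator B (x + y)) \<partial>\<mu>)"
    using P.emeasure_space_1
    by (intro nn_integral_cong) (auto simp: first_cross_def p1 indicator_def)
  also have "\<dots> = indicator B' x * R (indicator B) x"
    unfolding step_def by (rule nn_integral_cmult) measurable
  finally show ?case by simp
next
  case (Suc k)
  have "emeasure path_law (cross_event x (Suc k) B' B) =
    (\<integral>\<^sup>+y. emeasure path_law {\<omega>\<in>space path_law. first_cross x (case_nat y \<omega>) (Suc k) \<and> pos x (case_nat y \<omega>) (Suc k) \<in> B' \<and> pos x (case_nat y \<omega>) (Suc (Suc k)) \<in> B} \<partial>\<mu>)"
    by (rule emeasure_path_law) measurable
  also have "\<dots> = (\<integral>\<^sup>+y. indicator (- cross) (x, x + y) * (Q ^^ k) (\<lambda>x. indicator B' x * R (indicator B) x) (x + y) \<partial>\<mu>)"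
  proof (rule nn_integral_cong)
    fix y
    show "emeasure path_law {\<omega>\<in>space path_law. first_cross x (case_nat y \<omega>) (Suc k) \<and> pos x (case_nat y \<omega>) (Suc k) \<in> B' \<and> pos x (case_nat y \<omega>) (Suc (Suc k)) \<in> B}
       = indicator (- cross) (x, x + y) * (Q ^^ k) (\<lambda>x. indicator B' x * R (indicator B) x) (x + y)"
    proof (cases "(x, x + y) \<in> cross")
      case True
      then show ?thesis by (simp add: first_cross_Suc)
    next
      case False
      then have "{\<omega>\<in>space path_law. first_cross x (case_nat y \<omega>) (Suc k) \<and> pos x (case_nat y \<omega>) (Suc k) \<in> B' \<and> pos x (case_nat y \<omega>) (Suc (Suc k)) \<in> B}
         = cross_event (x + y) k B' B"
        unfolding first_cross_Suc pos_case_nat by blast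
      with False show ?thesis by (simp only: Suc) simp
    qed
  qed
  finally show ?case by (simp add: step_def[of _ _ _ x])
qed

lemma emeasure_crossing_position:
  assumes [measurable]: "B \<in> sets borel" "B' \<in> sets borel"
  shows "emeasure path_law {\<omega>\<in>space path_law. \<exists>k. first_cross x \<omega> k \<and> pos x \<omega> k \<in> B' \<and> pos x \<omega> (Suc k) \<in> B} =
    H (\<lambda>x. indicator B' x * R (indicator B) x) x"
proof -
  let ?S = "\<lambda>k. cross_event x k B' B"
  have S: "?S k \<in> sets path_law" for k by measurable
  have "disjoint_family ?S"
    unfolding disjoint_family_on_def by (auto dest: first_cross_unique)
  with image_subsetI[of UNIV ?S, OF S]
  have "(\<Sum>k. emeasure path_law (?S k)) = emeasure path_law (\<Union>k. ?S k)"
    by (rule suminf_emeasure)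
  moreover have "(\<Union>k. ?S k) = {\<omega>\<in>space path_law. \<exists>k. first_cross x \<omega> k \<and> pos x \<omega> k \<in> B' \<and> pos x \<omega> (Suc k) \<in> B}"
    by blast
  ultimately show ?thesis by (simp only: potential_def emeasure_first_cross assms)
qed

lemma emeasure_ex_first_cross:
  "emeasure path_law {\<omega>\<in>space path_law. \<exists>k. first_cross x \<omega> k} = H (R (\<lambda>_. 1)) x"
proof -
  have 1: "(\<lambda>x. indicator UNIV x * R (indicator UNIV) x) = R (\<lambda>_. 1)"
    by (simp add: fun_eq_iff indicator_def)
  show ?thesis
    using emeasure_crossing_position[of UNIV UNIV x] unfolding 1 by simp
qed

text \<open>Stated at every point, not only on Z, because \<open>superharmonic_const\<close> asks
  for a bound everywhere.\<close>

lemma potential_R_one_le: "H (R (\<lambda>_. 1)) x \<le> 1"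
  unfolding emeasure_ex_first_cross[symmetric]
  by (rule prob_space.measure_le_1[OF prob_space_path_law])

text \<open>The path visits \<open>Bi\<close> and later \<open>Ai\<close>. If it never crossed in
  between, it would stay in \<open>Ac\<close> from the first visit to the second.\<close>

lemma AE_first_cross:
  assumes "x \<in> Z"
  shows "AE \<omega> in path_law. \<exists>k. first_cross x \<omega> k"
proof -
  obtain a b where a: "a \<in> Ai" "a \<in> Z" and b: "b \<in> Bi" "b \<in> Z"
    using Ai_nonempty Bi_nonempty by blast
  show ?thesis
    using recurrent[OF assms a(2) open_Ai a(1)] recurrent[OF assms b(2) open_Bi b(1)] AE_path_in_Z
  proof eventually_elim
    case (elim \<omega>)
    have pos_Z: "pos x \<omega> n \<in> Z" for n
      using assms elim(3) by (induction n) (auto simp: pos_def add.assoc[symmetric] intro: Z_add)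
    obtain n where n: "pos x \<omega> n \<in> Bi" using elim(2) not_finite_existsD by auto
    obtain m where m: "n < m" "pos x \<omega> m \<in> Ai" using elim(1) by (auto simp: infinite_nat_iff_unbounded)
    have "\<exists>k. n \<le> k \<and> k < m \<and> pos x \<omega> k \<in> Ac \<and> pos x \<omega> (Suc k) \<in> A"
    proof (rule ccontr)
      assume no: "\<not> ?thesis"
      have "n + j \<le> m \<Longrightarrow> pos x \<omega> (n + j) \<in> Ac" for j
      proof (induction j)
        case 0 then show ?case using n Bi_subset pos_Z by auto
      next
        case (Suc j)
        then have "pos x \<omega> (n + j) \<in> Ac" "n + j < m" by auto
        with no have "pos x \<omega> (Suc (n + j)) \<notin> A" by auto
        then show ?case using pos_Z[of "Suc (n + j)"] by (simp add: Ac_eq)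
      qed
      from this[of "m - n"] m have "pos x \<omega> m \<in> Ac" by simp
      with m Ai_subset pos_Z show False by (auto simp: Ac_eq)
    qed
    then obtain k where "(pos x \<omega> k, pos x \<omega> (Suc k)) \<in> cross" by auto
    then show ?case by (rule first_cross_exists)
  qed
qed

lemma potential_R_one:
  assumes "x \<in> Z"
  shows "H (R (\<lambda>_. 1)) x = 1"
proof -
  interpret P: prob_space path_law by (rule prob_space_path_law)
  show ?thesis
    unfolding emeasure_ex_first_cross[symmetric]
  proof (rule P.emeasure_eq_1_AE)
    show "AE \<omega> in path_law. \<omega> \<in> {\<omega>\<in>space path_law. \<exists>k. first_cross x \<omega> k}"
      using AE_first_cross[OF assms] AE_space by eventually_elim blast
  qed measurable
qed

section \<open>The identity \<open>haar R H = haar\<close>\<close>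

lemma haar_R_le:
  assumes [measurable]: "f \<in> borel_measurable borel"
  shows "(\<integral>\<^sup>+x. R f x \<partial>haar) \<le> (\<integral>\<^sup>+x. f x \<partial>haar)"
  by (subst haar_invariant[OF assms, symmetric]) (intro nn_integral_mono, simp add: step_split)

lemma haar_R_potential_eq:
  assumes [measurable]: "f \<in> borel_measurable borel"
  shows "(\<integral>\<^sup>+x. R (H f) x \<partial>haar) = (\<Sum>k. \<integral>\<^sup>+x. R ((Q ^^ k) f) x \<partial>haar)"
  unfolding potential_def[abs_def] by (subst step_suminf) (auto simp: nn_integral_suminf)

text \<open>Iterating \<open>haar = haar Q + haar R\<close> writes \<open>haar\<close> as the sum of
  \<open>haar R Q^k\<close> over \<open>k < n\<close> plus the remainder \<open>haar Q^n\<close>.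
  Only an inequality results: \<open>haar\<close> may be infinite, so the remainder is not seen to
  vanish from the crossing probabilities alone.\<close>

lemma haar_R_potential_le:
  assumes [measurable]: "f \<in> borel_measurable borel"
  shows "(\<integral>\<^sup>+x. R (H f) x \<partial>haar) \<le> (\<integral>\<^sup>+x. f x \<partial>haar)"
proof -
  have eq: "(\<Sum>k<n. \<integral>\<^sup>+x. R ((Q ^^ k) f) x \<partial>haar) + (\<integral>\<^sup>+x. (Q ^^ n) f x \<partial>haar) = (\<integral>\<^sup>+x. f x \<partial>haar)" for n
  proof (induction n)
    case (Suc n)
    have "(\<integral>\<^sup>+x. (Q ^^ n) f x \<partial>haar) = (\<integral>\<^sup>+x. Q ((Q ^^ n) f) x + R ((Q ^^ n) f) x \<partial>haar)"
      by (subst haar_invariant[symmetric]) (auto intro!: nn_integral_cong step_split)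
    also have "\<dots> = (\<integral>\<^sup>+x. (Q ^^ Suc n) f x \<partial>haar) + (\<integral>\<^sup>+x. R ((Q ^^ n) f) x \<partial>haar)"
      by (subst nn_integral_add) simp_all
    finally show ?case using Suc by (simp add: ac_simps)
  qed simp
  have "(\<Sum>k. \<integral>\<^sup>+x. R ((Q ^^ k) f) x \<partial>haar) \<le> (\<integral>\<^sup>+x. f x \<partial>haar)"
    unfolding suminf_eq_SUP
  proof (rule SUP_least)
    fix n show "(\<Sum>k<n. \<integral>\<^sup>+x. R ((Q ^^ k) f) x \<partial>haar) \<le> (\<integral>\<^sup>+x. f x \<partial>haar)"
      unfolding eq[of n, symmetric] by simp
  qed
  then show ?thesis by (simp add: haar_R_potential_eq)
qed

lemma potential_functional: "ennreal_functional (\<lambda>f. H f x)"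
  by (rule ennreal_functionalI) (simp_all add: potential_add potential_cmult potential_SUP)

lemma R_potential_functional: "ennreal_functional (\<lambda>f. R (H f) x)"
proof (rule ennreal_functionalI)
  fix f :: "nat \<Rightarrow> 'a \<Rightarrow> ennreal"
  assume [measurable]: "\<And>i. f i \<in> borel_measurable borel" and inc: "incseq f"
  then have "incseq (\<lambda>i. H (f i))" by (auto simp: incseq_def intro!: potential_mono)
  then show "R (H (\<lambda>x. SUP i. f i x)) x = (SUP i. R (H (f i)) x)"
    using inc by (simp add: potential_SUP step_SUP)
qed (simp_all add: potential_add step_add potential_cmult step_cmult)

text \<open>Otherwise every \<open>haar Q^n R\<close> would vanish, and so would the integral of
  \<open>H (R 1)\<close>, which is the total mass of \<open>haar\<close>.\<close>

lemma haar_R_one_nonzero: "(\<integral>\<^sup>+x. R (\<lambda>_. 1) x \<partial>haar) \<noteq> 0"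
proof
  assume 0: "(\<integral>\<^sup>+x. R (\<lambda>_. 1) x \<partial>haar) = 0"
  have le: "(\<integral>\<^sup>+x. (Q ^^ n) (R (\<lambda>_. 1)) x \<partial>haar) \<le> (\<integral>\<^sup>+x. R (\<lambda>_. 1) x \<partial>haar)" for n
  proof (induction n)
    case (Suc n)
    have "(\<integral>\<^sup>+x. Q ((Q ^^ n) (R (\<lambda>_. 1))) x \<partial>haar) \<le> (\<integral>\<^sup>+x. step \<mu> UNIV ((Q ^^ n) (R (\<lambda>_. 1))) x \<partial>haar)"
      by (intro nn_integral_mono step_mono) auto
    also have "\<dots> = (\<integral>\<^sup>+x. (Q ^^ n) (R (\<lambda>_. 1)) x \<partial>haar)" by (rule haar_invariant) measurable
    finally show ?case using Suc by simp
  qed simp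
  have "emeasure haar UNIV = (\<integral>\<^sup>+x. 1 \<partial>haar)"
    using sets_eq_imp_space_eq[OF sets_haar] by simp
  also have "\<dots> = (\<integral>\<^sup>+x. H (R (\<lambda>_. 1)) x \<partial>haar)"
    using AE_haar_Z by (intro nn_integral_cong_AE) (auto elim!: eventually_mono simp: potential_R_one)
  also have "\<dots> = (\<Sum>n. \<integral>\<^sup>+x. (Q ^^ n) (R (\<lambda>_. 1)) x \<partial>haar)"
    unfolding potential_def[abs_def] by (rule nn_integral_suminf) measurable
  also have "\<dots> = 0" using le 0 by simp
  finally show False using haar_nonzero by simp
qed

text \<open>Last-exit decomposition. The left side is an excessive measure below \<open>haar\<close>, hence
  \<open>c * haar\<close>, and comparing one step of both sides gives \<open>c = 1\<close>; no time reversal is needed.\<close>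

lemma haar_R_potential:
  assumes f[measurable]: "f \<in> borel_measurable borel"
  shows "(\<integral>\<^sup>+x. R (H f) x \<partial>haar) = (\<integral>\<^sup>+x. f x \<partial>haar)"
proof -
  have "ennreal_functional (\<lambda>f. \<integral>\<^sup>+x. R (H f) x \<partial>haar)"
    by (intro ennreal_functional_nn_integral R_potential_functional)
       (simp add: measurable_cong_sets[OF sets_haar refl] step_measurable potential_measurable)
  obtain m where sets_m[measurable_cong, simp]: "sets m = sets borel"
    and m: "\<And>f. f \<in> borel_measurable borel \<Longrightarrow> (\<integral>\<^sup>+x. f x \<partial>m) = (\<integral>\<^sup>+x. R (H f) x \<partial>haar)"
    by (rule ennreal_functional_eq_nn_integral[OF \<open>ennreal_functional _\<close>]) (rule that)
  have m_le: "(\<integral>\<^sup>+x. f x \<partial>m) \<le> (\<integral>\<^sup>+x. f x \<partial>haar)" if "f \<in> borel_measurable borel" for f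
    using m[OF that] haar_R_potential_le[OF that] by simp
  have em_le: "emeasure m B \<le> emeasure haar B" if "B \<in> sets borel" for B
    using m_le[of "indicator B"] that by simp
  \<comment> \<open>As measures, \<open>m = haar R + m Q\<close>.\<close>
  have unfold: "(\<integral>\<^sup>+x. f x \<partial>m) = (\<integral>\<^sup>+x. R f x \<partial>haar) + (\<integral>\<^sup>+x. Q f x \<partial>m)"
    if [measurable]: "f \<in> borel_measurable borel" for f
  proof -
    have "H f = (\<lambda>x. f x + H (Q f) x)" by (rule ext) (rule potential_unfold_right; measurable)
    then have "(\<integral>\<^sup>+x. f x \<partial>m) = (\<integral>\<^sup>+x. R (\<lambda>x. f x + H (Q f) x) x \<partial>haar)" by (simp add: m)
    also have "\<dots> = (\<integral>\<^sup>+x. R f x \<partial>haar) + (\<integral>\<^sup>+x. R (H (Q f)) x \<partial>haar)"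
      by (simp add: step_add nn_integral_add)
    finally show ?thesis by (simp add: m)
  qed
  have split: "(\<integral>\<^sup>+x. step \<mu> UNIV f x \<partial>m) = (\<integral>\<^sup>+x. R f x \<partial>m) + (\<integral>\<^sup>+x. Q f x \<partial>m)"
    if [measurable]: "f \<in> borel_measurable borel" for f
    by (simp add: step_split nn_integral_add add.commute)
  obtain w where w: "w \<in> Ai" "w \<in> Z" using Ai_nonempty by blast
  obtain U where U: "open U" "w \<in> U" "emeasure haar U < \<infinity>" using haar_locally_finite by blast
  obtain c where c: "c < \<infinity>" "m = scale_measure c haar"
  proof (rule excessive_measure_proportional[of m U w])
    have "emeasure m (- Z) \<le> emeasure haar (- Z)" by (rule em_le) measurable
    also have "emeasure haar (- Z) = 0"
      using AE_haar_Z by (subst (asm) AE_iff_measurable[of "- Z"]) (auto simp: sets_eq_imp_space_eq[OF sets_haar])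
    finally show "AE x in m. x \<in> Z"
      by (subst AE_iff_measurable[of "- Z"]) (auto simp: sets_eq_imp_space_eq[OF sets_m])
    show "emeasure m U < \<infinity>" using em_le[of U] U by (meson borel_open le_less_trans)
    \<comment> \<open>Excessive, because \<open>m P = m R + m Q\<close> while
      \<open>m \<le> haar\<close> gives \<open>m R \<le> haar R\<close>.\<close>
    fix f :: "'a \<Rightarrow> ennreal" assume [measurable]: "f \<in> borel_measurable borel"
    have "(\<integral>\<^sup>+x. R f x \<partial>m) \<le> (\<integral>\<^sup>+x. R f x \<partial>haar)" by (rule m_le) measurable
    then show "(\<integral>\<^sup>+x. step \<mu> UNIV f x \<partial>m) \<le> (\<integral>\<^sup>+x. f x \<partial>m)"
      by (simp add: split unfold[of f] add_right_mono)
  qed (use U w in auto)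
  have mc: "(\<integral>\<^sup>+x. f x \<partial>m) = c * (\<integral>\<^sup>+x. f x \<partial>haar)" if "f \<in> borel_measurable borel" for f
    unfolding c(2) using that by (simp add: nn_integral_scale_measure)
  obtain S :: "nat \<Rightarrow> 'a set" where S: "range S \<subseteq> sets haar" "(\<Union>i. S i) = space haar" "\<And>i. emeasure haar (S i) \<noteq> \<infinity>"
    using haar.sigma_finite by metis
  then have [measurable]: "S i \<in> sets borel" for i by auto
  \<comment> \<open>A set of finite \<open>haar\<close> measure that \<open>haar R\<close> charges
    is needed to cancel down to c.\<close>
  have "\<exists>i. (\<integral>\<^sup>+x. R (indicator (S i)) x \<partial>haar) \<noteq> 0"
  proof (rule ccontr)
    assume *: "\<not> ?thesis"
    have S_UN: "x \<in> (\<Union>i. S i)" for x using S(2) by (simp add: sets_eq_imp_space_eq[OF sets_haar])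
    have "1 \<le> (\<Sum>i. indicator (S i) x :: ennreal)" for x
    proof -
      obtain i where "x \<in> S i" using S_UN[of x] by blast
      then show ?thesis using sum_le_suminf[of "\<lambda>i. indicator (S i) x :: ennreal" "{i}"] by simp
    qed
    then have "(\<integral>\<^sup>+x. R (\<lambda>_. 1) x \<partial>haar) \<le> (\<integral>\<^sup>+x. R (\<lambda>x. \<Sum>i. indicator (S i) x) x \<partial>haar)"
      by (intro nn_integral_mono step_mono) (auto simp: le_fun_def)
    also have "\<dots> = (\<Sum>i. \<integral>\<^sup>+x. R (indicator (S i)) x \<partial>haar)"
      by (subst step_suminf) (auto simp: nn_integral_suminf)
    also have "\<dots> = 0" using * by simp
    finally show False using haar_R_one_nonzero by simp
  qed
  then obtain i where i: "(\<integral>\<^sup>+x. R (indicator (S i)) x \<partial>haar) \<noteq> 0" by blast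
  let ?r = "\<integral>\<^sup>+x. R (indicator (S i)) x \<partial>haar" and ?q = "\<integral>\<^sup>+x. Q (indicator (S i)) x \<partial>m"
  have r: "?r < \<infinity>"
    using haar_R_le[of "indicator (S i)"] S(3)[of i] by (auto simp: less_top intro: le_less_trans)
  \<comment> \<open>As a multiple of \<open>haar\<close>, m satisfies \<open>m = m P\<close>.
    Expanding both sides gives \<open>haar R + m Q = c haar R + m Q\<close> on \<open>S i\<close>,
    with finite terms.\<close>
  have "?r + ?q = (\<integral>\<^sup>+x. indicator (S i) x \<partial>m)" by (rule unfold[symmetric]) measurable
  also have "\<dots> = (\<integral>\<^sup>+x. step \<mu> UNIV (indicator (S i)) x \<partial>m)"
    by (simp add: mc haar_invariant del: nn_integral_indicator)
  also have "\<dots> = c * ?r + ?q" by (subst split) (simp_all add: mc)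
  finally have eq: "?r + ?q = c * ?r + ?q" .
  have "?q \<le> (\<integral>\<^sup>+x. indicator (S i) x \<partial>m)"
    by (subst unfold) auto
  also have "\<dots> = c * emeasure haar (S i)" by (subst mc) simp_all
  also have "\<dots> < \<infinity>" using S(3)[of i] c(1) by (simp add: ennreal_mult_less_top less_top)
  finally have "?q \<noteq> \<top>" by simp
  then have "?r = c * ?r" using eq by (metis ennreal_add_diff_cancel_right)
  then have "?r * 1 = ?r * c" by (simp add: mult.commute)
  then have "c = 1" using i r by (subst (asm) ennreal_mult_cancel_left) auto
  then show ?thesis using m[OF f] mc[OF f] by simp
qed

text \<open>Since \<open>H g = g + Q (H g)\<close>, the hypothesis \<open>R (H g) \<le> g\<close>
  makes \<open>H g\<close> superharmonic for the full step. The entrance chain uses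
  \<open>g = R f\<close>, the exit chain \<open>g = f p\<close>.\<close>

lemma potential_const:
  assumes [measurable]: "g \<in> borel_measurable borel" and g: "\<And>x. g x \<le> R (\<lambda>_. 1) x"
    and super: "AE x in haar. R (H g) x \<le> g x"
  obtains c where "AE x in haar. H g x = c"
proof (rule superharmonic_const[of "H g"])
  show "H g x \<le> 1" for x
    using potential_mono[of g "R (\<lambda>_. 1)"] potential_R_one_le[of x] g
    by (auto simp: le_fun_def intro: order_trans)
  show "AE x in haar. step \<mu> UNIV (H g) x \<le> H g x"
    using super
  proof eventually_elim
    case (elim x)
    have "step \<mu> UNIV (H g) x = Q (H g) x + R (H g) x" by (rule step_split) measurable
    also have "\<dots> \<le> g x + Q (H g) x" using elim by (simp add: add.commute add_right_mono)
    also have "\<dots> = H g x" by (rule potential_unfold[symmetric]) measurable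
    finally show ?case .
  qed
qed (use that in auto)

text \<open>Versions of \<open>Q\<close> and \<open>R\<close> on open sets of pairs, which preserve
  lower semicontinuity. On Z the pairs are the non-crossing and the crossing steps among interior
  points; steps touching the boundary are dropped from both.\<close>

abbreviation "Qi \<equiv> step \<mu> (Ai \<times> (Ai \<union> Bi) \<union> Bi \<times> Bi)"
abbreviation "Ri \<equiv> step \<mu> (Bi \<times> Ai)"

lemma interior_borel[measurable]: "Ai \<times> (Ai \<union> Bi) \<union> Bi \<times> Bi \<in> sets borel" "Bi \<times> Ai \<in> sets borel"
  using open_Ai open_Bi by (auto intro!: borel_open open_Un open_Times)

text \<open>Almost every start is interior and, as the step respects null sets, so is almost every
  position reached from it.\<close>

lemma AE_interior_eq:
  "AE x in haar. (Qi ^^ n) (Ri (\<lambda>_. 1)) x = (Q ^^ n) (R (\<lambda>_. 1)) x"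
proof -
  have 1: "AE x in haar. \<forall>f. Qi f x = Q f x \<and> Ri f x = R f x"
    using AE_haar_step[OF AE_interior] AE_interior AE_haar_Z
  proof eventually_elim
    case (elim x)
    have *: "AE y in \<mu>. ((x, x + y) \<in> Ai \<times> (Ai \<union> Bi) \<union> Bi \<times> Bi \<longleftrightarrow> (x, x + y) \<notin> cross) \<and>
        ((x, x + y) \<in> Bi \<times> Ai \<longleftrightarrow> (x, x + y) \<in> cross)"
      using elim(1) AE_in_subgroup
    proof eventually_elim
      case (elim y)
      then show ?case
        using Ai_subset Bi_subset \<open>x \<in> Ai \<union> Bi\<close> \<open>x \<in> Z\<close> Z_add[of x y] unfolding Ac_eq by blast
    qed
    show ?case
    proof (intro allI conjI)
      fix f
      show "Qi f x = Q f x" unfolding step_def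
        by (rule nn_integral_cong_AE) (use * in eventually_elim, auto simp: indicator_def)
      show "Ri f x = R f x" unfolding step_def
        by (rule nn_integral_cong_AE) (use * in eventually_elim, auto simp: indicator_def)
    qed
  qed
  show ?thesis
  proof (induction n)
    case 0 show ?case using 1 by eventually_elim simp
  next
    case (Suc n)
    show ?case using AE_haar_step_cong[OF Suc, of "Ai \<times> (Ai \<union> Bi) \<union> Bi \<times> Bi"] 1
      by eventually_elim simp
  qed
qed

text \<open>Lower semicontinuity turns the positivity of a crossing probability at one point into
  a uniform lower bound on an open set.\<close>

lemma potential_finite_on_open:
  assumes sets_s[measurable_cong]: "sets s = sets borel" and s_Z: "AE x in s. x \<in> Z"
    and lsc: "\<And>i::nat. lsc (\<phi> i)" and meas[measurable]: "\<And>i. \<psi> i \<in> borel_measurable borel"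
    and le: "\<And>i x. x \<in> Z \<Longrightarrow> \<phi> i x \<le> \<psi> i x"
    and cover: "\<And>x. x \<in> Z \<Longrightarrow> Ri (\<lambda>_. 1) x \<le> (\<Sum>i. \<phi> i x)"
    and fin: "\<And>i. (\<integral>\<^sup>+x. H (\<psi> i) x \<partial>s) < \<infinity>"
  obtains U w where "open U" "w \<in> U" "w \<in> Z" "(\<integral>\<^sup>+x. H (indicator U) x \<partial>s) < \<infinity>"
proof -
  have [measurable]: "\<phi> i \<in> borel_measurable borel" for i using lsc by (rule lsc_measurable)
  \<comment> \<open>Otherwise every \<open>(Qi ^^ n) (Ri 1)\<close> vanishes on Z, and the crossing
    probability \<open>H (R 1)\<close> would be 0 almost everywhere instead of 1.\<close>
  have "\<exists>n i x. x \<in> Z \<and> (Qi ^^ n) (\<phi> i) x \<noteq> 0"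
  proof (rule ccontr)
    assume *: "\<not> ?thesis"
    have sum0: "(Qi ^^ n) (\<lambda>x. \<Sum>i. \<phi> i x) = (\<lambda>x. \<Sum>i. (Qi ^^ n) (\<phi> i) x)" for n
      by (induction n) (auto simp: step_suminf)
    have z: "(Qi ^^ n) (Ri (\<lambda>_. 1)) x = 0" if "x \<in> Z" for n x
    proof -
      have "(Qi ^^ n) (Ri (\<lambda>_. 1)) x \<le> (Qi ^^ n) (\<lambda>x. \<Sum>i. \<phi> i x) x"
        using cover that by (intro step_pow_mono_Z) auto
      also have "\<dots> = 0" using * that by (simp add: sum0)
      finally show ?thesis by simp
    qed
    have "AE x in haar. \<forall>n. (Qi ^^ n) (Ri (\<lambda>_. 1)) x = (Q ^^ n) (R (\<lambda>_. 1)) x"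
      using AE_interior_eq by (simp add: AE_all_countable)
    then have "AE x in haar. False"
      using AE_haar_Z
    proof eventually_elim
      case (elim x)
      then have "H (R (\<lambda>_. 1)) x = 0" using z[OF elim(2)] by (simp add: potential_def)
      with potential_R_one[OF elim(2)] show ?case by simp
    qed
    then show False
      using haar_nonzero AE_iff_measurable[of UNIV haar "\<lambda>_. False"]
      by (simp add: sets_eq_imp_space_eq[OF sets_haar])
  qed
  then obtain n i w where w: "w \<in> Z" "(Qi ^^ n) (\<phi> i) w \<noteq> 0" by blast
  then obtain e where e: "0 < e" "e < (Qi ^^ n) (\<phi> i) w"
    using dense[of 0 "(Qi ^^ n) (\<phi> i) w"] by (auto simp: zero_less_iff_neq_zero)
  let ?U = "{x. e < (Qi ^^ n) (\<phi> i) x}"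
  have "lsc ((Qi ^^ n) (\<phi> i))"
    using open_Ai open_Bi by (induction n) (auto intro!: lsc lsc_step open_Un open_Times)
  then have U: "open ?U" by (simp add: lsc_def)
  then have [measurable]: "?U \<in> sets borel" by (rule borel_open)
  \<comment> \<open>The lower bound e passes through the potential:
    \<open>e * H 1_U \<le> H (Q^n \<psi>) \<le> H \<psi>\<close>, where the last step drops the
    first n terms of a series.\<close>
  have "e * (\<integral>\<^sup>+x. H (indicator ?U) x \<partial>s) = (\<integral>\<^sup>+x. H (\<lambda>x. e * indicator ?U x) x \<partial>s)"
    by (simp add: potential_cmult nn_integral_cmult)
  also have "\<dots> \<le> (\<integral>\<^sup>+x. H (\<psi> i) x \<partial>s)"
    using s_Z
  proof (intro nn_integral_mono_AE, eventually_elim)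
    case (elim x)
    have "H (\<lambda>x. e * indicator ?U x) x \<le> H ((Q ^^ n) (\<psi> i)) x"
    proof (rule potential_mono_Z[OF _ elim(2)])
      fix x assume x: "x \<in> Z"
      have "e * indicator ?U x \<le> (Qi ^^ n) (\<phi> i) x" by (auto simp: indicator_def)
      also have "\<dots> \<le> (Q ^^ n) (\<psi> i) x"
        using Ai_subset Bi_subset by (intro step_pow_mono_Z le x) (auto simp: Ac_eq)
      finally show "e * indicator ?U x \<le> (Q ^^ n) (\<psi> i) x" .
    qed
    also have "\<dots> \<le> H (\<psi> i) x" by (rule potential_step_pow_le)
    finally show ?case .
  qed
  also have "\<dots> < \<infinity>" by (rule fin)
  finally have "(\<integral>\<^sup>+x. H (indicator ?U) x \<partial>s) < \<infinity>"
    using e(1) by (auto simp: ennreal_mult_less_top zero_less_iff_neq_zero)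
  with U e w show ?thesis by (intro that[of ?U w]) auto
qed

text \<open>For \<open>m = s H\<close> the invariance \<open>s H R = s\<close> gives
  \<open>m P = m Q + m R = s H Q + s = m\<close>, so m is invariant for the walk, and one open set
  of finite measure makes it a multiple of \<open>haar\<close>. Both uniqueness proofs pass through
  this lemma.\<close>

lemma potential_proportional:
  assumes sets_s[measurable_cong]: "sets s = sets borel" and s_Z: "AE x in s. x \<in> Z"
    and inv: "\<And>f. f \<in> borel_measurable borel \<Longrightarrow> (\<integral>\<^sup>+x. H (R f) x \<partial>s) = (\<integral>\<^sup>+x. f x \<partial>s)"
    and U: "open U" "w \<in> U" "w \<in> Z" "(\<integral>\<^sup>+x. H (indicator U) x \<partial>s) < \<infinity>"
  obtains c where "c < \<infinity>" "\<And>f. f \<in> borel_measurable borel \<Longrightarrow> (\<integral>\<^sup>+x. H f x \<partial>s) = c * (\<integral>\<^sup>+x. f x \<partial>haar)"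
proof -
  have "ennreal_functional (\<lambda>f. \<integral>\<^sup>+x. H f x \<partial>s)"
    by (intro ennreal_functional_nn_integral potential_functional)
       (simp add: measurable_cong_sets[OF sets_s refl] step_measurable potential_measurable)
  obtain m where sets_m[measurable_cong, simp]: "sets m = sets borel"
    and m: "\<And>f. f \<in> borel_measurable borel \<Longrightarrow> (\<integral>\<^sup>+x. f x \<partial>m) = (\<integral>\<^sup>+x. H f x \<partial>s)"
    by (rule ennreal_functional_eq_nn_integral[OF \<open>ennreal_functional _\<close>]) (rule that)
  obtain c where c: "c < \<infinity>" "m = scale_measure c haar"
  proof (rule excessive_measure_proportional[of m U w])
    have "emeasure m (- Z) = (\<integral>\<^sup>+x. H (indicator (- Z)) x \<partial>s)"
      using m[of "indicator (- Z)"] by simp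
    also have "\<dots> = (\<integral>\<^sup>+x. H (\<lambda>_. 0) x \<partial>s)"
      using s_Z
    proof (intro nn_integral_cong_AE, eventually_elim)
      case (elim x) show ?case by (rule potential_cong_Z[OF _ elim(2)]) simp
    qed
    also have "\<dots> = 0"
      using m[of "\<lambda>_. 0"] by simp
    finally show "AE x in m. x \<in> Z"
      by (subst AE_iff_measurable[of "- Z"]) (auto simp: sets_eq_imp_space_eq[OF sets_m])
    show "emeasure m U < \<infinity>" using m[of "indicator U"] U by simp
    fix f :: "'a \<Rightarrow> ennreal" assume [measurable]: "f \<in> borel_measurable borel"
    have "(\<integral>\<^sup>+x. step \<mu> UNIV f x \<partial>m) = (\<integral>\<^sup>+x. Q f x \<partial>m) + (\<integral>\<^sup>+x. R f x \<partial>m)"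
      by (simp add: step_split nn_integral_add)
    also have "\<dots> = (\<integral>\<^sup>+x. H (Q f) x \<partial>s) + (\<integral>\<^sup>+x. f x \<partial>s)"
      by (simp add: m inv)
    also have "\<dots> = (\<integral>\<^sup>+x. f x + H (Q f) x \<partial>s)"
      by (simp add: nn_integral_add add.commute)
    also have "\<dots> = (\<integral>\<^sup>+x. f x \<partial>m)"
      by (subst potential_unfold_right[symmetric]) (simp_all add: m)
    finally show "(\<integral>\<^sup>+x. step \<mu> UNIV f x \<partial>m) \<le> (\<integral>\<^sup>+x. f x \<partial>m)" by simp
  qed (use U in auto)
  have "(\<integral>\<^sup>+x. H f x \<partial>s) = c * (\<integral>\<^sup>+x. f x \<partial>haar)" if "f \<in> borel_measurable borel" for f
    using m[OF that] that unfolding c(2) by (simp add: nn_integral_scale_measure)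
  with c(1) show ?thesis by (rule that)
qed

end

section \<open>The entrance chain\<close>

text \<open>The images under \<open>Some\<close> form an intersection-stable generator, and total
  mass 1 accounts for the cemetery, so only these evaluations need checking.\<close>

lemma prob_kernelI:
  assumes "\<And>x. x \<in> space M \<Longrightarrow> prob_space (K x)" "\<And>x. x \<in> space M \<Longrightarrow> sets (K x) = sets (with_cemetery E)"
    and "\<And>B. B \<in> sets (restrict_space borel E) \<Longrightarrow> (\<lambda>x. emeasure (K x) (Some ` B)) \<in> borel_measurable M"
  shows "K \<in> M \<rightarrow>\<^sub>M prob_algebra (with_cemetery E)"
proof (rule measurable_prob_algebra_generated[where \<Omega>="insert None (Some ` E)" and G="(`) Some ` sets (restrict_space borel E)"])
  have sub: "(`) Some ` sets (restrict_space borel E) \<subseteq> Pow (insert None (Some ` E))"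
    by (auto dest: sets_restrict_borel_subset)
  show "(`) Some ` sets (restrict_space borel E) \<subseteq> Pow (insert None (Some ` E))" by (rule sub)
  show "sets (with_cemetery E) = sigma_sets (insert None (Some ` E)) ((`) Some ` sets (restrict_space borel E))"
    unfolding with_cemetery_def by (rule sets_measure_of[OF sub])
  show "Int_stable ((`) Some ` sets (restrict_space borel E))"
    by (auto simp: Int_stable_def image_Int[symmetric])
qed (use assms in auto)

lemma restrict_borel_measurable_extend:
  fixes f :: "'a::topological_space \<Rightarrow> ennreal"
  assumes "f \<in> borel_measurable (restrict_space borel E)" "E \<in> sets borel"
  shows "(\<lambda>x. f x * indicator E x) \<in> borel_measurable borel"
  using assms by (simp add: borel_measurable_restrict_space_iff_ennreal)

lemma restrict_sets_borel:
  assumes "E \<in> sets borel"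
  shows "B \<in> sets (restrict_space borel E) \<longleftrightarrow> B \<in> sets borel \<and> B \<subseteq> E"
  using assms by (subst sets_restrict_space_iff) auto

lemma locally_finite_cover:
  fixes \<nu> :: "'a::second_countable_topology measure"
  assumes lf: "locally_finite_borel_measure_on E \<nu>"
  obtains V :: "nat \<Rightarrow> 'a set" where "\<And>i. open (V i)" "\<And>i. emeasure \<nu> (V i \<inter> E) < \<infinity>" "E \<subseteq> (\<Union>i. V i)"
proof -
  let ?F = "{V. open V \<and> emeasure \<nu> (V \<inter> E) < \<infinity>}"
  have "E \<subseteq> \<Union>?F"
  proof
    fix x assume "x \<in> E"
    then obtain U where "openin (top_of_set E) U" "x \<in> U" "emeasure \<nu> U < \<infinity>"
      using lf by (auto simp: locally_finite_borel_measure_on_def)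
    moreover then obtain V where "open V" "U = E \<inter> V" by (auto simp: openin_open)
    ultimately show "x \<in> \<Union>?F" by (auto simp: Int_commute)
  qed
  moreover obtain F where F: "F \<subseteq> ?F" "countable F" "\<Union>F = \<Union>?F"
    using Lindelof[of ?F] by auto
  \<comment> \<open>Adding the empty set keeps the family nonempty, so that
    \<open>from_nat_into\<close> enumerates it even when F is empty.\<close>
  moreover have "range (from_nat_into (insert {} F)) = insert {} F"
    using F(2) by (intro range_from_nat_into) auto
  moreover have "from_nat_into (insert {} F) i \<in> ?F" for i
  proof -
    have "insert {} F \<subseteq> ?F" using F(1) by auto
    moreover have "from_nat_into (insert {} F) i \<in> insert {} F" by (rule from_nat_into) simp
    ultimately show ?thesis by blast
  qed
  ultimately show ?thesis
    by (intro that[of "from_nat_into (insert {} F)"]) auto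
qed

context crossing
begin

text \<open>The measures of the chains live on a subspace sigma-algebra, so being below
  \<open>haar\<close> is expressed by integrals of Borel functions on the whole space.\<close>

lemma nn_integral_le_AE:
  assumes le: "\<And>f. f \<in> borel_measurable borel \<Longrightarrow> (\<integral>\<^sup>+x. f x \<partial>\<nu>) \<le> (\<integral>\<^sup>+x. f x \<partial>haar)"
    and sets: "sets \<nu> = sets (restrict_space borel E)" and E: "E \<in> sets borel"
    and "AE x in haar. P x"
  shows "AE x in \<nu>. P x"
proof -
  obtain N where N: "{x\<in>space haar. \<not> P x} \<subseteq> N" "emeasure haar N = 0" "N \<in> sets haar"
    using assms(4) by (rule AE_E)
  have NE: "N \<inter> E \<in> sets \<nu>" using N(3) E by (simp add: sets restrict_sets_borel)
  have sp: "space \<nu> = E" using sets_eq_imp_space_eq[OF sets] by (simp add: space_restrict_space)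
  have "emeasure \<nu> (N \<inter> E) = (\<integral>\<^sup>+x. indicator (N \<inter> E) x \<partial>\<nu>)" using NE by simp
  also have "\<dots> \<le> (\<integral>\<^sup>+x. indicator (N \<inter> E) x \<partial>haar)" using N(3) E by (intro le) auto
  also have "\<dots> \<le> emeasure haar N" using N(3) E by (auto intro!: emeasure_mono)
  finally have "emeasure \<nu> (N \<inter> E) = 0" using N(2) by simp
  with NE have "N \<inter> E \<in> null_sets \<nu>" by (simp add: null_sets_def)
  then show ?thesis
    by (rule AE_I') (use N(1) sp sets_eq_imp_space_eq[OF sets_haar] in auto)
qed

lemma below_haar_locally_finite:
  assumes le: "\<And>f. f \<in> borel_measurable borel \<Longrightarrow> (\<integral>\<^sup>+x. f x \<partial>\<nu>) \<le> (\<integral>\<^sup>+x. f x \<partial>haar)"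
    and sets: "sets \<nu> = sets (restrict_space borel E)" and E: "E \<in> sets borel"
  shows "locally_finite_borel_measure_on E \<nu>" "sigma_finite_measure \<nu>"
proof -
  have em: "emeasure \<nu> (B \<inter> E) \<le> emeasure haar B" if B: "B \<in> sets borel" for B
  proof -
    have "B \<inter> E \<in> sets \<nu>" using B E by (simp add: sets restrict_sets_borel)
    then have "emeasure \<nu> (B \<inter> E) = (\<integral>\<^sup>+x. indicator (B \<inter> E) x \<partial>\<nu>)" by simp
    also have "\<dots> \<le> (\<integral>\<^sup>+x. indicator (B \<inter> E) x \<partial>haar)" using B E by (intro le) auto
    also have "\<dots> \<le> emeasure haar B" using B E by (auto intro!: emeasure_mono)
    finally show ?thesis .
  qed
  show lf: "locally_finite_borel_measure_on E \<nu>"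
    unfolding locally_finite_borel_measure_on_def
  proof (intro conjI sets ballI)
    fix x assume "x \<in> E"
    obtain U where U: "open U" "x \<in> U" "emeasure haar U < \<infinity>" using haar_locally_finite by blast
    then have "emeasure \<nu> (U \<inter> E) < \<infinity>" using em[of U] by (meson borel_open le_less_trans)
    moreover have "openin (top_of_set E) (U \<inter> E)" using U(1) by (auto simp: openin_open)
    ultimately show "\<exists>U. openin (top_of_set E) U \<and> x \<in> U \<and> emeasure \<nu> U < \<infinity>"
      using U(2) \<open>x \<in> E\<close> by blast
  qed
  obtain V :: "nat \<Rightarrow> 'a set" where V: "\<And>i. open (V i)" "\<And>i. emeasure \<nu> (V i \<inter> E) < \<infinity>" "E \<subseteq> (\<Union>i. V i)"
    by (rule locally_finite_cover[OF lf]) (rule that)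
  show "sigma_finite_measure \<nu>"
  proof
    show "\<exists>A. countable A \<and> A \<subseteq> sets \<nu> \<and> \<Union>A = space \<nu> \<and> (\<forall>a\<in>A. emeasure \<nu> a \<noteq> \<infinity>)"
    proof (intro exI[of _ "range (\<lambda>i. V i \<inter> E)"] conjI ballI)
      show "range (\<lambda>i. V i \<inter> E) \<subseteq> sets \<nu>" using V(1) E by (auto simp: sets restrict_sets_borel)
      show "(\<Union>i. V i \<inter> E) = space \<nu>"
        using V(3) sets_eq_imp_space_eq[OF sets] by (auto simp: space_restrict_space)
      show "emeasure \<nu> a \<noteq> \<infinity>" if "a \<in> range (\<lambda>i. V i \<inter> E)" for a using that V(2) by (auto simp: less_top)
    qed simp
  qed
qed

lemma R_cong_A:
  assumes "\<And>y. y \<in> A \<Longrightarrow> f y = g y"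
  shows "R f x = R g x"
  unfolding step_def using assms by (intro nn_integral_cong) (auto simp: indicator_def)

lemma R_functional: "ennreal_functional (\<lambda>f. R f x)"
  by (rule ennreal_functionalI) (simp_all add: step_add step_cmult step_SUP)

lemma R_le_one:
  assumes "\<And>x. f x \<le> 1" shows "R f x \<le> R (\<lambda>_. 1) x"
  using assms by (intro step_mono) (auto simp: le_fun_def)

lemma R_one_le: "R (\<lambda>_. 1) x \<le> 1"
proof -
  have "R (\<lambda>_. 1) x \<le> (\<integral>\<^sup>+y. 1 \<partial>\<mu>)"
    unfolding step_def by (intro nn_integral_mono) (auto simp: indicator_def)
  then show ?thesis by (simp add: emeasure_space_1)
qed

text \<open>If almost no step from x crosses, \<open>R\<close> vanishes at x altogether; this is
  what makes division by \<open>R 1\<close> harmless, with 0 / 0 = 0.\<close>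

lemma R_eq_0:
  assumes [measurable]: "f \<in> borel_measurable borel" and "R (\<lambda>_. 1) x = 0"
  shows "R f x = 0"
proof -
  have "AE y in \<mu>. (indicator cross (x, x + y) :: ennreal) = 0"
    using assms(2) unfolding step_def
    by (subst (asm) nn_integral_0_iff_AE) (use step_integrand_measurable[of cross "\<lambda>_. 1" x] in auto)
  then show ?thesis unfolding step_def
    by (subst nn_integral_0_iff_AE) (auto elim!: eventually_mono)
qed

lemma A_nonempty: "A \<noteq> {}" and Ac_nonempty: "Ac \<noteq> {}"
  using Ai_nonempty Bi_nonempty Ai_subset Bi_subset by auto

end

text \<open>The kernel enters only through its mass on subsets of A, which is all that
  \<open>kernel_op\<close> sees; \<open>walk_crossing\<close> supplies the concrete kernel.\<close>

locale entrance_chain = crossing \<mu> Z haar A Ac Ai Bi + cemetery_chain A K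
  for \<mu> :: "'a::euclidean_space measure" and Z haar A Ac Ai Bi K +
  assumes emeasure_K: "x \<in> A \<Longrightarrow> B \<in> sets (restrict_space borel A) \<Longrightarrow>
      emeasure (K x) (Some ` B) = H (R (indicator B)) x"
begin

lemma kernel_op_eq:
  assumes x: "x \<in> A" and f: "f \<in> borel_measurable borel"
  shows "kernel_op K f x = H (R f) x"
proof (rule ennreal_functional_eqI[OF kernel_op_functional[OF x] _ _ f])
  show "ennreal_functional (\<lambda>f. H (R f) x)"
  proof (rule ennreal_functionalI)
    fix f :: "nat \<Rightarrow> 'a \<Rightarrow> ennreal"
    assume [measurable]: "\<And>i. f i \<in> borel_measurable borel" and inc: "incseq f"
    have "incseq (\<lambda>i. R (f i))" using inc unfolding incseq_def by (blast intro: le_funI step_mono)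
    moreover have "R (\<lambda>x. SUP i. f i x) = (\<lambda>x. SUP i. R (f i) x)"
      using inc by (intro ext step_SUP) simp_all
    ultimately show "H (R (\<lambda>x. SUP i. f i x)) x = (SUP i. H (R (f i)) x)"
      by (simp add: potential_SUP)
  next
    fix f g :: "'a \<Rightarrow> ennreal" and c
    assume [measurable]: "f \<in> borel_measurable borel" "g \<in> borel_measurable borel"
    have "R (\<lambda>x. f x + g x) = (\<lambda>x. R f x + R g x)" by (intro ext step_add) simp_all
    then show "H (R (\<lambda>x. f x + g x)) x = H (R f) x + H (R g) x" by (simp add: potential_add)
  next
    fix f :: "'a \<Rightarrow> ennreal" and c
    assume [measurable]: "f \<in> borel_measurable borel"
    have "R (\<lambda>x. c * f x) = (\<lambda>x. c * R f x)" by (intro ext step_cmult) simp_all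
    then show "H (R (\<lambda>x. c * f x)) x = c * H (R f) x" by (simp add: potential_cmult)
  qed
  fix B :: "'a set" assume "B \<in> sets borel"
  then have B: "B \<inter> A \<in> sets (restrict_space borel A)" by (simp add: restrict_sets_borel)
  have "kernel_op K (indicator B) x = kernel_op K (indicator (B \<inter> A)) x"
    using x by (intro kernel_op_cong) (auto simp: indicator_def)
  also have "\<dots> = H (R (indicator (B \<inter> A))) x"
    using x B by (simp add: kernel_op_indicator emeasure_K)
  also have "R (indicator (B \<inter> A)) = R (indicator B)"
    by (rule ext, rule R_cong_A) (simp add: indicator_def)
  finally show "kernel_op K (indicator B) x = H (R (indicator B)) x" .
qed

lemma K_None: "x \<in> A \<Longrightarrow> emeasure (K x) {None} = 0"
proof -
  assume x: "x \<in> A"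
  interpret P: prob_space "K x" by (rule K_prob[OF x])
  have A: "A \<in> sets (restrict_space borel A)" by (simp add: restrict_sets_borel)
  have "R (indicator A) = R (\<lambda>_. 1)" by (rule ext, rule R_cong_A) simp
  then have "emeasure (K x) (Some ` A) = 1"
    using x A_subset by (simp add: emeasure_K[OF x A] potential_R_one subset_iff)
  moreover have "space (K x) = insert None (Some ` A)" using sets_eq_imp_space_eq[OF K_sets[OF x]] by simp
  then have "{None} = space (K x) - Some ` A" by auto
  ultimately show ?thesis
    using emeasure_compl[of "Some ` A" "K x"] P.emeasure_space_1 Some_image_sets[OF A] K_sets[OF x] by simp
qed

context
  fixes \<nu> :: "'a measure"
  assumes sets_nu: "sets \<nu> = sets (restrict_space borel A)"
    and nn_integral_nu: "\<And>f. f \<in> borel_measurable borel \<Longrightarrow> (\<integral>\<^sup>+x. f x \<partial>\<nu>) = (\<integral>\<^sup>+x. R f x \<partial>haar)"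
begin

lemma nu_le: "f \<in> borel_measurable borel \<Longrightarrow> (\<integral>\<^sup>+x. f x \<partial>\<nu>) \<le> (\<integral>\<^sup>+x. f x \<partial>haar)"
  by (simp add: nn_integral_nu haar_R_le)

lemma space_nu: "space \<nu> = A"
  using sets_eq_imp_space_eq[OF sets_nu] by (simp add: space_restrict_space)

text \<open>With \<open>\<nu> = haar R\<close> this is
  \<open>(haar R) (H R) = (haar R H) R = haar R\<close>.\<close>

lemma nu_invariant: "invariant_for K \<nu>"
  unfolding invariant_for_def
proof
  fix B assume B: "B \<in> sets \<nu>"
  then have B': "B \<in> sets borel" "B \<subseteq> A" by (simp_all add: sets_nu restrict_sets_borel)
  have [measurable]: "indicator B \<in> borel_measurable borel" using B' by simp
  have "(\<integral>\<^sup>+x. emeasure (K x) (Some ` B) \<partial>\<nu>) = (\<integral>\<^sup>+x. H (R (indicator B)) x \<partial>\<nu>)"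
    using B by (intro nn_integral_cong) (simp add: space_nu sets_nu emeasure_K)
  also have "\<dots> = (\<integral>\<^sup>+x. R (indicator B) x \<partial>haar)"
    by (simp add: nn_integral_nu haar_R_potential)
  also have "\<dots> = emeasure \<nu> B"
    using nn_integral_nu[of "indicator B"] B by simp
  finally show "(\<integral>\<^sup>+x. emeasure (K x) (Some ` B) \<partial>\<nu>) = emeasure \<nu> B" .
qed

text \<open>Since \<open>\<nu> = haar R\<close>, an exceptional \<nu>-null set N is entered by
  almost no crossing step. Applying \<open>R\<close> to \<open>H (R f) \<le> f\<close>, valid on A
  off N, therefore yields the hypothesis of \<open>potential_const\<close> for
  \<open>g = R f\<close>.\<close>

lemma nu_liouville:
  assumes f: "f \<in> borel_measurable \<nu>" "\<And>x. f x \<le> 1" and super: "AE x in \<nu>. kernel_op K f x \<le> f x"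
  shows "\<exists>c. AE x in \<nu>. kernel_op K f x = c"
proof -
  let ?f = "\<lambda>x. f x * indicator A x"
  have [measurable]: "?f \<in> borel_measurable borel"
    using f(1) by (intro restrict_borel_measurable_extend) (simp_all add: measurable_cong_sets[OF sets_nu refl])
  have Kf: "kernel_op K f x = H (R ?f) x" if "x \<in> A" for x
    unfolding kernel_op_eq[OF that, symmetric, OF \<open>?f \<in> _\<close>] using that by (intro kernel_op_cong) auto
  obtain N where N: "{x\<in>space \<nu>. \<not> kernel_op K f x \<le> f x} \<subseteq> N" "emeasure \<nu> N = 0" "N \<in> sets \<nu>"
    using super by (rule AE_E)
  have [measurable]: "N \<in> sets borel" using N(3) by (simp add: sets_nu restrict_sets_borel)
  have "(\<integral>\<^sup>+x. R (indicator N) x \<partial>haar) = 0"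
    using nn_integral_nu[of "indicator N"] N by simp
  then have "AE x in haar. R (indicator N) x = 0"
    by (subst (asm) nn_integral_0_iff_AE) simp_all
  then have sup: "AE x in haar. R (H (R ?f)) x \<le> R ?f x"
  proof eventually_elim
    case (elim x)
    then have "AE y in \<mu>. indicator cross (x, x + y) * indicator N (x + y) = (0::ennreal)"
      unfolding step_def by (subst (asm) nn_integral_0_iff_AE) simp_all
    then show ?case unfolding step_def[of _ _ _ x]
    proof (intro nn_integral_mono_AE, eventually_elim)
      case (elim y)
      show ?case
      proof (cases "(x, x + y) \<in> cross")
        case True
        with elim N(1) have "kernel_op K f (x + y) \<le> f (x + y)" "x + y \<in> A"
          by (auto simp: space_nu indicator_def)
        with True show ?thesis by (simp add: Kf)
      qed simp
    qed
  qed
  obtain c where c: "AE x in haar. H (R ?f) x = c"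
  proof (rule potential_const[of "R ?f"])
    show "R ?f x \<le> R (\<lambda>_. 1) x" for x
      using f(2) by (intro R_le_one) (auto simp: indicator_def)
  qed (use sup that in auto)
  have "AE x in \<nu>. H (R ?f) x = c"
    by (rule nn_integral_le_AE[OF nu_le sets_nu A_borel c])
  then have "AE x in \<nu>. kernel_op K f x = c"
    using AE_space by eventually_elim (simp add: Kf space_nu)
  then show ?thesis by blast
qed

lemma nu_liouville_chain: "liouville_chain A K \<nu>"
proof
  show "AE x in \<nu>. emeasure (K x) {None} = 0"
    using K_None by (intro AE_I2) (simp add: space_nu)
qed (use sets_nu nu_invariant below_haar_locally_finite(2)[OF nu_le sets_nu A_borel] A_nonempty nu_liouville in \<open>auto simp: sigma_finite_measure_def\<close>)

lemma entrance_unique: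
  assumes lf: "locally_finite_borel_measure_on A \<nu>'" and inv: "invariant_for K \<nu>'"
  shows "\<exists>c\<ge>0. \<nu>' = scale_measure (ennreal c) \<nu>"
proof -
  have sets': "sets \<nu>' = sets (restrict_space borel A)"
    using lf by (simp add: locally_finite_borel_measure_on_def)
  interpret I: invariant_chain A K \<nu>' by unfold_locales (fact sets', fact inv)
  define s where "s = distr \<nu>' borel (\<lambda>x. x)"
  have id: "(\<lambda>x. x) \<in> \<nu>' \<rightarrow>\<^sub>M borel"
    by (simp add: measurable_cong_sets[OF sets' refl] measurable_restrict_space1)
  have sets_s[measurable_cong]: "sets s = sets borel" by (simp add: s_def)
  have s: "(\<integral>\<^sup>+x. f x \<partial>s) = (\<integral>\<^sup>+x. f x \<partial>\<nu>')" if "f \<in> borel_measurable borel" for f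
    unfolding s_def by (subst nn_integral_distr[OF id]) (simp_all add: that)
  have sA: "AE x in s. x \<in> Z"
    unfolding s_def using A_subset by (subst AE_distr_iff[OF id]) (auto intro!: AE_I2)
  have inv_s: "(\<integral>\<^sup>+x. H (R f) x \<partial>s) = (\<integral>\<^sup>+x. f x \<partial>s)" if [measurable]: "f \<in> borel_measurable borel" for f
  proof -
    have "(\<integral>\<^sup>+x. H (R f) x \<partial>s) = (\<integral>\<^sup>+x. H (R f) x \<partial>\<nu>')" by (rule s) measurable
    also have "\<dots> = (\<integral>\<^sup>+x. kernel_op K f x \<partial>\<nu>')"
      by (intro nn_integral_cong) (simp add: kernel_op_eq)
    also have "\<dots> = (\<integral>\<^sup>+x. f x \<partial>\<nu>')"
      by (rule I.nn_integral_kernel_op) (simp add: measurable_cong_sets[OF sets' refl] measurable_restrict_space1)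
    finally show ?thesis by (simp add: s)
  qed
  obtain V :: "nat \<Rightarrow> 'a set" where V: "\<And>i. open (V i)" "\<And>i. emeasure \<nu>' (V i \<inter> A) < \<infinity>" "A \<subseteq> (\<Union>i. V i)"
    by (rule locally_finite_cover[OF lf]) (rule that)
  have [measurable]: "V i \<in> sets borel" for i using V(1) by simp
  have s_V: "emeasure s (V i) < \<infinity>" for i
    unfolding s_def using V(2)[of i] by (subst emeasure_distr[OF id]) simp_all
  obtain U w where U: "open U" "w \<in> U" "w \<in> Z" "(\<integral>\<^sup>+x. H (indicator U) x \<partial>s) < \<infinity>"
  \<comment> \<open>The entrance point is constrained to an open set \<open>V i\<close> of finite
    \<nu>'-measure; by invariance the integral of \<open>H (R (indicator (V i)))\<close> under s is
    that measure.\<close>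
  proof (rule potential_finite_on_open[OF sets_s sA, of "\<lambda>i. Ri (indicator (V i))" "\<lambda>i. R (indicator (V i))"])
    show "lsc (Ri (indicator (V i)))" for i
      using open_Ai open_Bi V(1) by (intro lsc_step lsc_indicator open_Times)
    show "Ri (indicator (V i)) x \<le> R (indicator (V i)) x" if "x \<in> Z" for i x
      using that Ai_subset Bi_subset by (intro step_mono_Z[OF that]) (auto simp: indicator_def)
    show "Ri (\<lambda>_. 1) x \<le> (\<Sum>i. Ri (indicator (V i)) x)" if "x \<in> Z" for x
    proof -
      have "Ri (\<lambda>_. 1) x \<le> Ri (\<lambda>x. \<Sum>i. indicator (V i) x) x"
      proof (rule step_mono_Z[OF that])
        fix y assume "y \<in> Z"
        show "indicator (Bi \<times> Ai) (x, y) * 1 \<le> indicator (Bi \<times> Ai) (x, y) * (\<Sum>i. indicator (V i) y :: ennreal)"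
        proof (cases "y \<in> Ai")
          case True
          then obtain i where "y \<in> V i" using \<open>y \<in> Z\<close> Ai_subset V(3) by blast
          then have "1 \<le> (\<Sum>i. indicator (V i) y :: ennreal)"
            using sum_le_suminf[of "\<lambda>i. indicator (V i) y :: ennreal" "{i}"] by simp
          then show ?thesis by (intro mult_left_mono) auto
        qed simp
      qed
      also have "\<dots> = (\<Sum>i. Ri (indicator (V i)) x)" by (rule step_suminf) measurable
      finally show ?thesis .
    qed
    show "(\<integral>\<^sup>+x. H (R (indicator (V i))) x \<partial>s) < \<infinity>" for i
      by (subst inv_s) (use s_V sets_s in simp_all)
  qed (use that in \<open>auto simp: \<open>\<And>i. V i \<in> sets borel\<close>\<close>)
  obtain c where c: "c < \<infinity>" "\<And>f. f \<in> borel_measurable borel \<Longrightarrow> (\<integral>\<^sup>+x. H f x \<partial>s) = c * (\<integral>\<^sup>+x. f x \<partial>haar)"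
    by (rule potential_proportional[OF sets_s sA inv_s U]) (use that in blast)+
  have "\<nu>' = scale_measure c \<nu>"
  proof (rule measure_eqI)
    show "sets \<nu>' = sets (scale_measure c \<nu>)" by (simp add: sets' sets_nu)
    fix B assume B: "B \<in> sets \<nu>'"
    then have B': "B \<in> sets borel" by (simp add: sets' restrict_sets_borel)
    have [measurable]: "indicator B \<in> borel_measurable borel" using B' by simp
    have "emeasure \<nu>' B = (\<integral>\<^sup>+x. indicator B x \<partial>s)" using B by (simp add: s del: nn_integral_indicator) simp
    also have "\<dots> = (\<integral>\<^sup>+x. H (R (indicator B)) x \<partial>s)" by (rule inv_s[symmetric]) measurable
    also have "\<dots> = c * (\<integral>\<^sup>+x. R (indicator B) x \<partial>haar)" by (rule c(2)) measurable
    also have "\<dots> = c * emeasure \<nu> B"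
      using nn_integral_nu[of "indicator B"] B by (simp add: sets_nu sets')
    finally show "emeasure \<nu>' B = emeasure (scale_measure c \<nu>) B" by simp
  qed
  then show ?thesis using c(1) by (intro exI[of _ "enn2real c"]) (simp add: ennreal_enn2real)
qed

lemma entrance_main:
  "unique_locally_finite_invariant A K \<nu> \<and> recurrent_for A K \<nu> \<and> ergodic_for A K \<nu>"
proof -
  interpret L: liouville_chain A K \<nu> by (rule nu_liouville_chain)
  show ?thesis
    unfolding unique_locally_finite_invariant_def
    using below_haar_locally_finite(1)[OF nu_le sets_nu A_borel] nu_invariant entrance_unique L.recurrent L.ergodic
    by blast
qed

end

end

section \<open>The exit chain\<close>

text \<open>A step into A has conditional law \<open>R / p\<close>; from there non-crossing steps
  (\<open>H\<close>) lead to an exit point v, from which the path crosses with probability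
  \<open>p v\<close>. Where \<open>p x = 0\<close> the quotient is 0 / 0 = 0, and all mass goes to
  the cemetery.\<close>

locale exit_chain = crossing \<mu> Z haar A Ac Ai Bi + cemetery_chain Ac K
  for \<mu> :: "'a::euclidean_space measure" and Z haar A Ac Ai Bi K +
  assumes emeasure_K: "x \<in> Ac \<Longrightarrow> B \<in> sets (restrict_space borel Ac) \<Longrightarrow>
      emeasure (K x) (Some ` B) = R (H (\<lambda>v. indicator B v * R (\<lambda>_. 1) v)) x / R (\<lambda>_. 1) x"
begin

abbreviation p :: "'a \<Rightarrow> ennreal" where "p \<equiv> R (\<lambda>_. 1)"

lemma p_finite: "p x \<noteq> \<top>"
  using R_one_le[of x] by (auto simp: top_unique)

lemma p_mult_divide:
  assumes [measurable]: "f \<in> borel_measurable borel"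
  shows "p x * (R f x / p x) = R f x"
proof (cases "p x = 0")
  case True then show ?thesis by (simp add: R_eq_0)
next
  case False then show ?thesis
    using p_finite[of x] by (metis ennreal_mult_divide_eq ennreal_times_divide mult.commute)
qed

lemma kernel_op_eq:
  assumes x: "x \<in> Ac" and f: "f \<in> borel_measurable borel"
  shows "kernel_op K f x = R (H (\<lambda>v. f v * p v)) x / p x"
proof (rule ennreal_functional_eqI[OF kernel_op_functional[OF x] _ _ f])
  have add: "ennreal_functional (\<lambda>f. R (H (\<lambda>v. f v * p v)) x)"
  proof (rule ennreal_functionalI)
    fix f g :: "'a \<Rightarrow> ennreal"
    assume [measurable]: "f \<in> borel_measurable borel" "g \<in> borel_measurable borel"
    show "R (H (\<lambda>v. (f v + g v) * p v)) x = R (H (\<lambda>v. f v * p v)) x + R (H (\<lambda>v. g v * p v)) x"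
      by (simp add: distrib_right potential_add step_add)
  next
    fix f :: "'a \<Rightarrow> ennreal" and c
    assume [measurable]: "f \<in> borel_measurable borel"
    show "R (H (\<lambda>v. (c * f v) * p v)) x = c * R (H (\<lambda>v. f v * p v)) x"
      by (simp add: mult.assoc potential_cmult step_cmult)
  next
    fix f :: "nat \<Rightarrow> 'a \<Rightarrow> ennreal"
    assume [measurable]: "\<And>i. f i \<in> borel_measurable borel" and inc: "incseq f"
    have "incseq (\<lambda>i v. f i v * p v)" using inc by (auto simp: incseq_def le_fun_def intro!: mult_right_mono)
    moreover then have "incseq (\<lambda>i. H (\<lambda>v. f i v * p v))" by (auto simp: incseq_def intro!: potential_mono)
    moreover have "(\<lambda>v. (SUP i. f i v) * p v) = (\<lambda>v. SUP i. f i v * p v)" by (simp add: SUP_mult_right_ennreal)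
    ultimately show "R (H (\<lambda>v. (SUP i. f i v) * p v)) x = (SUP i. R (H (\<lambda>v. f i v * p v)) x)"
      by (simp add: potential_SUP step_SUP)
  qed
  show "ennreal_functional (\<lambda>f. R (H (\<lambda>v. f v * p v)) x / p x)"
  proof (rule ennreal_functionalI)
    fix f :: "nat \<Rightarrow> 'a \<Rightarrow> ennreal"
    assume "\<And>i. f i \<in> borel_measurable borel" "incseq f"
    then show "R (H (\<lambda>v. (SUP i. f i v) * p v)) x / p x = (SUP i. R (H (\<lambda>v. f i v * p v)) x / p x)"
      using add by (auto simp: ennreal_functional_def image_subset_iff divide_ennreal_def SUP_mult_right_ennreal)
  qed (use add in \<open>auto simp: ennreal_functional_def divide_ennreal_def distrib_right mult.assoc\<close>)
  fix B :: "'a set" assume "B \<in> sets borel"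
  then have B: "B \<inter> Ac \<in> sets (restrict_space borel Ac)" by (simp add: restrict_sets_borel)
  have "kernel_op K (indicator B) x = kernel_op K (indicator (B \<inter> Ac)) x"
    using x by (intro kernel_op_cong) (auto simp: indicator_def)
  also have "\<dots> = R (H (\<lambda>v. indicator (B \<inter> Ac) v * p v)) x / p x"
    using x B by (simp add: kernel_op_indicator emeasure_K)
  also have "(\<lambda>v. indicator (B \<inter> Ac) v * p v) = (\<lambda>v. indicator B v * p v)"
    using R_outside by (auto simp: indicator_def fun_eq_iff)
  finally show "kernel_op K (indicator B) x = R (H (\<lambda>v. indicator B v * p v)) x / p x" .
qed

lemma K_None:
  assumes x: "x \<in> Ac" and p0: "p x \<noteq> 0"
  shows "emeasure (K x) {None} = 0"
proof -
  interpret P: prob_space "K x" by (rule K_prob[OF x])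
  have Ac: "Ac \<in> sets (restrict_space borel Ac)" by (simp add: restrict_sets_borel)
  have "(\<lambda>v. indicator Ac v * p v) = p"
    using R_outside by (auto simp: indicator_def fun_eq_iff)
  moreover have "R (H p) x = p x"
    using A_subset by (intro R_cong_A) (auto simp: potential_R_one)
  ultimately have "emeasure (K x) (Some ` Ac) = 1"
    using p0 p_finite[of x] by (simp add: emeasure_K[OF x Ac] ennreal_divide_self less_top)
  moreover have "space (K x) = insert None (Some ` Ac)" using sets_eq_imp_space_eq[OF K_sets[OF x]] by simp
  then have "{None} = space (K x) - Some ` Ac" by auto
  ultimately show ?thesis
    using emeasure_compl[of "Some ` Ac" "K x"] P.emeasure_space_1 Some_image_sets[OF Ac] K_sets[OF x] by simp
qed

context
  fixes \<nu> :: "'a measure"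
  assumes sets_nu: "sets \<nu> = sets (restrict_space borel Ac)"
    and nn_integral_nu: "\<And>f. f \<in> borel_measurable borel \<Longrightarrow> (\<integral>\<^sup>+x. f x \<partial>\<nu>) = (\<integral>\<^sup>+x. f x * p x \<partial>haar)"
begin

lemma nu_le: "f \<in> borel_measurable borel \<Longrightarrow> (\<integral>\<^sup>+x. f x \<partial>\<nu>) \<le> (\<integral>\<^sup>+x. f x \<partial>haar)"
  unfolding nn_integral_nu
  using mult_left_mono[OF R_one_le] by (intro nn_integral_mono) (metis mult.right_neutral zero_le)

lemma space_nu: "space \<nu> = Ac"
  using sets_eq_imp_space_eq[OF sets_nu] by (simp add: space_restrict_space)

text \<open>With \<open>\<nu> = haar p\<close> this is
  \<open>(haar p) p^-1 R H p = haar R H p = haar p\<close>; cancelling p is justified at its zeros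
  by \<open>p_mult_divide\<close>.\<close>

lemma nu_invariant: "invariant_for K \<nu>"
  unfolding invariant_for_def
proof
  fix B assume B: "B \<in> sets \<nu>"
  then have B': "B \<in> sets borel" "B \<subseteq> Ac" by (simp_all add: sets_nu restrict_sets_borel)
  have [measurable]: "indicator B \<in> borel_measurable borel" using B' by simp
  let ?g = "\<lambda>v. indicator B v * p v"
  have [measurable]: "?g \<in> borel_measurable borel" by measurable
  have "(\<integral>\<^sup>+x. emeasure (K x) (Some ` B) \<partial>\<nu>) = (\<integral>\<^sup>+x. R (H ?g) x / p x \<partial>\<nu>)"
    using B by (intro nn_integral_cong) (simp add: space_nu sets_nu emeasure_K)
  also have "\<dots> = (\<integral>\<^sup>+x. p x * (R (H ?g) x / p x) \<partial>haar)"
    by (subst nn_integral_nu) (simp_all add: mult.commute)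
  also have "\<dots> = (\<integral>\<^sup>+x. R (H ?g) x \<partial>haar)"
    by (simp add: p_mult_divide)
  also have "\<dots> = (\<integral>\<^sup>+x. ?g x \<partial>haar)" by (rule haar_R_potential) measurable
  also have "\<dots> = emeasure \<nu> B"
    using nn_integral_nu[of "indicator B"] B by simp
  finally show "(\<integral>\<^sup>+x. emeasure (K x) (Some ` B) \<partial>\<nu>) = emeasure \<nu> B" .
qed

lemma AE_p_nonzero: "AE x in \<nu>. p x \<noteq> 0"
proof -
  let ?N = "{x\<in>Ac. p x = 0}"
  have N: "?N \<in> sets borel" by measurable
  then have N': "?N \<in> sets \<nu>" by (simp add: sets_nu restrict_sets_borel)
  have "emeasure \<nu> ?N = (\<integral>\<^sup>+x. indicator ?N x * p x \<partial>haar)"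
    using nn_integral_nu[of "indicator ?N"] N N' by simp
  also have "\<dots> = (\<integral>\<^sup>+x. 0 \<partial>haar)" by (intro nn_integral_cong) (auto simp: indicator_def)
  finally have "?N \<in> null_sets \<nu>" using N' by (simp add: null_sets_def)
  then show ?thesis by (rule AE_I') (auto simp: space_nu)
qed

text \<open>Multiplied by p, \<open>K f \<le> f\<close> becomes \<open>R (H g) \<le> g\<close> for
  \<open>g = f p\<close>, which also holds at zeros of p. Once \<open>H g = c\<close>, it follows
  that \<open>K f = R c / p = c\<close> wherever p is nonzero, hence \<nu>-almost
  everywhere.\<close>

lemma nu_liouville:
  assumes f: "f \<in> borel_measurable \<nu>" "\<And>x. f x \<le> 1" and super: "AE x in \<nu>. kernel_op K f x \<le> f x"
  shows "\<exists>c. AE x in \<nu>. kernel_op K f x = c"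
proof -
  let ?f = "\<lambda>x. f x * indicator Ac x" and ?g = "\<lambda>x. (f x * indicator Ac x) * p x"
  have [measurable]: "?f \<in> borel_measurable borel"
    using f(1) by (intro restrict_borel_measurable_extend) (simp_all add: measurable_cong_sets[OF sets_nu refl])
  have [measurable]: "?g \<in> borel_measurable borel" by measurable
  have Kf: "kernel_op K f x = R (H ?g) x / p x" if "x \<in> Ac" for x
    unfolding kernel_op_eq[OF that, symmetric, OF \<open>?f \<in> _\<close>] using that by (intro kernel_op_cong) auto
  obtain N where N: "{x\<in>space \<nu>. \<not> kernel_op K f x \<le> f x} \<subseteq> N" "emeasure \<nu> N = 0" "N \<in> sets \<nu>"
    using super by (rule AE_E)
  have [measurable]: "N \<in> sets borel" using N(3) by (simp add: sets_nu restrict_sets_borel)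
  have "(\<integral>\<^sup>+x. indicator N x * p x \<partial>haar) = 0"
    using nn_integral_nu[of "indicator N"] N by simp
  then have "AE x in haar. indicator N x * p x = 0"
    by (subst (asm) nn_integral_0_iff_AE) simp_all
  then have sup: "AE x in haar. R (H ?g) x \<le> ?g x"
  proof eventually_elim
    case (elim x)
    show ?case
    proof (cases "x \<in> Ac \<and> p x \<noteq> 0")
      case True
      then have "x \<notin> N" using elim by auto
      then have "R (H ?g) x / p x \<le> f x" using N(1) True Kf[of x] by (auto simp: space_nu)
      then have "p x * (R (H ?g) x / p x) \<le> p x * f x" by (intro mult_left_mono) auto
      with True show ?thesis by (simp add: p_mult_divide mult.commute)
    next
      case False
      then have "p x = 0" using R_outside by auto
      then show ?thesis by (simp add: R_eq_0)
    qed
  qed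
  obtain c where c: "AE x in haar. H ?g x = c"
  proof (rule potential_const[of ?g])
    show "?g x \<le> p x" for x
      using f(2)[of x] mult_right_mono[of "f x * indicator Ac x" 1 "p x"] by (auto simp: indicator_def)
  qed (use sup that in auto)
  have "AE x in \<nu>. R (H ?g) x = R (\<lambda>_. c) x"
    by (rule nn_integral_le_AE[OF nu_le sets_nu Ac_borel AE_haar_step_cong[OF c]])
  then have "AE x in \<nu>. kernel_op K f x = c"
    using AE_space AE_p_nonzero
  proof eventually_elim
    case (elim x)
    have "R (\<lambda>_. c) x = c * p x" using step_cmult[of cross "\<lambda>_. 1" c x] by simp
    with elim p_finite[of x] show ?case by (simp add: Kf space_nu ennreal_mult_divide_eq)
  qed
  then show ?thesis by blast
qed

lemma nu_liouville_chain: "liouville_chain Ac K \<nu>"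
proof
  show "AE x in \<nu>. emeasure (K x) {None} = 0"
    using AE_p_nonzero AE_space by eventually_elim (simp add: space_nu K_None)
qed (use sets_nu nu_invariant below_haar_locally_finite(2)[OF nu_le sets_nu Ac_borel] Ac_nonempty nu_liouville in \<open>auto simp: sigma_finite_measure_def\<close>)

text \<open>The measure \<open>s = \<nu>' p^-1 R\<close> describes the entrance point following an
  exit point distributed as \<nu>'. It is fixed by \<open>H R\<close>, so its potential is a
  multiple of \<open>haar\<close>, and \<nu>' is recovered from that potential by weighting with
  p.\<close>

lemma exit_unique:
  assumes lf: "locally_finite_borel_measure_on Ac \<nu>'" and inv: "invariant_for K \<nu>'"
  shows "\<exists>c\<ge>0. \<nu>' = scale_measure (ennreal c) \<nu>"
proof -
  have sets': "sets \<nu>' = sets (restrict_space borel Ac)"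
    using lf by (simp add: locally_finite_borel_measure_on_def)
  interpret I: invariant_chain Ac K \<nu>' by unfold_locales (fact sets', fact inv)
  have meas': "f \<in> borel_measurable \<nu>'" if "f \<in> borel_measurable borel" for f :: "'a \<Rightarrow> ennreal"
    using that by (simp add: measurable_cong_sets[OF sets' refl] measurable_restrict_space1)
  have *: "ennreal_functional (\<lambda>f. R f x / p x)" for x
    using R_functional[of x]
    by (auto simp: ennreal_functional_def image_subset_iff divide_ennreal_def SUP_mult_right_ennreal distrib_right mult.assoc)
  have "ennreal_functional (\<lambda>f. \<integral>\<^sup>+x. R f x / p x \<partial>\<nu>')"
  proof (rule ennreal_functional_nn_integral[OF *])
    fix f :: "'a \<Rightarrow> ennreal" assume [measurable]: "f \<in> borel_measurable borel"
    have "(\<lambda>x. R f x / p x) \<in> borel_measurable borel" by measurable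
    then show "(\<lambda>x. R f x / p x) \<in> borel_measurable \<nu>'" by (rule meas')
  qed
  then obtain s where sets_s[measurable_cong, simp]: "sets s = sets borel"
    and s: "\<And>f. f \<in> borel_measurable borel \<Longrightarrow> (\<integral>\<^sup>+x. f x \<partial>s) = (\<integral>\<^sup>+x. R f x / p x \<partial>\<nu>')"
    by (rule ennreal_functional_eq_nn_integral) (rule that)
  have "emeasure s (- Z) = (\<integral>\<^sup>+x. R (indicator (- Z)) x / p x \<partial>\<nu>')"
    using s[of "indicator (- Z)"] by simp
  also have "\<dots> = (\<integral>\<^sup>+x. 0 \<partial>\<nu>')"
  proof (rule nn_integral_cong)
    fix x
    have "R (indicator (- Z)) x = R (\<lambda>_. 0) x" using A_subset by (intro R_cong_A) auto
    then show "R (indicator (- Z)) x / p x = 0" by (simp add: step_def)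
  qed
  finally have sZ: "AE x in s. x \<in> Z"
    by (subst AE_iff_measurable[of "- Z"]) (auto simp: sets_eq_imp_space_eq[OF sets_s])
  have nu': "(\<integral>\<^sup>+x. H (\<lambda>v. f v * p v) x \<partial>s) = (\<integral>\<^sup>+x. f x \<partial>\<nu>')" if f[measurable]: "f \<in> borel_measurable borel" for f
  proof -
    have "(\<integral>\<^sup>+x. H (\<lambda>v. f v * p v) x \<partial>s) = (\<integral>\<^sup>+x. R (H (\<lambda>v. f v * p v)) x / p x \<partial>\<nu>')"
      by (rule s) measurable
    also have "\<dots> = (\<integral>\<^sup>+x. kernel_op K f x \<partial>\<nu>')"
      by (intro nn_integral_cong) (simp add: kernel_op_eq)
    also have "\<dots> = (\<integral>\<^sup>+x. f x \<partial>\<nu>')"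
      by (rule I.nn_integral_kernel_op) (rule meas'[OF f])
    finally show ?thesis .
  qed
  have inv_s: "(\<integral>\<^sup>+x. H (R f) x \<partial>s) = (\<integral>\<^sup>+x. f x \<partial>s)" if [measurable]: "f \<in> borel_measurable borel" for f
  proof -
    \<comment> \<open>Reading \<open>nu'\<close> at the function \<open>R f / p\<close> expresses
      \<open>s H R\<close> as \<open>\<nu>' p^-1 R\<close>, which is s.\<close>
    have "(\<lambda>v. R f v / p v * p v) = R f" using p_mult_divide[OF that] by (simp add: mult.commute)
    then show ?thesis using nu'[of "\<lambda>v. R f v / p v"] s[OF that] by simp
  qed
  obtain V :: "nat \<Rightarrow> 'a set" where V: "\<And>i. open (V i)" "\<And>i. emeasure \<nu>' (V i \<inter> Ac) < \<infinity>" "Ac \<subseteq> (\<Union>i. V i)"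
    by (rule locally_finite_cover[OF lf]) (rule that)
  have V_borel[measurable]: "V i \<in> sets borel" for i using V(1) by simp
  have nu_V: "(\<integral>\<^sup>+x. indicator (V i) x \<partial>\<nu>') < \<infinity>" for i
  proof -
    have "(\<integral>\<^sup>+x. indicator (V i) x \<partial>\<nu>') = (\<integral>\<^sup>+x. indicator (V i \<inter> Ac) x \<partial>\<nu>')"
      by (intro nn_integral_cong) (auto simp: indicator_def)
    then show ?thesis using V(2)[of i] by (simp add: sets' restrict_sets_borel)
  qed
  obtain U w where U: "open U" "w \<in> U" "w \<in> Z" "(\<integral>\<^sup>+x. H (indicator U) x \<partial>s) < \<infinity>"
  \<comment> \<open>Now the open sets cover \<open>Ac\<close> and constrain the exit point, so the
    indicator multiplies the crossing probability instead of being its argument.\<close>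
  proof (rule potential_finite_on_open[OF sets_s sZ, of "\<lambda>i x. indicator (V i) x * Ri (\<lambda>_. 1) x" "\<lambda>i x. indicator (V i) x * p x"])
    show "lsc (\<lambda>x. indicator (V i) x * Ri (\<lambda>_. 1) x)" for i
      using open_Ai open_Bi V(1) by (intro lsc_step lsc_indicator_mult open_Times) (auto simp: lsc_def)
    show "indicator (V i) x * Ri (\<lambda>_. 1) x \<le> indicator (V i) x * p x" if "x \<in> Z" for i x
      using that Ai_subset Bi_subset by (intro mult_left_mono step_mono_Z[OF that]) (auto simp: indicator_def)
    show "Ri (\<lambda>_. 1) x \<le> (\<Sum>i. indicator (V i) x * Ri (\<lambda>_. 1) x)" if "x \<in> Z" for x
    proof (cases "x \<in> Bi")
      case True
      then obtain i where "x \<in> V i" using \<open>x \<in> Z\<close> Bi_subset V(3) by blast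
      then show ?thesis
        using sum_le_suminf[of "\<lambda>i. indicator (V i) x * Ri (\<lambda>_. 1) x" "{i}"] by simp
    next
      case False
      then have "Ri (\<lambda>_. 1) x = 0" by (simp add: step_def)
      then show ?thesis by simp
    qed
    show "(\<integral>\<^sup>+x. H (\<lambda>x. indicator (V i) x * p x) x \<partial>s) < \<infinity>" for i
      by (subst nu') (use nu_V in simp_all)
    show "(\<lambda>x. indicator (V i) x * p x) \<in> borel_measurable borel" for i by measurable
  qed (use that in blast)
  obtain c where c: "c < \<infinity>" "\<And>f. f \<in> borel_measurable borel \<Longrightarrow> (\<integral>\<^sup>+x. H f x \<partial>s) = c * (\<integral>\<^sup>+x. f x \<partial>haar)"
    by (rule potential_proportional[OF sets_s sZ inv_s U]) (use that in blast)+
  have "\<nu>' = scale_measure c \<nu>"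
  proof (rule measure_eqI)
    show "sets \<nu>' = sets (scale_measure c \<nu>)" by (simp add: sets' sets_nu)
    fix B assume B: "B \<in> sets \<nu>'"
    then have B': "B \<in> sets borel" by (simp add: sets' restrict_sets_borel)
    have [measurable]: "indicator B \<in> borel_measurable borel" using B' by simp
    have "emeasure \<nu>' B = (\<integral>\<^sup>+x. indicator B x \<partial>\<nu>')" using B by simp
    also have "\<dots> = (\<integral>\<^sup>+x. H (\<lambda>v. indicator B v * p v) x \<partial>s)" by (rule nu'[symmetric]) measurable
    also have "\<dots> = c * (\<integral>\<^sup>+x. indicator B x * p x \<partial>haar)" by (rule c(2)) measurable
    also have "\<dots> = c * emeasure \<nu> B"
      using nn_integral_nu[of "indicator B"] B by (simp add: sets_nu sets')
    finally show "emeasure \<nu>' B = emeasure (scale_measure c \<nu>) B" by simp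
  qed
  then show ?thesis using c(1) by (intro exI[of _ "enn2real c"]) (simp add: ennreal_enn2real)
qed

lemma exit_main:
  "unique_locally_finite_invariant Ac K \<nu> \<and> recurrent_for Ac K \<nu> \<and> ergodic_for Ac K \<nu>"
proof -
  interpret L: liouville_chain Ac K \<nu> by (rule nu_liouville_chain)
  show ?thesis
    unfolding unique_locally_finite_invariant_def
    using below_haar_locally_finite(1)[OF nu_le sets_nu Ac_borel] nu_invariant exit_unique L.recurrent L.ergodic
    by blast
qed

end

end

section \<open>Recurrence on the state space\<close>

lemma infinite_nat_shift: "infinite {n. P n} \<longleftrightarrow> infinite {n. P (Suc n)}"
proof -
  have "(\<forall>m. \<exists>n\<ge>m. P n) \<longleftrightarrow> (\<forall>m. \<exists>n\<ge>m. P (Suc n))"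
    by (metis Suc_le_D Suc_le_mono le_SucI)
  then show ?thesis by (simp add: infinite_nat_iff_unbounded_le)
qed

context subgroup_walk
begin

definition finite_visits :: "'a set \<Rightarrow> 'a \<Rightarrow> ennreal" where
  "finite_visits V x = emeasure path_law {\<omega>\<in>space path_law. finite {n. pos x \<omega> n \<in> V}}"

lemma finite_visits_measurable[measurable]:
  assumes [measurable]: "V \<in> sets borel"
  shows "finite_visits V \<in> borel_measurable borel"
proof -
  interpret P: prob_space path_law by (rule prob_space_path_law)
  let ?Q = "{p \<in> space (borel \<Otimes>\<^sub>M path_law). \<exists>m. \<forall>n. pos (fst p) (snd p) n \<in> V \<longrightarrow> n < m}"
  have "?Q \<in> sets (borel \<Otimes>\<^sub>M path_law)" by measurable
  then have "(\<lambda>x. emeasure path_law (Pair x -` ?Q)) \<in> borel_measurable borel"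
    by (rule P.measurable_emeasure_Pair)
  also have "(\<lambda>x. emeasure path_law (Pair x -` ?Q)) = finite_visits V"
    by (auto simp: finite_visits_def fun_eq_iff space_pair_measure finite_nat_set_iff_bounded intro!: arg_cong[of _ _ "emeasure _"])
  finally show ?thesis .
qed

text \<open>Dropping the first position does not change whether the number of visits is
  finite.\<close>

lemma finite_visits_step:
  assumes [measurable]: "V \<in> sets borel"
  shows "finite_visits V x = step \<mu> UNIV (finite_visits V) x"
proof -
  have *: "finite {n. pos x (case_nat y \<omega>) n \<in> V} \<longleftrightarrow> finite {n. pos (x + y) \<omega> n \<in> V}" for y \<omega>
    using infinite_nat_shift[of "\<lambda>n. pos x (case_nat y \<omega>) n \<in> V"] by (simp add: pos_case_nat)
  have "finite_visits V x = (\<integral>\<^sup>+y. emeasure path_law {\<omega>\<in>space path_law. finite {n. pos x (case_nat y \<omega>) n \<in> V}} \<partial>\<mu>)"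
    unfolding finite_visits_def by (rule emeasure_path_law) measurable
  then show ?thesis by (simp only: * step_def finite_visits_def) simp
qed

lemma finite_visits_eq_0:
  assumes [measurable]: "V \<in> sets borel"
  shows "finite_visits V x = 0 \<longleftrightarrow> (AE \<omega> in path_law. infinite {n. pos x \<omega> n \<in> V})"
proof -
  have "{\<omega>\<in>space path_law. finite {n. pos x \<omega> n \<in> V}} \<in> sets path_law" by measurable
  then show ?thesis unfolding finite_visits_def
    by (subst AE_iff_measurable[of "{\<omega>\<in>space path_law. finite {n. pos x \<omega> n \<in> V}}"]) auto
qed

text \<open>The recurrent and, below, the possible values of the classical theory. The walk starts
  at 0; other starting points are reached through differences of values.\<close>

definition recurrent_value :: "'a \<Rightarrow> bool" where
  "recurrent_value z \<longleftrightarrow> (\<forall>G. open G \<longrightarrow> z \<in> G \<longrightarrow> (AE \<omega> in path_law. infinite {n. pos 0 \<omega> n \<in> G}))"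

definition possible_value :: "'a \<Rightarrow> bool" where
  "possible_value w \<longleftrightarrow> (\<forall>G. open G \<longrightarrow> w \<in> G \<longrightarrow> (\<exists>n. (step \<mu> UNIV ^^ n) (indicator G) 0 \<noteq> 0))"

lemma recurrent_value_possible:
  assumes "recurrent_value z" shows "possible_value z"
  unfolding possible_value_def
proof (intro allI impI)
  fix G assume G: "open G" "z \<in> G"
  then have [measurable]: "G \<in> sets borel" by simp
  interpret P: prob_space path_law by (rule prob_space_path_law)
  show "\<exists>n. (step \<mu> UNIV ^^ n) (indicator G) 0 \<noteq> 0"
  proof (rule ccontr)
    assume "\<not> ?thesis"
    then have 0: "emeasure path_law {\<omega>\<in>space path_law. pos 0 \<omega> n \<in> G} = 0" for n
      by (simp add: step_UNIV_pow_visit)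
    have "AE \<omega> in path_law. pos 0 \<omega> n \<notin> G" for n
    proof (rule AE_I[OF _ 0])
      show "{\<omega>\<in>space path_law. pos 0 \<omega> n \<in> G} \<in> sets path_law" by measurable
    qed auto
    then have "AE \<omega> in path_law. \<forall>n. pos 0 \<omega> n \<notin> G" by (simp add: AE_all_countable)
    moreover have "AE \<omega> in path_law. infinite {n. pos 0 \<omega> n \<in> G}"
      using assms G by (simp add: recurrent_value_def)
    ultimately have "AE \<omega> in path_law. False" by eventually_elim simp
    then show False by simp
  qed
qed

lemma step_eq_0_mono:
  assumes [measurable]: "f \<in> borel_measurable borel" "g \<in> borel_measurable borel"
    and "\<And>x. f x = 0 \<Longrightarrow> g x = 0" and "step \<mu> UNIV f x = 0"
  shows "step \<mu> UNIV g x = 0"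
proof -
  have "AE y in \<mu>. f (x + y) = 0"
    using assms(4) unfolding step_def by (subst (asm) nn_integral_0_iff_AE) simp_all
  then show ?thesis unfolding step_def
    by (subst nn_integral_0_iff_AE) (auto elim!: eventually_mono simp: assms(3))
qed

text \<open>The probability of finitely many visits to a neighbourhood of \<open>z\<close> is harmonic and vanishes
  at \<open>0\<close>, so it vanishes somewhere near every possible value \<open>w\<close>.\<close>

lemma recurrent_value_diff:
  assumes z: "recurrent_value z" and w: "possible_value w"
  shows "recurrent_value (z - w)"
  unfolding recurrent_value_def
proof (intro allI impI)
  fix G assume G: "open G" "z - w \<in> G"
  \<comment> \<open>Continuity of subtraction provides neighbourhoods V of z and U of w with V - U
    inside G.\<close>
  have "open ((\<lambda>p. fst p - snd p) -` G)" by (intro open_vimage G continuous_intros)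
  moreover have "(z, w) \<in> (\<lambda>p. fst p - snd p) -` G" using G by simp
  ultimately obtain V U where VU: "open V" "open U" "(z, w) \<in> V \<times> U" "V \<times> U \<subseteq> (\<lambda>p. fst p - snd p) -` G"
    by (rule open_prod_elim)
  have [measurable]: "V \<in> sets borel" "U \<in> sets borel" using VU by simp_all
  have "finite_visits V 0 = 0"
    using z VU by (subst finite_visits_eq_0) (auto simp: recurrent_value_def)
  moreover have pow: "(step \<mu> UNIV ^^ n) (finite_visits V) = finite_visits V" for n
    by (induction n) (auto simp: finite_visits_step[symmetric])
  ultimately have 0: "(step \<mu> UNIV ^^ n) (finite_visits V) 0 = 0" for n by simp
  \<comment> \<open>If \<open>finite_visits V\<close> were nonzero throughout U, its iterated means
    could vanish at 0 only if those of \<open>indicator U\<close> did, for every n, and w would not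
    be possible.\<close>
  have "\<exists>u\<in>U. finite_visits V u = 0"
  proof (rule ccontr)
    assume "\<not> ?thesis"
    then have *: "(step \<mu> UNIV ^^ n) (finite_visits V) x = 0 \<Longrightarrow> (step \<mu> UNIV ^^ n) (indicator U) x = 0" for n x
    proof (induction n arbitrary: x)
      case 0 then show ?case by (auto simp: indicator_def)
    next
      case (Suc n)
      show ?case
        using step_eq_0_mono[of "(step \<mu> UNIV ^^ n) (finite_visits V)" "(step \<mu> UNIV ^^ n) (indicator U)" x] Suc by auto
    qed
    then have "(step \<mu> UNIV ^^ n) (indicator U) 0 = 0" for n using 0 by blast
    then show False using w VU unfolding possible_value_def by blast
  qed
  then obtain u where u: "u \<in> U" "finite_visits V u = 0" by blast
  then have "AE \<omega> in path_law. infinite {n. pos u \<omega> n \<in> V}" by (simp add: finite_visits_eq_0)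
  then show "AE \<omega> in path_law. infinite {n. pos 0 \<omega> n \<in> G}"
  proof eventually_elim
    case (elim \<omega>)
    \<comment> \<open>The path from 0 is the path from u moved by -u, so a visit of the latter to V
      puts the former in V - U.\<close>
    have "{n. pos u \<omega> n \<in> V} \<subseteq> {n. pos 0 \<omega> n \<in> G}"
    proof safe
      fix n assume "pos u \<omega> n \<in> V"
      then have "(pos u \<omega> n, u) \<in> (\<lambda>p. fst p - snd p) -` G" using VU(4) u(1) by blast
      then show "pos 0 \<omega> n \<in> G" by (simp add: pos_def)
    qed
    then show ?case using elim finite_subset by blast
  qed
qed

text \<open>A recurrent value is possible, so recurrent values are closed under differences. The set
  is closed because a neighbourhood of a limit is a neighbourhood of some recurrent value.\<close>

lemma closed_subgroup_recurrent_values: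
  assumes 0: "recurrent_value 0"
  shows "closed_subgroup {z. recurrent_value z}"
proof -
  have poss: "recurrent_value w" if "possible_value w" for w
    using recurrent_value_diff[OF 0 recurrent_value_possible[OF recurrent_value_diff[OF 0 that]]] by simp
  have diff: "recurrent_value (z - w)" if "recurrent_value z" "recurrent_value w" for z w
    by (rule recurrent_value_diff[OF that(1) recurrent_value_possible[OF that(2)]])
  have minus: "recurrent_value (- w)" if "recurrent_value w" for w
    using diff[OF 0 that] by simp
  have "open {z. \<not> recurrent_value z}"
    by (subst open_subopen) (unfold recurrent_value_def, blast)
  then have "closed {z. recurrent_value z}" by (simp add: closed_def Compl_eq)
  then show ?thesis
    unfolding closed_subgroup_def using 0 minus diff[OF _ minus] by (auto simp del: diff_minus_eq_add simp flip: diff_minus_eq_add)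
qed

lemma support_recurrent_values:
  assumes 0: "recurrent_value 0"
  shows "topological_support \<mu> \<subseteq> {z. recurrent_value z}"
proof
  fix w assume w: "w \<in> topological_support \<mu>"
  have "possible_value w"
    unfolding possible_value_def
  proof (intro allI impI exI)
    fix G assume "open G" "w \<in> G"
    then have "emeasure \<mu> G > 0" using w by (auto simp: topological_support_def)
    moreover have "(step \<mu> UNIV ^^ 1) (indicator G) 0 = emeasure \<mu> G"
      using \<open>open G\<close> by (simp add: step_def)
    ultimately show "(step \<mu> UNIV ^^ 1) (indicator G) 0 \<noteq> 0" by simp
  qed
  then show "w \<in> {z. recurrent_value z}"
    \<comment> \<open>Subtracting twice, w = 0 - (0 - w) turns a possible value into a recurrent
      one.\<close>
    using recurrent_value_diff[OF 0 recurrent_value_possible[OF recurrent_value_diff[OF 0]]] by simp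
qed

text \<open>By minimality Z consists of recurrent values; in particular \<open>w - x\<close> is one,
  which is recurrence to w from x.\<close>

lemma recurrent_subgroup_walkI:
  assumes 0: "recurrent_value 0" and min: "\<And>S. closed_subgroup S \<Longrightarrow> topological_support \<mu> \<subseteq> S \<Longrightarrow> Z \<subseteq> S"
  shows "recurrent_subgroup_walk \<mu> Z"
proof
  fix x w G assume *: "x \<in> Z" "w \<in> Z" "open G" "w \<in> G"
  have "w - x \<in> {z. recurrent_value z}"
    using min[OF closed_subgroup_recurrent_values[OF 0] support_recurrent_values[OF 0]] Z_diff[OF *(2,1)] by blast
  moreover have "open ((+) x -` G)" by (intro open_vimage * continuous_intros)
  moreover have "w - x \<in> (+) x -` G" using * by simp
  ultimately have "AE \<omega> in path_law. infinite {n. pos 0 \<omega> n \<in> (+) x -` G}"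
    unfolding recurrent_value_def by blast
  then show "AE \<omega> in path_law. infinite {n. pos x \<omega> n \<in> G}"
    by (simp add: pos_def)
qed

end

section \<open>From the given random walk to the path law\<close>

lemma AE_in_topological_support:
  fixes m :: "'a::second_countable_topology measure"
  assumes sets_m: "sets m = sets borel"
  shows "AE x in m. x \<in> topological_support m"
proof -
  let ?F = "{U. open U \<and> emeasure m U = 0}"
  obtain F where F: "F \<subseteq> ?F" "countable F" "\<Union>F = \<Union>?F"
    using Lindelof[of ?F] by auto
  have "U \<in> null_sets m" if "U \<in> F" for U
    using that F(1) sets_m by (auto simp: null_sets_def)
  then have "\<Union>F \<in> null_sets m" using null_sets_UN'[of F id m] F(2) by simp
  then show ?thesis
    by (rule AE_I') (auto simp: F(3) topological_support_def not_gr_zero)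
qed

context random_walk
begin

abbreviation step_law :: "(real^'d) measure" where
  "step_law \<equiv> distr M borel (X 1)"

lemma X_measurable: "n \<ge> 1 \<Longrightarrow> X n \<in> borel_measurable M"
  using indep_increments unfolding indep_vars_def by auto

lemma closed_subgroup_state_space: "closed_subgroup (state_space M X)"
  unfolding state_space_def closed_subgroup_def by (auto intro!: closed_Inter)

lemma subgroup_walk_step_law: "subgroup_walk step_law (state_space M X)"
proof -
  interpret S: prob_space step_law by (rule prob_space_distr) (simp add: X_measurable)
  have "AE y in step_law. y \<in> state_space M X"
    using AE_in_topological_support[of step_law]
    by (auto elim!: eventually_mono simp: state_space_def)
  then show ?thesis
    by unfold_locales (auto simp: closed_subgroup_state_space)
qed

lemma increments_measurable: "(\<lambda>\<omega> i. X (Suc i) \<omega>) \<in> M \<rightarrow>\<^sub>M PiM UNIV (\<lambda>_. borel)"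
  by (rule measurable_PiM_single') (auto simp: X_measurable)

text \<open>The increments are numbered from 1 in \<open>random_walk\<close> and from 0 on path
  space, so the product measure given by independence is reindexed by \<open>Suc\<close>.\<close>

lemma distr_increments:
  "distr M (PiM UNIV (\<lambda>_. borel)) (\<lambda>\<omega> i. X (Suc i) \<omega>) = PiM UNIV (\<lambda>_. step_law)"
proof -
  let ?m = "\<lambda>i. distr M borel (X i)"
  have PiM_1: "PiM UNIV (\<lambda>i. ?m (Suc i)) = PiM UNIV (\<lambda>_. step_law)"
    by (intro PiM_cong refl identically_distributed) simp
  have "distr M (PiM {1..} (\<lambda>_. borel)) (\<lambda>\<omega>. \<lambda>i\<in>{1..}. X i \<omega>) = PiM {1..} ?m"
    using indep_increments by (subst (asm) indep_vars_iff_distr_eq_PiM') (auto simp: X_measurable)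
  then have "PiM UNIV (\<lambda>i. ?m (Suc i)) =
      distr (distr M (PiM {1..} (\<lambda>_. borel)) (\<lambda>\<omega>. \<lambda>i\<in>{1..}. X i \<omega>)) (PiM UNIV (\<lambda>i. ?m (Suc i))) (\<lambda>\<omega>. \<lambda>n\<in>UNIV. \<omega> (Suc n))"
    using distr_PiM_reindex[of "{1..}" ?m Suc UNIV]
    by (auto simp: prob_space_distr X_measurable)
  also have "\<dots> = distr M (PiM UNIV (\<lambda>i. ?m (Suc i))) ((\<lambda>\<omega>. \<lambda>n\<in>UNIV. \<omega> (Suc n)) \<circ> (\<lambda>\<omega>. \<lambda>i\<in>{1..}. X i \<omega>))"
  proof (rule distr_distr)
    show "(\<lambda>\<omega>. \<lambda>n\<in>UNIV. \<omega> (Suc n)) \<in> PiM {1..} (\<lambda>_. borel) \<rightarrow>\<^sub>M PiM UNIV (\<lambda>i. ?m (Suc i))"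
      by (intro measurable_restrict) (simp add: measurable_component_singleton)
    show "(\<lambda>\<omega>. \<lambda>i\<in>{1..}. X i \<omega>) \<in> M \<rightarrow>\<^sub>M PiM {1..} (\<lambda>_. borel)"
      by (intro measurable_restrict) (simp add: X_measurable)
  qed
  also have "\<dots> = distr M (PiM UNIV (\<lambda>_. borel)) (\<lambda>\<omega> i. X (Suc i) \<omega>)"
    by (intro distr_cong sets_PiM_cong) (auto simp: comp_def)
  finally show ?thesis unfolding PiM_1 ..
qed

lemma walk_eq_pos: "walk X x \<omega> = subgroup_walk.pos x (\<lambda>i. X (Suc i) \<omega>)"
proof -
  interpret S: subgroup_walk step_law "state_space M X" by (rule subgroup_walk_step_law)
  show ?thesis
    by (simp add: fun_eq_iff walk_def S.pos_def sum.atLeast1_atMost_eq)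
qed

lemma recurrent_walk:
  assumes "topologically_recurrent M X"
  shows "recurrent_subgroup_walk step_law (state_space M X)"
proof -
  interpret S: subgroup_walk step_law "state_space M X" by (rule subgroup_walk_step_law)
  show ?thesis
  proof (rule S.recurrent_subgroup_walkI)
    show "S.recurrent_value 0"
      unfolding S.recurrent_value_def
    proof (intro allI impI)
      fix G :: "(real^'d) set" assume G: "open G" "0 \<in> G"
      then have [measurable]: "G \<in> sets borel" by simp
      have "prob {\<omega>\<in>space M. infinite {n. walk X 0 \<omega> n \<in> G}} = 1"
        using assms G by (simp add: topologically_recurrent_def)
      then have "AE \<omega> in M. \<omega> \<in> {\<omega>\<in>space M. infinite {n. walk X 0 \<omega> n \<in> G}}"
        by (rule AE_prob_1)
      then have "AE \<omega> in M. infinite {n. S.pos 0 (\<lambda>i. X (Suc i) \<omega>) n \<in> G}"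
        by eventually_elim (simp add: walk_eq_pos)
      moreover have "{\<omega>\<in>space (PiM UNIV (\<lambda>_. borel)). infinite {n. S.pos 0 \<omega> n \<in> G}} \<in> sets (PiM UNIV (\<lambda>_. borel))"
        by measurable
      ultimately show "AE \<omega> in S.path_law. infinite {n. S.pos 0 \<omega> n \<in> G}"
        unfolding distr_increments[symmetric] by (subst AE_distr_iff[OF increments_measurable]) auto
    qed
  qed (auto simp: state_space_def)
qed

end

section \<open>Kernels and invariant measures of the walk\<close>

context crossing
begin

lemma entrance_time_first_cross:
  assumes "first_cross x \<omega> k"
  shows "entrance_time A Ac (pos x \<omega>) 1 = enat (Suc k)"
proof -
  let ?S = "{enat k |k. enat k > 0 \<and> pos x \<omega> (k - 1) \<in> Ac \<and> pos x \<omega> k \<in> A}"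
  have "Inf ?S = enat (Suc k)"
  proof (rule antisym)
    show "Inf ?S \<le> enat (Suc k)"
      using assms by (intro Inf_lower) (auto simp: first_cross_def zero_enat_def)
    show "enat (Suc k) \<le> Inf ?S"
    proof (rule Inf_greatest)
      fix e assume "e \<in> ?S"
      then obtain j where j: "e = enat j" "0 < j" "pos x \<omega> (j - 1) \<in> Ac" "pos x \<omega> j \<in> A"
        by (auto simp: zero_enat_def)
      then have "(pos x \<omega> (j - 1), pos x \<omega> (Suc (j - 1))) \<in> cross" by simp
      then have "\<not> j - 1 < k" using assms by (auto simp: first_cross_def)
      then show "enat (Suc k) \<le> e" using j by simp
    qed
  qed
  then show ?thesis by simp
qed

lemma entrance_time_no_cross:
  assumes "\<not> (\<exists>k. first_cross x \<omega> k)"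
  shows "entrance_time A Ac (pos x \<omega>) 1 = \<infinity>"
proof -
  have no: "(pos x \<omega> k, pos x \<omega> (Suc k)) \<notin> cross" for k
    using first_cross_exists assms by blast
  have "entrance_time A Ac (pos x \<omega>) 1 = Inf {enat k |k. enat k > 0 \<and> pos x \<omega> (k - 1) \<in> Ac \<and> pos x \<omega> k \<in> A}"
    by simp
  also have "{enat k |k. enat k > 0 \<and> pos x \<omega> (k - 1) \<in> Ac \<and> pos x \<omega> k \<in> A} = {}"
  proof -
    have False if "0 < k" "pos x \<omega> (k - 1) \<in> Ac" "pos x \<omega> k \<in> A" for k
      using no[of "k - 1"] that by simp
    then show ?thesis by (auto simp: zero_enat_def)
  qed
  finally show ?thesis by (simp add: top_enat_def)
qed

text \<open>\<open>h \<omega> k\<close> stands for the position read at a first crossing with index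
  k: \<open>pos x \<omega> k\<close> for the exit chain and \<open>pos x \<omega> (Suc k)\<close>
  for the entrance chain.\<close>

lemma crossing_position_law:
  assumes h[measurable]: "\<And>k. (\<lambda>\<omega>. h \<omega> k) \<in> PiM UNIV (\<lambda>_. borel) \<rightarrow>\<^sub>M borel" and E: "E \<in> sets borel"
    and fc: "\<And>\<omega> k. first_cross x \<omega> k \<Longrightarrow> f \<omega> = Some (h \<omega> k) \<and> h \<omega> k \<in> E"
    and nc: "\<And>\<omega>. \<not> (\<exists>k. first_cross x \<omega> k) \<Longrightarrow> f \<omega> = None"
  shows "f \<in> PiM UNIV (\<lambda>_. borel) \<rightarrow>\<^sub>M with_cemetery E"
    and "B \<in> sets (restrict_space borel E) \<Longrightarrow> emeasure (distr path_law (with_cemetery E) f) (Some ` B) =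
      emeasure path_law {\<omega>\<in>space path_law. \<exists>k. first_cross x \<omega> k \<and> h \<omega> k \<in> B}"
proof -
  show f: "f \<in> PiM UNIV (\<lambda>_. borel) \<rightarrow>\<^sub>M with_cemetery E"
  proof (rule measurableI)
    show "f \<omega> \<in> space (with_cemetery E)" for \<omega>
      using fc nc by (cases "\<exists>k. first_cross x \<omega> k") auto
    fix C assume "C \<in> sets (with_cemetery E)"
    then have [measurable]: "Some -` C \<in> sets borel" using E by (simp add: sets_with_cemetery restrict_sets_borel)
    have "f -` C \<inter> space (PiM UNIV (\<lambda>_. borel)) = {\<omega>\<in>space (PiM UNIV (\<lambda>_. borel)).
        (\<exists>k. first_cross x \<omega> k \<and> h \<omega> k \<in> Some -` C) \<or> (None \<in> C \<and> \<not> (\<exists>k. first_cross x \<omega> k))}"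
    proof -
      have "f \<omega> \<in> C \<longleftrightarrow> (\<exists>k. first_cross x \<omega> k \<and> h \<omega> k \<in> Some -` C) \<or> (None \<in> C \<and> \<not> (\<exists>k. first_cross x \<omega> k))" for \<omega>
        using fc[of \<omega>] nc[of \<omega>] by (cases "\<exists>k. first_cross x \<omega> k") fastforce+
      then show ?thesis by auto
    qed
    also have "\<dots> \<in> sets (PiM UNIV (\<lambda>_. borel))" by measurable
    finally show "f -` C \<inter> space (PiM UNIV (\<lambda>_. borel)) \<in> sets (PiM UNIV (\<lambda>_. borel))" .
  qed
  assume B: "B \<in> sets (restrict_space borel E)"
  have "f -` (Some ` B) \<inter> space path_law = {\<omega>\<in>space path_law. \<exists>k. first_cross x \<omega> k \<and> h \<omega> k \<in> B}"
  proof -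
    have "f \<omega> \<in> Some ` B \<longleftrightarrow> (\<exists>k. first_cross x \<omega> k \<and> h \<omega> k \<in> B)" for \<omega>
      using fc[of \<omega>] nc[of \<omega>] by (cases "\<exists>k. first_cross x \<omega> k") fastforce+
    then show ?thesis by auto
  qed
  moreover have "f \<in> path_law \<rightarrow>\<^sub>M with_cemetery E" using f by simp
  ultimately show "emeasure (distr path_law (with_cemetery E) f) (Some ` B) =
      emeasure path_law {\<omega>\<in>space path_law. \<exists>k. first_cross x \<omega> k \<and> h \<omega> k \<in> B}"
    using Some_image_sets[OF B] by (simp add: emeasure_distr)
qed

lemma entrance_position_law:
  shows "(\<lambda>\<omega>. entrance_position A Ac (pos x \<omega>) 1) \<in> PiM UNIV (\<lambda>_. borel) \<rightarrow>\<^sub>M with_cemetery A"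
    and "B \<in> sets (restrict_space borel A) \<Longrightarrow>
      emeasure (distr path_law (with_cemetery A) (\<lambda>\<omega>. entrance_position A Ac (pos x \<omega>) 1)) (Some ` B) = H (R (indicator B)) x"
proof -
  let ?f = "\<lambda>\<omega>. entrance_position A Ac (pos x \<omega>) 1"
  have 1: "?f \<omega> = Some (pos x \<omega> (Suc k)) \<and> pos x \<omega> (Suc k) \<in> A" if "first_cross x \<omega> k" for \<omega> k
    using that entrance_time_first_cross[OF that] by (simp add: entrance_position_def first_cross_def)
  have 2: "?f \<omega> = None" if "\<not> (\<exists>k. first_cross x \<omega> k)" for \<omega>
    using entrance_time_no_cross[OF that] by (simp add: entrance_position_def)
  show "?f \<in> PiM UNIV (\<lambda>_. borel) \<rightarrow>\<^sub>M with_cemetery A"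
    by (rule crossing_position_law(1)[OF pos_measurable A_borel 1 2])
  assume B: "B \<in> sets (restrict_space borel A)"
  then have B': "B \<in> sets borel" by (simp add: restrict_sets_borel)
  show "emeasure (distr path_law (with_cemetery A) ?f) (Some ` B) = H (R (indicator B)) x"
    using crossing_position_law(2)[OF pos_measurable A_borel 1 2 B] emeasure_crossing_position[OF B', of UNIV x]
    by simp
qed

lemma exit_position_law:
  shows "(\<lambda>\<omega>. exit_position A Ac (pos x \<omega>) 1) \<in> PiM UNIV (\<lambda>_. borel) \<rightarrow>\<^sub>M with_cemetery Ac"
    and "B \<in> sets (restrict_space borel Ac) \<Longrightarrow>
      emeasure (distr path_law (with_cemetery Ac) (\<lambda>\<omega>. exit_position A Ac (pos x \<omega>) 1)) (Some ` B) =
      H (\<lambda>v. indicator B v * R (\<lambda>_. 1) v) x"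
proof -
  let ?f = "\<lambda>\<omega>. exit_position A Ac (pos x \<omega>) 1"
  have 1: "?f \<omega> = Some (pos x \<omega> k) \<and> pos x \<omega> k \<in> Ac" if "first_cross x \<omega> k" for \<omega> k
    using that entrance_time_first_cross[OF that] by (simp add: exit_position_def first_cross_def)
  have 2: "?f \<omega> = None" if "\<not> (\<exists>k. first_cross x \<omega> k)" for \<omega>
    using entrance_time_no_cross[OF that] by (simp add: exit_position_def)
  show "?f \<in> PiM UNIV (\<lambda>_. borel) \<rightarrow>\<^sub>M with_cemetery Ac"
    by (rule crossing_position_law(1)[OF pos_measurable Ac_borel 1 2])
  assume B: "B \<in> sets (restrict_space borel Ac)"
  then have B': "B \<in> sets borel" by (simp add: restrict_sets_borel)
  have "R (indicator UNIV) = R (\<lambda>_. 1)" by (rule ext, rule R_cong_A) simp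
  then show "emeasure (distr path_law (with_cemetery Ac) ?f) (Some ` B) = H (\<lambda>v. indicator B v * R (\<lambda>_. 1) v) x"
    using crossing_position_law(2)[OF pos_measurable Ac_borel 1 2 B] emeasure_crossing_position[OF _ B', of UNIV x]
    by simp
qed

text \<open>Translating \<open>haar\<close> by the increment changes the variable from the exit
  point to the entrance point. This identifies \<open>haar R\<close> with the entrance measure of
  the theorem.\<close>

lemma haar_R_eq:
  assumes [measurable]: "f \<in> borel_measurable borel"
  shows "(\<integral>\<^sup>+x. R f x \<partial>haar) = (\<integral>\<^sup>+x. indicator A x * (emeasure \<mu> {y. x - y \<in> Ac} * f x) \<partial>haar)"
proof -
  interpret P: pair_sigma_finite \<mu> haar ..
  have "(\<integral>\<^sup>+x. R f x \<partial>haar) = (\<integral>\<^sup>+x. \<integral>\<^sup>+y. indicator Ac x * indicator A (y + x) * f (y + x) \<partial>\<mu> \<partial>haar)"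
    unfolding step_def by (intro nn_integral_cong) (auto simp: indicator_def add.commute)
  also have "\<dots> = (\<integral>\<^sup>+y. \<integral>\<^sup>+x. indicator Ac x * indicator A (y + x) * f (y + x) \<partial>haar \<partial>\<mu>)"
    by (rule P.Fubini') measurable
  also have "\<dots> = (\<integral>\<^sup>+y. \<integral>\<^sup>+x. indicator Ac (x - y) * indicator A x * f x \<partial>haar \<partial>\<mu>)"
    using AE_in_subgroup
  proof (intro nn_integral_cong_AE, eventually_elim)
    case (elim y)
    show ?case
      using nn_integral_translate[OF haar_translate[OF elim(2)], of "\<lambda>x. indicator Ac (x - y) * indicator A x * f x"]
      by simp
  qed
  also have "\<dots> = (\<integral>\<^sup>+x. \<integral>\<^sup>+y. indicator Ac (x - y) * indicator A x * f x \<partial>\<mu> \<partial>haar)"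
    by (rule P.Fubini'[symmetric]) measurable
  also have "\<dots> = (\<integral>\<^sup>+x. indicator A x * (emeasure \<mu> {y. x - y \<in> Ac} * f x) \<partial>haar)"
  proof (rule nn_integral_cong)
    fix x
    have "{y\<in>space \<mu>. x - y \<in> Ac} \<in> sets \<mu>" by measurable
    then have m: "{y. x - y \<in> Ac} \<in> sets \<mu>" by (simp add: sets_eq_imp_space_eq[OF sets_law])
    have "(\<integral>\<^sup>+y. indicator Ac (x - y) * indicator A x * f x \<partial>\<mu>) = (\<integral>\<^sup>+y. indicator {y. x - y \<in> Ac} y * (indicator A x * f x) \<partial>\<mu>)"
      by (intro nn_integral_cong) (simp add: indicator_def)
    also have "\<dots> = emeasure \<mu> {y. x - y \<in> Ac} * (indicator A x * f x)"
      using m by (subst nn_integral_multc) auto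
    finally show "(\<integral>\<^sup>+y. indicator Ac (x - y) * indicator A x * f x \<partial>\<mu>) = indicator A x * (emeasure \<mu> {y. x - y \<in> Ac} * f x)"
      by (simp add: ac_simps)
  qed
  finally show ?thesis .
qed

lemma emeasure_minus_Ac_measurable[measurable]: "(\<lambda>x. emeasure \<mu> {y. x - y \<in> Ac}) \<in> borel_measurable borel"
proof -
  have "{p \<in> space (borel \<Otimes>\<^sub>M \<mu>). fst p - snd p \<in> Ac} \<in> sets (borel \<Otimes>\<^sub>M \<mu>)" by measurable
  from measurable_emeasure_Pair[OF this] show ?thesis
    by (simp add: space_pair_measure sets_eq_imp_space_eq[OF sets_law] vimage_def)
qed

lemma R_one_eq:
  assumes "x \<in> Ac"
  shows "R (\<lambda>_. 1) x = emeasure \<mu> {y. x + y \<in> A}"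
proof -
  have "{y\<in>space \<mu>. x + y \<in> A} \<in> sets \<mu>" by measurable
  then have m: "{y. x + y \<in> A} \<in> sets \<mu>" by (simp add: sets_eq_imp_space_eq[OF sets_law])
  have "R (\<lambda>_. 1) x = (\<integral>\<^sup>+y. indicator {y. x + y \<in> A} y \<partial>\<mu>)"
    unfolding step_def using assms by (intro nn_integral_cong) (auto simp: indicator_def)
  with m show ?thesis by simp
qed

lemma R_eq_integral:
  assumes "x \<in> Ac"
  shows "R f x = (\<integral>\<^sup>+y. f (x + y) * indicator A (x + y) \<partial>\<mu>)"
  unfolding step_def using assms by (intro nn_integral_cong) (auto simp: indicator_def)

end

text \<open>Z splits into the relative interior of A, that of its complement, and the frontier. The
  frontier is null while A and its complement are not, so both interiors are nonempty; as relatively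
  open sets they are traces of the ambient open sets \<open>Ai\<close> and
  \<open>Bi\<close>.\<close>

lemma crossing_interiors:
  fixes Z A :: "'a::euclidean_space set"
  assumes haar: "haar_walk \<mu> Z (distr m borel (\<lambda>x. x))" and sets_m: "sets m = sets (restrict_space borel Z)"
    and A: "A \<subseteq> Z" "A \<in> sets borel" and "emeasure m A > 0" "emeasure m (Z - A) > 0"
    and fr: "emeasure m ((top_of_set Z) frontier_of A) = 0"
  obtains Ai Bi where "crossing \<mu> Z (distr m borel (\<lambda>x. x)) A (Z - A) Ai Bi"
proof -
  interpret haar_walk \<mu> Z "distr m borel (\<lambda>x. x)" by fact
  let ?T = "top_of_set Z"
  have id: "(\<lambda>x. x) \<in> m \<rightarrow>\<^sub>M borel"
    by (simp add: measurable_cong_sets[OF sets_m refl] measurable_restrict_space1)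
  have sp: "space m = Z" using sets_eq_imp_space_eq[OF sets_m] by (simp add: space_restrict_space)
  obtain Ai where Ai: "open Ai" "?T interior_of A = Z \<inter> Ai"
    using openin_interior_of[of ?T A] unfolding openin_open by blast
  obtain Bi where Bi: "open Bi" "?T interior_of (Z - A) = Z \<inter> Bi"
    using openin_interior_of[of ?T "Z - A"] unfolding openin_open by blast
  have fr_sets: "?T frontier_of A \<in> sets m"
  proof -
    have "closedin ?T (?T frontier_of A)" by (rule closedin_frontier_of)
    then obtain C where "closed C" "?T frontier_of A = Z \<inter> C" by (auto simp: closedin_closed)
    then show ?thesis by (simp add: sets_m restrict_sets_borel)
  qed
  have compl: "?T interior_of (Z - A) = Z - ?T closure_of A"
    using interior_of_complement[of ?T A] by simp
  have Z_cases: "x \<in> Ai \<or> x \<in> Bi \<or> x \<in> ?T frontier_of A" if "x \<in> Z" for x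
    using that Ai(2) Bi(2) compl by (auto simp: frontier_of_def)
  have A_cl: "A \<subseteq> ?T closure_of A" using A(1) by (intro closure_of_subset) simp
  have "Ai \<inter> Z \<subseteq> A" using Ai(2) interior_of_subset[of ?T A] by auto
  moreover have "Bi \<inter> Z \<subseteq> Z - A" using Bi(2) interior_of_subset[of ?T "Z - A"] by auto
  moreover have "AE x in distr m borel (\<lambda>x. x). x \<in> Ai \<union> Bi"
  proof -
    have "?T frontier_of A \<in> null_sets m" using fr fr_sets by (simp add: null_sets_def)
    then have "AE x in m. x \<in> Ai \<union> Bi" by (rule AE_I') (use Z_cases sp in auto)
    then show ?thesis using Ai(1) Bi(1) by (subst AE_distr_iff[OF id]) (simp_all add: Collect_disj_eq)
  qed
  moreover have "Ai \<inter> Z \<noteq> {}"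
  proof
    assume "Ai \<inter> Z = {}"
    then have "A \<subseteq> ?T frontier_of A" using Ai(2) A_cl by (auto simp: frontier_of_def)
    then have "emeasure m A \<le> emeasure m (?T frontier_of A)" by (rule emeasure_mono[OF _ fr_sets])
    with fr assms(5) show False by simp
  qed
  moreover have "Bi \<inter> Z \<noteq> {}"
  proof
    assume "Bi \<inter> Z = {}"
    then have "Z - A \<subseteq> ?T frontier_of A" using Z_cases calculation(1) by blast
    then have "emeasure m (Z - A) \<le> emeasure m (?T frontier_of A)" by (rule emeasure_mono[OF _ fr_sets])
    with fr assms(6) show False by simp
  qed
  ultimately show ?thesis
    using A Ai(1) Bi(1) by (intro that[of Ai Bi]) (unfold_locales, simp_all)
qed

lemma haar_walk_distr:
  fixes Z :: "'a::euclidean_space set"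
  assumes "recurrent_subgroup_walk \<mu> Z" and haar: "haar_measure_on Z m"
  shows "haar_walk \<mu> Z (distr m borel (\<lambda>x. x))"
proof -
  interpret recurrent_subgroup_walk \<mu> Z by fact
  have lf: "locally_finite_borel_measure_on Z m" and pos: "emeasure m Z > 0"
    and inv: "\<And>z B. z \<in> Z \<Longrightarrow> B \<in> sets m \<Longrightarrow> emeasure m ((+) z ` B) = emeasure m B"
    using haar by (auto simp: haar_measure_on_def)
  have sets_m: "sets m = sets (restrict_space borel Z)"
    using lf by (simp add: locally_finite_borel_measure_on_def)
  have sp: "space m = Z" using sets_eq_imp_space_eq[OF sets_m] by (simp add: space_restrict_space)
  have id: "(\<lambda>x. x) \<in> m \<rightarrow>\<^sub>M borel"
    by (simp add: measurable_cong_sets[OF sets_m refl] measurable_restrict_space1)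
  have em: "emeasure (distr m borel (\<lambda>x. x)) B = emeasure m (B \<inter> Z)" if "B \<in> sets borel" for B
    using that by (simp add: emeasure_distr[OF id] sp)
  obtain V :: "nat \<Rightarrow> 'a set" where V: "\<And>i. open (V i)" "\<And>i. emeasure m (V i \<inter> Z) < \<infinity>" "Z \<subseteq> (\<Union>i. V i)"
    by (rule locally_finite_cover[OF lf]) (rule that)
  show ?thesis
  proof
    show "\<exists>U. open U \<and> x \<in> U \<and> emeasure (distr m borel (\<lambda>x. x)) U < \<infinity>" for x
    proof (cases "x \<in> Z")
      case True
      then obtain i where "x \<in> V i" using V(3) by blast
      with V(1,2) show ?thesis by (intro exI[of _ "V i"]) (simp add: em)
    next
      case False
      then show ?thesis using Z_closed by (intro exI[of _ "- Z"]) (auto simp: em)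
    qed
    show "AE x in distr m borel (\<lambda>x. x). x \<in> Z"
      by (subst AE_distr_iff[OF id]) (auto simp: sp intro!: AE_I2)
    show "emeasure (distr m borel (\<lambda>x. x)) UNIV \<noteq> 0" using pos by (simp add: em)
    fix z assume z: "z \<in> Z"
    show "distr (distr m borel (\<lambda>x. x)) borel ((+) z) = distr m borel (\<lambda>x. x)"
    proof (rule measure_eqI)
      fix B :: "'a set" assume "B \<in> sets (distr (distr m borel (\<lambda>x. x)) borel ((+) z))"
      then have B: "B \<in> sets borel" by simp
      have pre: "(+) z -` B \<in> sets borel" using measurable_sets_borel[OF _ B, of "(+) z"] by simp
      \<comment> \<open>Invariance of m is assumed for images of sets, while a pushforward involves
        preimages; on Z the two match because Z is a group.\<close>
      have img: "(+) z ` ((+) z -` B \<inter> Z) = B \<inter> Z"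
      proof safe
        fix x assume "x \<in> B" "x \<in> Z"
        then show "x \<in> (+) z ` ((+) z -` B \<inter> Z)"
          using Z_diff[OF _ z, of x] by (intro image_eqI[of _ _ "x - z"]) auto
      qed (use z Z_add in auto)
      have "emeasure (distr (distr m borel (\<lambda>x. x)) borel ((+) z)) B = emeasure m ((+) z -` B \<inter> Z)"
        using B pre by (simp add: emeasure_distr em)
      also have "\<dots> = emeasure m ((+) z ` ((+) z -` B \<inter> Z))"
        using pre by (intro inv[symmetric] z) (simp add: sets_m restrict_sets_borel)
      also have "\<dots> = emeasure (distr m borel (\<lambda>x. x)) B" using B by (simp add: img em)
      finally show "emeasure (distr (distr m borel (\<lambda>x. x)) borel ((+) z)) B = emeasure (distr m borel (\<lambda>x. x)) B" .
    qed simp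
  qed simp
qed

section \<open>The concrete kernels and measures\<close>

lemma (in random_walk) distr_walk:
  assumes "f \<in> PiM UNIV (\<lambda>_. borel) \<rightarrow>\<^sub>M N"
  shows "distr M N (\<lambda>\<omega>. f (\<lambda>i. X (Suc i) \<omega>)) = distr (PiM UNIV (\<lambda>_. step_law)) N f"
  unfolding distr_increments[symmetric]
  by (subst distr_distr[OF assms increments_measurable]) (simp add: comp_def)

locale walk_crossing = random_walk M X +
  C: crossing "distr M borel (X 1)" Z "distr haar borel (\<lambda>x. x)" A Ac Ai Bi
  for M :: "'w measure" and X :: "nat \<Rightarrow> 'w \<Rightarrow> real^'d" and Z haar A Ac Ai Bi +
  assumes sets_haar: "sets haar = sets (restrict_space borel Z)"
begin

abbreviation "ext_haar \<equiv> distr haar borel (\<lambda>x. x)"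

lemma X1[measurable]: "X 1 \<in> borel_measurable M"
  by (rule X_measurable) simp

lemma space_haar: "space haar = Z"
  using sets_eq_imp_space_eq[OF sets_haar] by (simp add: space_restrict_space)

lemma sets_restrict_haar:
  assumes "E \<in> sets borel" "E \<subseteq> Z"
  shows "sets (restrict_space haar E) = sets (restrict_space borel E)"
proof (rule set_eqI)
  fix B
  have "E \<inter> space haar \<in> sets haar" using assms by (simp add: sets_haar restrict_sets_borel space_haar)
  then show "B \<in> sets (restrict_space haar E) \<longleftrightarrow> B \<in> sets (restrict_space borel E)"
    using assms by (subst sets_restrict_space_iff) (auto simp: sets_haar restrict_sets_borel)
qed

text \<open>\<open>e\<close> is a Borel function on the whole space that agrees with the density g
  on E. For the exit measure it is \<open>R 1\<close>, which is 0 off \<open>Ac\<close>, whereas the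
  probability in the definition need not be.\<close>

lemma nn_integral_density_restrict_haar:
  assumes E: "E \<in> sets borel" "E \<subseteq> Z" and [measurable]: "e \<in> borel_measurable borel" "f \<in> borel_measurable borel"
    and g: "\<And>x. x \<in> E \<Longrightarrow> g x = e x"
  shows "(\<integral>\<^sup>+x. f x \<partial>density (restrict_space haar E) g) = (\<integral>\<^sup>+x. indicator E x * (e x * f x) \<partial>ext_haar)"
proof -
  have id: "(\<lambda>x. x) \<in> haar \<rightarrow>\<^sub>M borel"
    by (simp add: measurable_cong_sets[OF sets_haar refl] measurable_restrict_space1)
  have spE: "space (restrict_space haar E) = E" using E by (auto simp: space_restrict_space space_haar)
  have restr: "h \<in> borel_measurable (restrict_space haar E)" if "h \<in> borel_measurable borel" for h :: "real^'d \<Rightarrow> ennreal"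
    using that by (simp add: measurable_cong_sets[OF sets_restrict_haar[OF E] refl] measurable_restrict_space1)
  have ge: "g \<in> borel_measurable (restrict_space haar E)"
    by (rule measurable_cong[THEN iffD1, OF _ restr[of e]]) (simp_all add: spE g)
  have "(\<integral>\<^sup>+x. f x \<partial>density (restrict_space haar E) g) = (\<integral>\<^sup>+x. g x * f x \<partial>restrict_space haar E)"
    by (rule nn_integral_density[OF ge restr]) measurable
  also have "\<dots> = (\<integral>\<^sup>+x. e x * f x \<partial>restrict_space haar E)"
    by (intro nn_integral_cong) (simp add: spE g)
  also have "\<dots> = (\<integral>\<^sup>+x. e x * f x * indicator E x \<partial>haar)"
    using E by (intro nn_integral_restrict_space) (simp add: sets_haar restrict_sets_borel space_haar)
  also have "\<dots> = (\<integral>\<^sup>+x. e x * f x * indicator E x \<partial>ext_haar)"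
    using E(1) by (subst nn_integral_distr[OF id]) simp_all
  finally show ?thesis by (simp add: ac_simps)
qed

lemma Ac_subset: "Ac \<subseteq> Z"
  using C.Ac_eq by blast

lemma entrance_kernel_eq: "entrance_kernel M X A Ac x =
    distr C.path_law (with_cemetery A) (\<lambda>\<omega>. entrance_position A Ac (C.pos x \<omega>) 1)"
  unfolding entrance_kernel_def walk_eq_pos by (rule distr_walk[OF C.entrance_position_law(1)])

lemma exit_distr: "distr M (with_cemetery Ac) (\<lambda>\<omega>. exit_position A Ac (walk X x \<omega>) 1) =
    distr C.path_law (with_cemetery Ac) (\<lambda>\<omega>. exit_position A Ac (C.pos x \<omega>) 1)"
  unfolding walk_eq_pos by (rule distr_walk[OF C.exit_position_law(1)])

sublocale E: entrance_chain step_law Z ext_haar A Ac Ai Bi "entrance_kernel M X A Ac"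
proof
  show "entrance_kernel M X A Ac \<in> restrict_space borel A \<rightarrow>\<^sub>M prob_algebra (with_cemetery A)"
  proof (rule prob_kernelI)
    show "prob_space (entrance_kernel M X A Ac x)" for x
      unfolding entrance_kernel_eq
      by (rule prob_space.prob_space_distr[OF C.prob_space_path_law])
         (unfold measurable_cong_sets[OF C.sets_path_law refl], rule C.entrance_position_law(1))
    show "sets (entrance_kernel M X A Ac x) = sets (with_cemetery A)" for x
      by (simp add: entrance_kernel_def)
    fix B assume B: "B \<in> sets (restrict_space borel A)"
    then have [measurable]: "B \<in> sets borel" by (simp add: restrict_sets_borel)
    have "C.H (C.R (indicator B)) \<in> borel_measurable borel" by measurable
    then show "(\<lambda>x. emeasure (entrance_kernel M X A Ac x) (Some ` B)) \<in> borel_measurable (restrict_space borel A)"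
      unfolding entrance_kernel_eq C.entrance_position_law(2)[OF B] by (rule measurable_restrict_space1)
  qed
  show "emeasure (entrance_kernel M X A Ac x) (Some ` B) = C.H (C.R (indicator B)) x"
    if "B \<in> sets (restrict_space borel A)" for x B
    unfolding entrance_kernel_eq by (rule C.entrance_position_law(2)[OF that])
qed

lemma entrance_density: "emeasure M {\<omega>\<in>space M. X 1 \<omega> \<in> (\<lambda>y. x - y) ` Ac} = emeasure step_law {y. x - y \<in> Ac}"
proof -
  have "{y\<in>space borel. x - y \<in> Ac} \<in> sets borel" by measurable
  then have "emeasure step_law {y. x - y \<in> Ac} = emeasure M (X 1 -` {y. x - y \<in> Ac} \<inter> space M)"
    by (subst emeasure_distr[OF X1]) simp_all
  also have "X 1 -` {y. x - y \<in> Ac} \<inter> space M = {\<omega>\<in>space M. X 1 \<omega> \<in> (\<lambda>y. x - y) ` Ac}"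
    by (force simp: image_iff)
  finally show ?thesis ..
qed

lemma entrance_theorem:
  "unique_locally_finite_invariant A (entrance_kernel M X A Ac) (entrance_measure M X haar A Ac) \<and>
    recurrent_for A (entrance_kernel M X A Ac) (entrance_measure M X haar A Ac) \<and>
    ergodic_for A (entrance_kernel M X A Ac) (entrance_measure M X haar A Ac)"
proof (rule E.entrance_main)
  show "sets (entrance_measure M X haar A Ac) = sets (restrict_space borel A)"
    by (simp add: entrance_measure_def sets_restrict_haar C.A_borel C.A_subset)
  fix f :: "real^'d \<Rightarrow> ennreal" assume f: "f \<in> borel_measurable borel"
  show "(\<integral>\<^sup>+x. f x \<partial>entrance_measure M X haar A Ac) = (\<integral>\<^sup>+x. C.R f x \<partial>ext_haar)"
    unfolding entrance_measure_def C.haar_R_eq[OF f]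
    by (rule nn_integral_density_restrict_haar[OF C.A_borel C.A_subset C.emeasure_minus_Ac_measurable f entrance_density])
qed

definition exit_law :: "real^'d \<Rightarrow> (real^'d) option measure" where
  "exit_law z = distr M (with_cemetery Ac) (\<lambda>\<omega>. exit_position A Ac (walk X z \<omega>) 1)"

abbreviation exit_potential :: "(real^'d) set \<Rightarrow> real^'d \<Rightarrow> ennreal" where
  "exit_potential B \<equiv> C.H (\<lambda>v. indicator B v * C.R (\<lambda>_. 1) v)"

definition next_law :: "real^'d \<Rightarrow> (real^'d) measure" where
  "next_law x = distr M borel (\<lambda>\<omega>. walk X x \<omega> 1)"

lemma emeasure_exit_law:
  "B \<in> sets (restrict_space borel Ac) \<Longrightarrow> emeasure (exit_law z) (Some ` B) = exit_potential B z"
  unfolding exit_law_def exit_distr by (rule C.exit_position_law(2))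

lemma exit_potential_measurable:
  assumes "B \<in> sets (restrict_space borel Ac)"
  shows "exit_potential B \<in> borel_measurable borel"
proof -
  have [measurable]: "B \<in> sets borel" using assms by (simp add: restrict_sets_borel)
  show ?thesis by measurable
qed

lemma exit_law_measurable: "exit_law \<in> borel \<rightarrow>\<^sub>M prob_algebra (with_cemetery Ac)"
proof (rule prob_kernelI)
  show "prob_space (exit_law x)" for x
    unfolding exit_law_def exit_distr
    by (rule prob_space.prob_space_distr[OF C.prob_space_path_law])
       (unfold measurable_cong_sets[OF C.sets_path_law refl], rule C.exit_position_law(1))
  show "sets (exit_law x) = sets (with_cemetery Ac)" for x by (simp add: exit_law_def)
  show "(\<lambda>x. emeasure (exit_law x) (Some ` B)) \<in> borel_measurable borel" if "B \<in> sets (restrict_space borel Ac)" for B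
    unfolding emeasure_exit_law[OF that] by (rule exit_potential_measurable[OF that])
qed

lemma next_law_eq: "next_law x = distr step_law borel ((+) x)"
  unfolding next_law_def by (subst distr_distr[OF _ X1]) (simp_all add: walk_def comp_def)

lemma nn_integral_next_law:
  "f \<in> borel_measurable borel \<Longrightarrow> (\<integral>\<^sup>+z. f z \<partial>next_law x) = (\<integral>\<^sup>+y. f (x + y) \<partial>step_law)"
  unfolding next_law_eq by (subst nn_integral_distr) simp_all

lemma sets_next_law: "sets (next_law x) = sets borel"
  by (simp add: next_law_def)

lemma emeasure_next_law:
  assumes "x \<in> Ac"
  shows "emeasure (next_law x) A = C.R (\<lambda>_. 1) x"
proof -
  have "emeasure (next_law x) A = (\<integral>\<^sup>+z. indicator A z \<partial>next_law x)" using C.A_borel by (simp add: sets_next_law)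
  then show ?thesis using nn_integral_next_law[of "indicator A" x] C.R_eq_integral[OF assms, of "\<lambda>_. 1"] C.A_borel by simp
qed

lemma exit_kernel_eq:
  assumes "x \<in> Ac"
  shows "exit_kernel M X A Ac x =
    (if C.R (\<lambda>_. 1) x > 0 then uniform_measure (next_law x) A \<bind> exit_law else return (with_cemetery Ac) None)"
  unfolding exit_kernel_def Let_def next_law_def[symmetric] exit_law_def[symmetric] emeasure_next_law[OF assms] ..

lemma uniform_next_law:
  assumes "x \<in> Ac" "C.R (\<lambda>_. 1) x > 0"
  shows "uniform_measure (next_law x) A \<in> space (prob_algebra borel)"
  using assms C.R_one_le[of x] unfolding space_prob_algebra
  by (auto simp: sets_next_law emeasure_next_law top_unique intro!: prob_space_uniform_measure)

text \<open>The conditional law of the step contributes the indicator of A, which turns the mean of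
  the exit law into \<open>R\<close>, and the normalising factor \<open>R 1 x\<close>. If a step
  into A has probability 0, both sides are 0.\<close>

lemma emeasure_exit_kernel:
  assumes x: "x \<in> Ac" and B: "B \<in> sets (restrict_space borel Ac)"
  shows "emeasure (exit_kernel M X A Ac x) (Some ` B) = C.R (exit_potential B) x / C.R (\<lambda>_. 1) x"
proof (cases "C.R (\<lambda>_. 1) x > 0")
  case True
  let ?g = "exit_potential B"
  have Du: "exit_law \<in> uniform_measure (next_law x) A \<rightarrow>\<^sub>M subprob_algebra (with_cemetery Ac)"
    using measurable_prob_algebraD[OF exit_law_measurable] by (simp add: measurable_def sets_next_law sets_eq_imp_space_eq[OF sets_next_law])
  have "emeasure (uniform_measure (next_law x) A \<bind> exit_law) (Some ` B) = (\<integral>\<^sup>+z. emeasure (exit_law z) (Some ` B) \<partial>uniform_measure (next_law x) A)"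
    by (rule emeasure_bind[OF _ Du Some_image_sets[OF B]]) (simp add: sets_eq_imp_space_eq[OF sets_next_law])
  also have "\<dots> = (\<integral>\<^sup>+z. ?g z * indicator A z \<partial>next_law x) / emeasure (next_law x) A"
    unfolding emeasure_exit_law[OF B] using exit_potential_measurable[OF B] C.A_borel
    by (intro nn_integral_uniform_measure) (simp_all add: sets_next_law measurable_cong_sets[OF sets_next_law refl])
  also have "(\<integral>\<^sup>+z. ?g z * indicator A z \<partial>next_law x) = C.R ?g x"
    unfolding C.R_eq_integral[OF x]
    by (rule nn_integral_next_law) (intro borel_measurable_times_ennreal exit_potential_measurable[OF B] borel_measurable_indicator C.A_borel)
  finally show ?thesis using True by (simp add: exit_kernel_eq[OF x] emeasure_next_law[OF x])
next
  case False
  then have "C.R (\<lambda>_. 1) x = 0" by simp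
  moreover from this have "C.R (exit_potential B) x = 0"
    by (rule C.R_eq_0[OF exit_potential_measurable[OF B]])
  moreover have "emeasure (return (with_cemetery Ac) None) (Some ` B) = 0"
    using Some_image_sets[OF B] by (simp add: emeasure_return)
  ultimately show ?thesis by (simp add: exit_kernel_eq[OF x])
qed

sublocale F: exit_chain step_law Z ext_haar A Ac Ai Bi "exit_kernel M X A Ac"
proof
  show "exit_kernel M X A Ac \<in> restrict_space borel Ac \<rightarrow>\<^sub>M prob_algebra (with_cemetery Ac)"
  proof (rule prob_kernelI)
    fix x assume "x \<in> space (restrict_space borel Ac)"
    then have x: "x \<in> Ac" by (simp add: space_restrict_space)
    have "exit_kernel M X A Ac x \<in> space (prob_algebra (with_cemetery Ac))"
    proof (cases "C.R (\<lambda>_. 1) x > 0")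
      case True
      show ?thesis
        using measurable_space[OF measurable_bind_prob_space2] prob_space_bind'[OF uniform_next_law[OF x True] exit_law_measurable]
          sets_bind'[OF uniform_next_law[OF x True] exit_law_measurable] True
        by (simp add: exit_kernel_eq[OF x] space_prob_algebra)
    next
      case False
      then show ?thesis
        by (simp add: exit_kernel_eq[OF x] space_prob_algebra prob_space_return)
    qed
    then show "prob_space (exit_kernel M X A Ac x)" "sets (exit_kernel M X A Ac x) = sets (with_cemetery Ac)"
      by (simp_all add: space_prob_algebra)
  next
    fix B assume B: "B \<in> sets (restrict_space borel Ac)"
    let ?h = "\<lambda>x. C.R (exit_potential B) x / C.R (\<lambda>_. 1) x"
    note [measurable] = exit_potential_measurable[OF B]
    have "?h \<in> borel_measurable borel" by measurable
    then have "?h \<in> borel_measurable (restrict_space borel Ac)" by (rule measurable_restrict_space1)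
    then show "(\<lambda>x. emeasure (exit_kernel M X A Ac x) (Some ` B)) \<in> borel_measurable (restrict_space borel Ac)"
      by (rule measurable_cong[THEN iffD1, rotated]) (simp add: emeasure_exit_kernel[OF _ B] space_restrict_space)
  qed
qed (rule emeasure_exit_kernel)

lemma exit_density:
  assumes "x \<in> Ac"
  shows "emeasure M {\<omega>\<in>space M. X 1 \<omega> \<in> (\<lambda>y. y - x) ` A} = C.R (\<lambda>_. 1) x"
proof -
  have "{y\<in>space borel. x + y \<in> A} \<in> sets borel" using C.A_borel by measurable
  then have "emeasure step_law {y. x + y \<in> A} = emeasure M (X 1 -` {y. x + y \<in> A} \<inter> space M)"
    by (subst emeasure_distr[OF X1]) simp_all
  also have "X 1 -` {y. x + y \<in> A} \<inter> space M = {\<omega>\<in>space M. X 1 \<omega> \<in> (\<lambda>y. y - x) ` A}"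
    by (force simp: image_iff)
  finally show ?thesis unfolding C.R_one_eq[OF assms] ..
qed

lemma exit_theorem:
  "unique_locally_finite_invariant Ac (exit_kernel M X A Ac) (exit_measure M X haar A Ac) \<and>
    recurrent_for Ac (exit_kernel M X A Ac) (exit_measure M X haar A Ac) \<and>
    ergodic_for Ac (exit_kernel M X A Ac) (exit_measure M X haar A Ac)"
proof (rule F.exit_main)
  show "sets (exit_measure M X haar A Ac) = sets (restrict_space borel Ac)"
    by (simp add: exit_measure_def sets_restrict_haar Ac_subset C.Ac_borel)
  fix f :: "real^'d \<Rightarrow> ennreal" assume f: "f \<in> borel_measurable borel"
  have "C.R (\<lambda>_. 1) \<in> borel_measurable borel" by measurable
  from nn_integral_density_restrict_haar[OF C.Ac_borel Ac_subset this f exit_density]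
  have "(\<integral>\<^sup>+x. f x \<partial>exit_measure M X haar A Ac) = (\<integral>\<^sup>+x. indicator Ac x * (C.R (\<lambda>_. 1) x * f x) \<partial>ext_haar)"
    by (simp add: exit_measure_def)
  also have "\<dots> = (\<integral>\<^sup>+x. f x * C.R (\<lambda>_. 1) x \<partial>ext_haar)"
  proof (rule nn_integral_cong)
    fix x show "indicator Ac x * (C.R (\<lambda>_. 1) x * f x) = f x * C.R (\<lambda>_. 1) x"
      using C.R_outside[of x "\<lambda>_. 1"] by (cases "x \<in> Ac") (simp_all add: mult.commute)
  qed
  finally show "(\<integral>\<^sup>+x. f x \<partial>exit_measure M X haar A Ac) = (\<integral>\<^sup>+x. f x * C.R (\<lambda>_. 1) x \<partial>ext_haar)" .
qed

end

theorem theorem5p2: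
  fixes M :: "'w measure" and X :: "nat \<Rightarrow> 'w \<Rightarrow> real^'d"
    and haar :: "(real^'d) measure" and Z A Ac :: "(real^'d) set"
  assumes "random_walk M X"
    and "topologically_recurrent M X"
    and "Z = state_space M X"
    and "normalized_haar_measure_on Z haar"
    and "A \<subseteq> Z" and "A \<in> sets borel" and "Ac = Z - A"
    and "emeasure haar A > 0" and "emeasure haar Ac > 0"
    and "emeasure haar ((top_of_set Z) frontier_of A) = 0"
  shows "unique_locally_finite_invariant A
           (entrance_kernel M X A Ac) (entrance_measure M X haar A Ac) \<and>
         recurrent_for A (entrance_kernel M X A Ac) (entrance_measure M X haar A Ac) \<and>
         ergodic_for A (entrance_kernel M X A Ac) (entrance_measure M X haar A Ac) \<and>
         unique_locally_finite_invariant Ac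
           (exit_kernel M X A Ac) (exit_measure M X haar A Ac) \<and>
         recurrent_for Ac (exit_kernel M X A Ac) (exit_measure M X haar A Ac) \<and>
         ergodic_for Ac (exit_kernel M X A Ac) (exit_measure M X haar A Ac)"
proof -
  interpret random_walk M X by fact
  have haar: "haar_measure_on Z haar" using assms(4) by (simp add: normalized_haar_measure_on_def)
  then have sets_haar: "sets haar = sets (restrict_space borel Z)"
    by (simp add: haar_measure_on_def locally_finite_borel_measure_on_def)
  have "haar_walk step_law Z (distr haar borel (\<lambda>x. x))"
    unfolding assms(3) by (rule haar_walk_distr[OF recurrent_walk[OF assms(2)] haar[unfolded assms(3)]])
  then obtain Ai Bi where cr: "crossing step_law Z (distr haar borel (\<lambda>x. x)) A (Z - A) Ai Bi"
    by (rule crossing_interiors[OF _ sets_haar assms(5,6,8) assms(9)[unfolded assms(7)] assms(10)]) (rule that)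
  then interpret walk_crossing M X Z haar A Ac Ai Bi
    unfolding assms(7) using random_walk_axioms sets_haar
    by (simp add: walk_crossing_def walk_crossing_axioms_def)
  from entrance_theorem exit_theorem show ?thesis by blast
qed

end
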